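(* Let $d\ge3$, $\epsilon\in(0,1)$, $\delta\in(0,1)$. Suppose the labeling oracle $\mathcal{O}$ satisfies the $\nu$-adversarial noise condition with respect to a unit vector $u$, the initial unit vector $v_0$ satisfies $\theta(v_0,u)\le\frac\pi2$, and $\nu\le c\,\frac{\epsilon}{\ln\frac d\delta+\ln\ln\frac1\epsilon}$ for a sufficiently small absolute constant $c>0$. Run ACTIVE-PERCEPTRON with inputs $\mathcal{O}$, $v_0$, $\epsilon$, $\delta$, sample schedule $m_k=\Theta(d(\ln d+\ln\frac k\delta))$ and band widths $b_k=\Theta\!\left(\frac{2^{-k}}{\sqrt d\,\ln(k m_k/\delta)}\right)$ (with appropriate absolute constants in the $\Theta$'s). Then with probability at least $1-\delta$: (1) the output $v$ satisfies $\mathbb{P}[\operatorname{sign}(v\cdot X)\neq\operatorname{sign}(u\cdot X)]\le\epsilon$; (2) the number of label queries is $O\!\left(d\ln\frac1\epsilon\left(\ln d+\ln\frac1\delta+\ln\ln\frac1\epsilon\right)\right)$; (3) the number of unlabeled examples drawn is $O\!\left(d\left(\ln d+\ln\frac1\delta+\ln\ln\frac1\epsilon\right)^2\frac1\epsilon\ln\frac1\epsilon\right)$; (4) the running time is $O\!\left(d^2\left(\ln d+\ln\frac1\delta+\ln\ln\frac1\epsilon\right)^2\frac1\epsilon\ln\frac1\epsilon\right)$.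
   Context: $\mathbb{S}^{d-1}$ is the unit sphere in $\mathbb{R}^d$; $X$ is uniform on $\mathbb{S}^{d-1}$. Data $(X,Y)\in\mathbb{S}^{d-1}\times\{-1,+1\}$ are drawn from a distribution $D$ whose marginal on $X$ is uniform on $\mathbb{S}^{d-1}$; the oracle $\mathcal{O}$ queried at $x$ returns an independent draw from the conditional law of $Y$ given $X=x$. $\theta(v_1,v_2)=\arccos(v_1\cdot v_2)$. $\nu$-adversarial noise w.r.t. $u$: $\mathbb{P}_D[Y\neq\operatorname{sign}(u\cdot X)]\le\nu$. Procedure MODIFIED-PERCEPTRON$(\mathcal{O},w_0,\theta,\delta,m,b)$: for $t=0,\dots,m-1$: let $R_t=\{x\in\mathbb{S}^{d-1}: \frac b2\le w_t\cdot x\le b\}$; draw unlabeled points uniformly from $\mathbb{S}^{d-1}$ until one lies in $R_t$, call it $x_t$, query $\mathcal{O}$ for its label $y_t$; set $w_{t+1}=w_t-2\,\mathbb{1}\{y_t\,w_t\cdot x_t<0\}(w_t\cdot x_t)\,x_t$. Return $w_m$. Algorithm ACTIVE-PERCEPTRON$(\mathcal{O},v_0,\epsilon,\delta,\{m_k\},\{b_k\})$: let $k_0=\lceil\log_2\frac1\epsilon\rceil$; for $k=1,\dots,k_0$ set $v_k=$ MODIFIED-PERCEPTRON$(\mathcal{O},v_{k-1},\frac{\pi}{2^k},\frac{\delta}{k(k+1)},m_k,b_k)$; return $v_{k_0}$. Running time counts arithmetic operations (processing one example costs $O(d)$).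
   Formalization: ln(1/ε) is read as max(1, ln(1/ε)), and ln ln(1/ε) as the logarithm of that, in the noise condition and the bounds; read literally, the claimed bounds fail for ε near 1 since at least m_1 labels are always queried. *)

theory Defs
  imports "HOL-Probability.Probability"
begin

text \<open>Points of R^d are represented as functions nat => real; only the
coordinates 0..d-1 matter.  The dimension d is an ordinary natural number,
so that the constants in the theorem are absolute (uniform in d).\<close>

type_synonym vec = "nat \<Rightarrow> real"

definition dotp :: "nat \<Rightarrow> vec \<Rightarrow> vec \<Rightarrow> real" where
  "dotp d v x = (\<Sum>i<d. v i * x i)"

definition euclid :: "nat \<Rightarrow> vec measure" where
  "euclid d = PiM {..<d} (\<lambda>_. lborel)"

text \<open>Uniform (normalised surface) measure on the unit sphere S^{d-1}:
sigma(A) = lambda(cone over A)/lambda(unit ball), i.e. the push-forward of the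
uniform distribution on the unit ball under radial projection x |-> x/|x|.\<close>
definition unif_sphere :: "nat \<Rightarrow> vec measure" where
  "unif_sphere d =
     distr (uniform_measure (euclid d) {x \<in> space (euclid d). dotp d x x \<le> 1})
           (euclid d)
           (\<lambda>x. restrict (\<lambda>i. x i / sqrt (dotp d x x)) {..<d})"

definition unif01 :: "real measure" where
  "unif01 = uniform_measure lborel {0..1}"

text \<open>eta x = P(Y = +1 | X = x).  A label drawn with auxiliary uniform r.\<close>
definition label_of :: "(vec \<Rightarrow> real) \<Rightarrow> vec \<Rightarrow> real \<Rightarrow> real" where
  "label_of \<eta> x r = (if r \<le> \<eta> x then 1 else -1)"

definition data_dist :: "nat \<Rightarrow> (vec \<Rightarrow> real) \<Rightarrow> (vec \<times> real) measure" where
  "data_dist d \<eta> =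
     distr (unif_sphere d \<Otimes>\<^sub>M unif01) (euclid d \<Otimes>\<^sub>M borel)
           (\<lambda>(x, r). (x, label_of \<eta> x r))"

definition adversarial_noise :: "nat \<Rightarrow> (vec \<Rightarrow> real) \<Rightarrow> real \<Rightarrow> vec \<Rightarrow> bool" where
  "adversarial_noise d \<eta> \<nu> u \<longleftrightarrow>
     measure (data_dist d \<eta>) {p \<in> space (data_dist d \<eta>). snd p \<noteq> sgn (dotp d u (fst p))} \<le> \<nu>"

text \<open>Probability space of all randomness: an i.i.d. stream of uniform unlabeled
points (fst) and an i.i.d. stream of uniform [0,1] variables (snd); the j-th
label query at point x returns label_of eta x (snd omega j), an independent
draw from the conditional law of Y given X = x.\<close>
definition sample_space :: "nat \<Rightarrow> ((nat \<Rightarrow> vec) \<times> (nat \<Rightarrow> real)) measure" where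
  "sample_space d = PiM UNIV (\<lambda>_::nat. unif_sphere d) \<Otimes>\<^sub>M PiM UNIV (\<lambda>_::nat. unif01)"

definition band_next :: "nat \<Rightarrow> (nat \<Rightarrow> vec) \<Rightarrow> vec \<Rightarrow> real \<Rightarrow> nat \<Rightarrow> nat" where
  "band_next d xs w b i =
     (LEAST n. i \<le> n \<and> b / 2 \<le> dotp d w (xs n) \<and> dotp d w (xs n) \<le> b)"

text \<open>One iteration of MODIFIED-PERCEPTRON.  State (w, N, L): current
weight vector, number of unlabeled points drawn so far, number of labels
queried so far.\<close>
definition perc_step ::
  "nat \<Rightarrow> (vec \<Rightarrow> real) \<Rightarrow> (nat \<Rightarrow> vec) \<times> (nat \<Rightarrow> real) \<Rightarrow> real
     \<Rightarrow> vec \<times> nat \<times> nat \<Rightarrow> vec \<times> nat \<times> nat" where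
  "perc_step d \<eta> \<omega> b s = (case s of (w, N, L) \<Rightarrow>
     let n = band_next d (fst \<omega>) w b N;
         x = fst \<omega> n;
         y = label_of \<eta> x (snd \<omega> L);
         w' = (if y * dotp d w x < 0 then (\<lambda>l. w l - 2 * dotp d w x * x l) else w)
     in (w', Suc n, Suc L))"

text \<open>MODIFIED-PERCEPTRON with m iterations and band width b (the parameters
theta and delta of the procedure are not used by it).\<close>
definition modified_perceptron ::
  "nat \<Rightarrow> (vec \<Rightarrow> real) \<Rightarrow> (nat \<Rightarrow> vec) \<times> (nat \<Rightarrow> real) \<Rightarrow> nat \<Rightarrow> real
     \<Rightarrow> vec \<times> nat \<times> nat \<Rightarrow> vec \<times> nat \<times> nat" where
  "modified_perceptron d \<eta> \<omega> m b s = (perc_step d \<eta> \<omega> b ^^ m) s"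

definition active_perceptron ::
  "nat \<Rightarrow> (vec \<Rightarrow> real) \<Rightarrow> (nat \<Rightarrow> vec) \<times> (nat \<Rightarrow> real) \<Rightarrow> vec \<Rightarrow> real
     \<Rightarrow> (nat \<Rightarrow> nat) \<Rightarrow> (nat \<Rightarrow> real) \<Rightarrow> vec \<times> nat \<times> nat" where
  "active_perceptron d \<eta> \<omega> v0 \<epsilon> m b =
     foldl (\<lambda>s k. modified_perceptron d \<eta> \<omega> (m k) (b k) s) (v0, 0, 0)
           [1..<Suc (nat \<lceil>log 2 (1 / \<epsilon>)\<rceil>)]"

text \<open>Running time (arithmetic operations): each drawn or labelled example is
processed at cost d (inner product / update).\<close>
definition running_time :: "nat \<Rightarrow> nat \<Rightarrow> nat \<Rightarrow> nat" where
  "running_time d N L = d * (N + L)"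

definition sched_m :: "real \<Rightarrow> nat \<Rightarrow> real \<Rightarrow> nat \<Rightarrow> nat" where
  "sched_m cm d \<delta> k = nat \<lceil>cm * real d * (ln (real d) + ln (real k / \<delta>))\<rceil>"

definition sched_b :: "real \<Rightarrow> real \<Rightarrow> nat \<Rightarrow> real \<Rightarrow> nat \<Rightarrow> real" where
  "sched_b cb cm d \<delta> k =
     cb * 2 powr (- real k) / (sqrt (real d) * ln (real k * real (sched_m cm d \<delta> k) / \<delta>))"

text \<open>Convention for logarithmic factors in asymptotic bounds: ln(1/eps) is
read as max 1 (ln(1/eps)), and ln ln(1/eps) as ln of that.\<close>
definition Lg :: "real \<Rightarrow> real" where
  "Lg x = max 1 (ln x)"

end

theory Submission
  imports Defs
begin

text \<open>Write \<open>z = 1 - u \<sqdot> w\<close> for the current vector \<open>w\<close>.  A mistake at \<open>x\<close> in the band reflects \<open>w\<close> and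
  changes \<open>u \<sqdot> w\<close> by \<open>- 2 (w \<sqdot> x) (u \<sqdot> x)\<close>.  Given the band, the component of \<open>x\<close> orthogonal to \<open>w\<close> is rotation
  invariant, so reflections alone determine its second moment and, up to a constant, its fourth moment; hence the
  expected progress is of order \<open>b sin \<theta> / sqrt d\<close>, and noise of small probability within the band spoils only a
  small fraction of it.  Since the second moment of a step is smaller than the drift by a constant factor at
  temperature \<open>\<Lambda>\<close> of order \<open>ln (k m / \<delta>) 4 ^ k\<close>, the potential \<open>exp (\<Lambda> z)\<close> contracts by \<open>1 - const / d\<close> in each
  iteration as long as \<open>z\<close> is of order \<open>4 ^ - k\<close>.  Iterating over \<open>m = const d ln (k m / \<delta>)\<close> steps and applying
  Markov's inequality bounds the failure probability of each epoch.  The number of draws is a sum of dominated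
  geometric waiting times and is controlled by a Chernoff bound.\<close>

section \<open>Reflections preserve Lebesgue measure\<close>

text \<open>Every constant must be uniform in \<open>d\<close>, so laws of projections are not
  computed from densities: reflections transport them, and the only special function that enters is
  the volume ratio of balls in consecutive dimensions. An iteration consumes a random number of
  points. The drift estimate holds only for \<open>miss\<close> between
  \<open>\<tau>\<^sup>2 / 64\<close> and \<open>6 * \<tau>\<^sup>2\<close>; closer to
  \<open>u\<close> the sine of the angle is too small. With
  \<open>\<Lambda> * \<tau>\<^sup>2 = 64 * l\<close>, where \<open>l\<close> is the logarithm in the
  band width, the levels \<open>\<tau>\<^sup>2 / 64\<close>, \<open>\<tau>\<^sup>2 / 16\<close>,
  \<open>4 * \<tau>\<^sup>2\<close> and \<open>6 * \<tau>\<^sup>2\<close> have exponents l, 4 l, 256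
  l and 384 l, so each unwanted crossing costs a power of \<delta> / (k m). Noise is bounded on the
  whole sphere but acts within the band. Its share there is at most \<nu> divided by the band
  probability, which is at least of order \<tau> / l; this dictates \<nu> of order \<epsilon> over a
  logarithm.\<close>

interpretation leb: product_sigma_finite "\<lambda>_::nat. lborel :: real measure"
  by standard

lemma space_euclid: "space (euclid d) = extensional {..<d}"
  by (simp add: euclid_def space_PiM PiE_UNIV_domain PiE_def)

lemma measurable_coord[measurable]: "i < d \<Longrightarrow> (\<lambda>x. x i) \<in> borel_measurable (euclid d)"
  unfolding euclid_def by measurable

lemma dotp_measurable[measurable]: "dotp d v \<in> borel_measurable (euclid d)"
  unfolding dotp_def by (intro borel_measurable_sum borel_measurable_times) auto

lemma dotp_self_measurable[measurable]: "(\<lambda>x. dotp d x x) \<in> borel_measurable (euclid d)"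
  unfolding dotp_def by (intro borel_measurable_sum borel_measurable_times) auto

lemma measurable_euclid:
  assumes "\<And>i. i < d \<Longrightarrow> (\<lambda>x. f x i) \<in> borel_measurable M"
    and "\<And>x. x \<in> space M \<Longrightarrow> f x \<in> extensional {..<d}"
  shows "f \<in> measurable M (euclid d)"
  unfolding euclid_def
  by (rule measurable_PiM_single')
     (use assms in \<open>auto simp: PiE_def Pi_def extensional_def\<close>)

definition preserves :: "'a measure \<Rightarrow> ('a \<Rightarrow> 'a) \<Rightarrow> bool" where
  "preserves M T \<longleftrightarrow> T \<in> measurable M M \<and> distr M M T = M"

lemma preserves_comp: "preserves M S \<Longrightarrow> preserves M T \<Longrightarrow> preserves M (\<lambda>x. S (T x))"
  unfolding preserves_def using distr_distr[of S M M T M] by (auto simp: comp_def)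

lemma preserves_cong: "(\<And>x. x \<in> space M \<Longrightarrow> S x = T x) \<Longrightarrow> preserves M S \<longleftrightarrow> preserves M T"
  unfolding preserves_def by (simp cong: measurable_cong distr_cong)

lemma preserves_nn_integral:
  "preserves M T \<Longrightarrow> f \<in> borel_measurable M \<Longrightarrow> (\<integral>\<^sup>+x. f (T x) \<partial>M) = (\<integral>\<^sup>+x. f x \<partial>M)"
  unfolding preserves_def by (metis nn_integral_distr measurable_distr_eq1)

text \<open>With coordinate \<open>i\<close> integrated innermost, \<open>\<phi>\<close> is constant
  there and the map is a translation of the line, possibly after a change of sign; one-dimensional
  Lebesgue measure is invariant under both.\<close>

lemma preserves_coord_affine:
  assumes i: "i < d" and [measurable]: "\<phi> \<in> borel_measurable (euclid d)"
    and indep: "\<And>x y. \<phi> (x(i := y)) = \<phi> x" and s: "\<bar>s\<bar> = 1"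
  shows "preserves (euclid d) (\<lambda>x. x(i := \<phi> x + s * x i))"
proof -
  let ?T = "\<lambda>x. x(i := \<phi> x + s * x i)"
  have T: "?T \<in> measurable (euclid d) (euclid d)"
  proof (rule measurable_euclid)
    fix j assume "j < d"
    then show "(\<lambda>x. ?T x j) \<in> borel_measurable (euclid d)"
      using i by (cases "j = i") auto
  qed (use i in \<open>auto simp: space_euclid extensional_def\<close>)
  have "distr (euclid d) (euclid d) ?T = euclid d"
  proof (rule measure_eqI)
  fix A assume "A \<in> sets (distr (euclid d) (euclid d) ?T)"
  then have A: "A \<in> sets (euclid d)" by simp
  let ?I = "{..<d} - {i}"
  have ins: "insert i ?I = {..<d}" using i by auto
  have E: "euclid d = PiM (insert i ?I) (\<lambda>_. lborel)" unfolding ins euclid_def ..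
  let ?f = "indicator A :: vec \<Rightarrow> ennreal"
  have f: "?f \<in> borel_measurable (euclid d)" using A by simp
  have fT: "(\<lambda>x. ?f (?T x)) \<in> borel_measurable (euclid d)"
    using measurable_compose[OF T f] .
  have "emeasure (distr (euclid d) (euclid d) ?T) A = (\<integral>\<^sup>+x. ?f x \<partial>distr (euclid d) (euclid d) ?T)"
    using A by simp
  also have "\<dots> = (\<integral>\<^sup>+x. ?f (?T x) \<partial>euclid d)"
    by (rule nn_integral_distr[OF T]) (use f in simp)
  also have "\<dots> = (\<integral>\<^sup>+x. \<integral>\<^sup>+y. ?f (?T (x(i := y))) \<partial>lborel \<partial>PiM ?I (\<lambda>_. lborel))"
    unfolding E by (rule leb.product_nn_integral_insert) (use fT in \<open>simp_all add: E\<close>)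
  also have "\<dots> = (\<integral>\<^sup>+x. \<integral>\<^sup>+y. ?f (x(i := y)) \<partial>lborel \<partial>PiM ?I (\<lambda>_. lborel))"
  proof (rule nn_integral_cong)
    fix x assume x: "x \<in> space (PiM ?I (\<lambda>_. lborel::real measure))"
    have "(\<lambda>y. x(i := y)) \<in> measurable lborel (euclid d)"
    proof (rule measurable_euclid)
      fix j assume "j < d"
      then show "(\<lambda>y. (x(i := y)) j) \<in> borel_measurable lborel" by (cases "j = i") auto
    qed (use i x in \<open>auto simp: space_PiM PiE_def extensional_def\<close>)
    then have [measurable]: "(\<lambda>y. ?f (x(i := y))) \<in> borel_measurable borel"
      using measurable_compose[OF _ f] by (simp add: measurable_lborel1)
    show "(\<integral>\<^sup>+y. ?f (?T (x(i := y))) \<partial>lborel) = (\<integral>\<^sup>+y. ?f (x(i := y)) \<partial>lborel)"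
      using s by (subst (2) nn_integral_real_affine[where c=s and t="\<phi> x"]) (auto simp: indep)
  qed
  also have "\<dots> = (\<integral>\<^sup>+x. ?f x \<partial>euclid d)"
    unfolding E by (rule leb.product_nn_integral_insert[symmetric]) (use f in \<open>simp_all add: E\<close>)
  also have "\<dots> = emeasure (euclid d) A" using A by simp
  finally show "emeasure (distr (euclid d) (euclid d) ?T) A = emeasure (euclid d) A" .
  qed simp
  with T show ?thesis by (simp add: preserves_def)
qed

lemma preserves_shear_from_coord:
  assumes i: "i < d" and J: "finite J" "J \<subseteq> {..<d} - {i}"
  shows "preserves (euclid d) (\<lambda>x j. if j \<in> J then x j + c j * x i else x j)"
  using J
proof (induction J rule: finite_induct)
  case empty
  show ?case by (simp add: preserves_def distr_id2)
next
  case (insert k J)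
  have "preserves (euclid d) (\<lambda>x. x(k := c k * x i + 1 * x k))"
    using insert.prems i by (intro preserves_coord_affine) auto
  from preserves_comp[OF this insert.IH] insert
  have "preserves (euclid d) (\<lambda>x. (\<lambda>x. x(k := c k * x i + 1 * x k)) ((\<lambda>j. if j \<in> J then x j + c j * x i else x j)))"
    by auto
  moreover have "(\<lambda>x. (\<lambda>x. x(k := c k * x i + 1 * x k)) ((\<lambda>j. if j \<in> J then x j + c j * x i else x j)))
    = (\<lambda>x j. if j \<in> insert k J then x j + c j * x i else x j)"
    using insert by (auto simp: fun_eq_iff)
  ultimately show ?case by simp
qed

text \<open>For a unit vector \<open>a\<close> this is the Householder reflection in the hyperplane
  orthogonal to \<open>a\<close>. It has two roles: a symmetry of the sphere and, with
  \<open>a\<close> the accepted point, the perceptron update itself. The restriction keeps values in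
  the extensional carrier of \<open>euclid d\<close>.\<close>

definition hrefl :: "nat \<Rightarrow> vec \<Rightarrow> vec \<Rightarrow> vec" where
  "hrefl d a x = restrict (\<lambda>l. x l - 2 * dotp d a x * a l) {..<d}"

lemma dotp_commute: "dotp d a b = dotp d b a"
  by (simp add: dotp_def mult.commute)

lemma dotp_hrefl: "dotp d v (hrefl d a x) = dotp d v x - 2 * dotp d a x * dotp d v a"
proof -
  have "dotp d v (hrefl d a x) = (\<Sum>i<d. v i * x i - 2 * dotp d a x * (v i * a i))"
    unfolding dotp_def[of d v] hrefl_def by (intro sum.cong) (auto simp: algebra_simps)
  then show ?thesis by (simp add: sum_subtractf sum_distrib_left dotp_def)
qed

lemma dotp_hrefl_hrefl:
  "dotp d a a = 1 \<Longrightarrow> dotp d (hrefl d a x) (hrefl d a y) = dotp d x y"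
  by (simp add: dotp_hrefl dotp_commute[of d "hrefl d a x"] dotp_commute[of d y] dotp_commute[of d x a] algebra_simps)

lemma preserves_hrefl:
  assumes a: "dotp d a a = 1"
  shows "preserves (euclid d) (hrefl d a)"
proof -
  from a obtain i where i: "i < d" "a i \<noteq> 0"
    unfolding dotp_def by (metis (no_types, lifting) lessThan_iff mult_eq_0_iff sum.neutral zero_neq_one)
  let ?J = "{..<d} - {i}"
  define \<phi> where "\<phi> x = (\<Sum>j\<in>?J. a j * x j) / a i" for x
  have [measurable]: "\<phi> \<in> borel_measurable (euclid d)"
    unfolding \<phi>_def by (intro borel_measurable_divide borel_measurable_sum borel_measurable_times) auto
  have \<phi>: "\<phi> (x(i := y)) = \<phi> x" for x y unfolding \<phi>_def by (intro arg_cong2[where f="(/)"] sum.cong) auto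
  have dotp_split: "dotp d v x = v i * x i + (\<Sum>j\<in>?J. v j * x j)" for v x
    unfolding dotp_def using i by (subst sum.remove[of _ i]) auto
  let ?S1 = "\<lambda>x. x(i := \<phi> x + 1 * x i)"
  let ?S2 = "\<lambda>x j. if j \<in> ?J then x j + (- 2 * a j * a i) * x i else x j"
  let ?F = "\<lambda>x. x(i := 0 + (-1) * x i)"
  let ?S3 = "\<lambda>x. x(i := - \<phi> x + 1 * x i)"
  have 1: "preserves (euclid d) ?S1" using i \<phi> by (intro preserves_coord_affine) auto
  have 2: "preserves (euclid d) ?S2" using i preserves_shear_from_coord[of i d ?J] by auto
  have 3: "preserves (euclid d) ?F" using i by (intro preserves_coord_affine) auto
  have 4: "preserves (euclid d) ?S3" using i \<phi> by (intro preserves_coord_affine) auto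
  have pres: "preserves (euclid d) (\<lambda>x. ?S3 (?F (?S2 (?S1 x))))"
    using preserves_comp[OF 4 preserves_comp[OF 3 preserves_comp[OF 2 1]]] .
  have eq: "?S3 (?F (?S2 (?S1 x))) = hrefl d a x" if "x \<in> space (euclid d)" for x
  proof
    have S1i: "?S1 x i = dotp d a x / a i"
      using i by (simp add: \<phi>_def dotp_split field_simps)
    fix l
    show "?S3 (?F (?S2 (?S1 x))) l = hrefl d a x l"
    proof (cases "l = i")
      case True
      have eqs: "(\<Sum>j\<in>?J. a j * x j) = dotp d a x - a i * x i" "(\<Sum>j\<in>?J. a j * a j) = 1 - a i * a i"
        using dotp_split[of a x] dotp_split[of a a] a by auto
      define Y where "Y = ?F (?S2 (?S1 x))"
      have Yi: "Y i = - (dotp d a x / a i)" unfolding Y_def using S1i by simp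
      have "\<phi> Y = (\<Sum>j\<in>?J. a j * (x j - 2 * a j * a i * (dotp d a x / a i))) / a i"
        unfolding Y_def \<phi> using S1i
        by (subst \<phi>_def) (auto intro!: arg_cong2[where f="(/)"] sum.cong)
      also have "\<dots> = ((\<Sum>j\<in>?J. a j * x j) - 2 * (\<Sum>j\<in>?J. a j * a j) * dotp d a x) / a i"
        using i by (auto simp: sum_subtractf sum_distrib_left sum_distrib_right algebra_simps)
      also have "\<dots> = (dotp d a x - a i * x i - 2 * (1 - a i * a i) * dotp d a x) / a i"
        by (simp add: eqs)
      finally have "?S3 Y i = hrefl d a x i" using i by (simp add: Yi hrefl_def field_simps)
      then show ?thesis using True by (simp only: Y_def)
    next
      case False
      then show ?thesis using i S1i that
        by (auto simp: hrefl_def space_euclid extensional_def)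
    qed
  qed
  show ?thesis
    by (rule iffD1[OF preserves_cong pres]) (rule eq)
qed

section \<open>The uniform measure on the sphere\<close>

definition nrm :: "nat \<Rightarrow> vec \<Rightarrow> vec" where
  "nrm d x = restrict (\<lambda>i. x i / sqrt (dotp d x x)) {..<d}"

definition uball :: "nat \<Rightarrow> vec set" where
  "uball d = {x \<in> space (euclid d). dotp d x x \<le> 1}"

lemma nrm_measurable[measurable]: "nrm d \<in> measurable (euclid d) (euclid d)"
  by (rule measurable_euclid) (auto simp: nrm_def)

lemma uball_sets[measurable]: "uball d \<in> sets (euclid d)"
  unfolding uball_def by measurable

lemma emeasure_uball: "emeasure (euclid d) (uball d) = ennreal (unit_ball_vol (real d))"
proof -
  have "uball d = {f. sqrt (\<Sum>i<d. (f i)\<^sup>2) \<le> 1} \<inter> space (euclid d)"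
    by (auto simp: uball_def dotp_def power2_eq_square)
  then show ?thesis
    using emeasure_cball_aux[of "{..<d}" 1] by (simp add: euclid_def)
qed

lemma unif_sphere_eq: "unif_sphere d = distr (uniform_measure (euclid d) (uball d)) (euclid d) (nrm d)"
  unfolding unif_sphere_def uball_def nrm_def ..

lemma sets_unif_sphere[measurable_cong, simp]: "sets (unif_sphere d) = sets (euclid d)"
  by (simp add: unif_sphere_def)

lemma space_unif_sphere[simp]: "space (unif_sphere d) = space (euclid d)"
  by (simp add: unif_sphere_def)

lemma prob_space_unif_sphere: "prob_space (unif_sphere d)"
proof -
  have "0 < unit_ball_vol (real d)" by simp
  then interpret prob_space "uniform_measure (euclid d) (uball d)"
    by (intro prob_space_uniform_measure) (simp_all add: emeasure_uball ennreal_eq_0_iff not_le)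
  show ?thesis unfolding unif_sphere_eq by (rule prob_space_distr) measurable
qed

lemma nn_integral_unif_sphere:
  assumes f[measurable]: "f \<in> borel_measurable (euclid d)"
  shows "(\<integral>\<^sup>+x. f x \<partial>unif_sphere d) = (\<integral>\<^sup>+x. f (nrm d x) * indicator (uball d) x \<partial>euclid d) / unit_ball_vol (real d)"
  unfolding unif_sphere_eq
  by (subst nn_integral_distr, measurable) (simp add: nn_integral_uniform_measure emeasure_uball)

lemma dotp_scale: "dotp d v (restrict (\<lambda>i. x i / c) {..<d}) = dotp d v x / c"
  unfolding dotp_def by (simp add: sum_divide_distrib)

lemma dotp_nrm: "dotp d v (nrm d x) = dotp d v x / sqrt (dotp d x x)"
  unfolding nrm_def by (rule dotp_scale)

lemma dotp_nrm_left: "dotp d (nrm d x) v = dotp d x v / sqrt (dotp d x x)"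
  using dotp_nrm[of d v x] by (simp add: dotp_commute)

lemma dotp_self_nonneg[simp]: "0 \<le> dotp d x x"
  unfolding dotp_def by (intro sum_nonneg) auto

lemma nrm_hrefl:
  assumes "dotp d a a = 1" shows "hrefl d a (nrm d x) = nrm d (hrefl d a x)"
  unfolding hrefl_def[of d a "nrm d x"] nrm_def[of d "hrefl d a x"] dotp_hrefl_hrefl[OF assms] dotp_nrm
  by (auto simp: hrefl_def nrm_def fun_eq_iff diff_divide_distrib)

text \<open>Reflections commute with radial projection and map the unit ball to itself, so the
  invariance descends from Lebesgue measure.\<close>

lemma preserves_hrefl_sphere:
  assumes a: "dotp d a a = 1"
  shows "preserves (unif_sphere d) (hrefl d a)"
  unfolding preserves_def
proof
  have H: "hrefl d a \<in> measurable (euclid d) (euclid d)"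
    using preserves_hrefl[OF a] by (simp add: preserves_def)
  then show H': "hrefl d a \<in> measurable (unif_sphere d) (unif_sphere d)" by (simp cong: measurable_cong_sets)
  show "distr (unif_sphere d) (unif_sphere d) (hrefl d a) = unif_sphere d"
  proof (rule measure_eqI)
    fix A assume "A \<in> sets (distr (unif_sphere d) (unif_sphere d) (hrefl d a))"
    then have A[measurable]: "A \<in> sets (euclid d)" by simp
    note H[measurable]
    have "emeasure (distr (unif_sphere d) (unif_sphere d) (hrefl d a)) A
      = (\<integral>\<^sup>+x. indicator A x \<partial>distr (unif_sphere d) (unif_sphere d) (hrefl d a))"
      by (rule nn_integral_indicator[symmetric]) simp
    also have "\<dots> = (\<integral>\<^sup>+x. indicator A (hrefl d a x) \<partial>unif_sphere d)"
      by (rule nn_integral_distr[OF H']) simp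
    also have "\<dots> = (\<integral>\<^sup>+x. indicator A (hrefl d a (nrm d x)) * indicator (uball d) x \<partial>euclid d) / unit_ball_vol (real d)"
      by (rule nn_integral_unif_sphere) measurable
    also have "(\<integral>\<^sup>+x. indicator A (hrefl d a (nrm d x)) * indicator (uball d) x \<partial>euclid d)
       = (\<integral>\<^sup>+x. indicator A (nrm d (hrefl d a x)) * indicator (uball d) (hrefl d a x) \<partial>euclid d)"
      using measurable_space[OF H]
      by (intro nn_integral_cong) (auto simp: nrm_hrefl[OF a] uball_def indicator_def dotp_hrefl_hrefl[OF a])
    also have "\<dots> = (\<integral>\<^sup>+x. indicator A (nrm d x) * indicator (uball d) x \<partial>euclid d)"
      by (rule preserves_nn_integral[OF preserves_hrefl[OF a], of "\<lambda>x. indicator A (nrm d x) * indicator (uball d) x"]) measurable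
    also have "\<dots> / unit_ball_vol (real d) = (\<integral>\<^sup>+x. indicator A x \<partial>unif_sphere d)"
      by (rule nn_integral_unif_sphere[symmetric]) measurable
    also have "\<dots> = emeasure (unif_sphere d) A" by simp
    finally show "emeasure (distr (unif_sphere d) (unif_sphere d) (hrefl d a)) A = emeasure (unif_sphere d) A" .
  qed simp
qed

section \<open>Joint law of the projections to two orthonormal vectors\<close>

definition orthonormal2 :: "nat \<Rightarrow> vec \<Rightarrow> vec \<Rightarrow> bool" where
  "orthonormal2 d w h \<longleftrightarrow> dotp d w w = 1 \<and> dotp d h h = 1 \<and> dotp d w h = 0"

lemma dotp_cong: "(\<And>i. i < d \<Longrightarrow> v i = w i) \<Longrightarrow> (\<And>i. i < d \<Longrightarrow> x i = y i) \<Longrightarrow> dotp d v x = dotp d w y"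
  unfolding dotp_def by (intro sum.cong) auto

lemma dotp_lin:
  "dotp d v (\<lambda>i. r * x i) = r * dotp d v x"
  "dotp d v (\<lambda>i. x i - y i) = dotp d v x - dotp d v y"
  "dotp d v (\<lambda>i. x i + y i) = dotp d v x + dotp d v y"
  "dotp d (\<lambda>i. r * x i) v = r * dotp d x v"
  "dotp d (\<lambda>i. x i - y i) v = dotp d x v - dotp d y v"
  "dotp d (\<lambda>i. x i + y i) v = dotp d x v + dotp d y v"
  "dotp d v (\<lambda>i. x i / r) = dotp d v x / r"
  "dotp d (\<lambda>i. x i / r) v = dotp d x v / r"
  unfolding dotp_def
  by (simp_all add: sum_distrib_left sum_subtractf sum.distrib sum_divide_distrib algebra_simps)

lemma dotp_self_eq_0: "dotp d x x = 0 \<longleftrightarrow> (\<forall>i<d. x i = 0)"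
  unfolding dotp_def by (subst sum_nonneg_eq_0_iff) auto

text \<open>The reflection along \<open>p - q\<close>. Vectors are compared on coordinates below
  \<open>d\<close> only, hence the first alternative speaks of products instead of
  \<open>p = q\<close>. By the last clause a vector with equal products with \<open>p\<close> and
  \<open>q\<close> is orthogonal to \<open>a\<close> and thus fixed, which allows a second vector to
  be moved without disturbing the first.\<close>

lemma swap_reflection:
  assumes p: "dotp d p p = 1" and q: "dotp d q q = 1"
  obtains "\<And>x. dotp d p x = dotp d q x" |
    a where "dotp d a a = 1" "\<And>x. dotp d p (hrefl d a x) = dotp d q x"
      "\<And>v. dotp d v p = dotp d v q \<Longrightarrow> dotp d v a = 0"
proof (cases "\<forall>i<d. p i = q i")
  case True
  then show thesis using that(1) dotp_cong[of d p q] by metis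
next
  case False
  define e where "e = (\<lambda>i. p i - q i)"
  define n where "n = dotp d e e"
  have n: "n > 0" using False dotp_self_eq_0[of d e] dotp_self_nonneg[of d e]
    by (auto simp: e_def n_def less_le)
  define a where "a = (\<lambda>i. e i / sqrt n)"
  have aa: "dotp d a a = 1" using n by (simp add: a_def dotp_lin n_def[symmetric])
  have n2: "n = 2 - 2 * dotp d p q"
    using p q by (simp add: n_def e_def dotp_lin dotp_commute[of d q p])
  have "dotp d p (hrefl d a x) = dotp d q x" for x
  proof -
    have "2 * dotp d a x * dotp d p a = dotp d e x * (2 * dotp d p e) / n"
      using n by (simp add: a_def dotp_lin field_simps)
    also have "2 * dotp d p e = n" using p n2 by (simp add: e_def dotp_lin)
    finally show ?thesis using n by (simp add: dotp_hrefl e_def dotp_lin)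
  qed
  moreover have "dotp d v p = dotp d v q \<Longrightarrow> dotp d v a = 0" for v
    by (simp add: a_def e_def dotp_lin)
  ultimately show thesis using that(2) aa by blast
qed

lemma dotp_hrefl_move: "dotp d v (hrefl d a x) = dotp d (hrefl d a v) x"
  using dotp_hrefl[of d v a x] dotp_hrefl[of d x a v] dotp_commute[of d "hrefl d a v" x]
    dotp_commute[of d v x] dotp_commute[of d x a] dotp_commute[of d v a] by simp

abbreviation proj2 :: "nat \<Rightarrow> vec \<Rightarrow> vec \<Rightarrow> (real \<times> real) measure" where
  "proj2 d w h \<equiv> distr (unif_sphere d) (borel \<Otimes>\<^sub>M borel) (\<lambda>x. (dotp d w x, dotp d h x))"

lemma proj2_hrefl:
  assumes "dotp d a a = 1"
  shows "proj2 d (hrefl d a w) (hrefl d a h) = proj2 d w h"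
proof -
  note P = preserves_hrefl_sphere[OF assms, unfolded preserves_def]
  have "proj2 d w h = distr (distr (unif_sphere d) (unif_sphere d) (hrefl d a)) (borel \<Otimes>\<^sub>M borel) (\<lambda>x. (dotp d w x, dotp d h x))"
    using P by simp
  also have "\<dots> = proj2 d (hrefl d a w) (hrefl d a h)"
    using P by (subst distr_distr) (auto simp: comp_def dotp_hrefl_move)
  finally show ?thesis ..
qed

text \<open>Two reflections suffice: one carries \<open>w\<close> to \<open>w'\<close>, the other
  carries the image of \<open>h\<close> to \<open>h'\<close>. The second one fixes
  \<open>w'\<close>, because \<open>w'\<close> is orthogonal to both vectors that it
  exchanges.\<close>

theorem proj2_orthonormal:
  assumes "orthonormal2 d w h" "orthonormal2 d w' h'"
  shows "proj2 d w h = proj2 d w' h'"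
proof -
  have second: "proj2 d w' h1 = proj2 d w' h'" if "orthonormal2 d w' h1" for h1
  proof -
    from that assms(2) have "dotp d h1 h1 = 1" "dotp d h' h' = 1"
      and eq: "dotp d w' h1 = dotp d w' h'"
      by (auto simp: orthonormal2_def)
    then show ?thesis
    proof (cases rule: swap_reflection)
      case 1 then show ?thesis by simp
    next
      case (2 a)
      have "dotp d w' (hrefl d a x) = dotp d w' x" for x using 2(3)[OF eq] by (simp add: dotp_hrefl)
      with 2(2) proj2_hrefl[OF 2(1), of w' h1] show ?thesis
        by (simp add: dotp_hrefl_move)
    qed
  qed
  from assms have "dotp d w w = 1" "dotp d w' w' = 1" by (auto simp: orthonormal2_def)
  then show ?thesis
  proof (cases rule: swap_reflection)
    case 1
    then have "orthonormal2 d w' h" using assms by (simp add: orthonormal2_def)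
    with second[OF this] 1 show ?thesis by simp
  next
    case (2 a)
    have w: "dotp d (hrefl d a w) x = dotp d w' x" for x using 2(2) by (simp add: dotp_hrefl_move)
    have "dotp d w' (hrefl d a h) = dotp d (hrefl d a w) (hrefl d a h)" by (simp add: w)
    then have "orthonormal2 d w' (hrefl d a h)"
      using assms dotp_hrefl_hrefl[OF 2(1)] by (simp add: orthonormal2_def)
    from second[OF this] proj2_hrefl[OF 2(1), of w h] show ?thesis by (simp add: w)
  qed
qed

lemma AE_coord_nonzero:
  assumes "i < d" shows "AE x in euclid d. x i \<noteq> 0"
proof (rule AE_I[OF subset_refl])
  let ?A = "{x \<in> space (euclid d). \<not> x i \<noteq> 0}" and ?I = "{..<d} - {i}"
  have ins: "insert i ?I = {..<d}" using assms by auto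
  show A: "?A \<in> sets (euclid d)" using assms by measurable
  have E: "euclid d = PiM (insert i ?I) (\<lambda>_. lborel)" unfolding ins euclid_def ..
  have "emeasure (euclid d) ?A = (\<integral>\<^sup>+x. indicator ?A x \<partial>euclid d)" using A by simp
  also have "\<dots> = (\<integral>\<^sup>+x. \<integral>\<^sup>+y. indicator ?A (x(i := y)) \<partial>lborel \<partial>PiM ?I (\<lambda>_. lborel))"
    unfolding E using A by (intro leb.product_nn_integral_insert) (auto simp: E)
  also have "\<dots> \<le> (\<integral>\<^sup>+x. \<integral>\<^sup>+y. indicator {0} y \<partial>(lborel::real measure) \<partial>PiM ?I (\<lambda>_. lborel :: real measure))"
    by (intro nn_integral_mono) (auto simp: indicator_def)
  also have "\<dots> = 0" by simp
  finally show "emeasure (euclid d) ?A = 0" by simp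
qed

text \<open>Only almost everywhere, since division by zero makes \<open>nrm\<close> send the origin
  to zero. A single nonzero coordinate already excludes the origin.\<close>

lemma AE_unit:
  assumes "0 < d" shows "AE x in unif_sphere d. dotp d x x = 1"
  unfolding unif_sphere_eq
proof (subst AE_distr_iff)
  have "AE x in euclid d. dotp d (nrm d x) (nrm d x) = 1"
    using AE_coord_nonzero[OF assms]
  proof eventually_elim
    case (elim x)
    then have "dotp d x x \<noteq> 0" using assms by (auto simp: dotp_self_eq_0)
    then have "dotp d x x > 0" using dotp_self_nonneg[of d x] by linarith
    then show ?case by (simp add: dotp_nrm dotp_nrm_left)
  qed
  then show "AE x in uniform_measure (euclid d) (uball d). dotp d (nrm d x) (nrm d x) = 1"
    by (intro AE_uniform_measureI) auto
qed measurable

lemma cauchy_schwarz_dotp: "(dotp d v x)\<^sup>2 \<le> dotp d v v * dotp d x x"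
  using Cauchy_Schwarz_ineq_sum[of v x "{..<d}"] by (simp add: dotp_def power2_eq_square)

lemma abs_dotp_le_1: "dotp d v v = 1 \<Longrightarrow> dotp d x x = 1 \<Longrightarrow> \<bar>dotp d v x\<bar> \<le> 1"
  using cauchy_schwarz_dotp[of d v x] by (simp add: abs_square_le_1)

section \<open>Moments on a band\<close>

definition unitv :: "nat \<Rightarrow> vec" where
  "unitv i = (\<lambda>l. if l = i then 1 else 0)"

lemma dotp_unitv: "i < d \<Longrightarrow> dotp d (unitv i) x = x i"
  unfolding dotp_def unitv_def by (simp add: if_distrib[of "\<lambda>c. c * _"] cong: if_cong)

lemma orthonormal2_unitv: "i < d \<Longrightarrow> j < d \<Longrightarrow> i \<noteq> j \<Longrightarrow> orthonormal2 d (unitv i) (unitv j)"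
  by (simp add: orthonormal2_def dotp_unitv) (simp add: unitv_def)

lemma orthonormal2_neg: "orthonormal2 d w h \<Longrightarrow> orthonormal2 d w (\<lambda>l. - h l)"
  using dotp_lin(1)[of d _ "-1" h] dotp_lin(4)[of d "-1" h] by (simp add: orthonormal2_def)

lemma abs_power_le_1: "\<bar>x\<bar> \<le> 1 \<Longrightarrow> \<bar>x ^ n\<bar> \<le> (1::real)"
  by (simp add: power_abs power_le_one)

lemma measurable_unif_sphere[simp]: "measurable (unif_sphere d) N = measurable (euclid d) N"
  by (rule measurable_cong_sets) auto

lemma sphere_law2:
  fixes g :: "real \<Rightarrow> real \<Rightarrow> real"
  assumes "orthonormal2 d w h" "orthonormal2 d w' h'"
    and [measurable]: "case_prod g \<in> borel_measurable (borel \<Otimes>\<^sub>M borel)"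
  shows "(\<integral>x. g (dotp d w x) (dotp d h x) \<partial>unif_sphere d) = (\<integral>x. g (dotp d w' x) (dotp d h' x) \<partial>unif_sphere d)"
proof -
  have eq: "(\<integral>x. g (dotp d w x) (dotp d h x) \<partial>unif_sphere d) = (\<integral>p. case_prod g p \<partial>proj2 d w h)" for w h
    by (subst integral_distr) auto
  show ?thesis unfolding eq proj2_orthonormal[OF assms(1,2)] ..
qed

lemma AE_dotp_le_1:
  assumes "0 < d" "dotp d w w = 1" shows "AE x in unif_sphere d. \<bar>dotp d w x\<bar> \<le> 1"
  using AE_unit[OF assms(1)] by eventually_elim (rule abs_dotp_le_1[OF assms(2)])

lemma AE_coord_le_1:
  assumes "i < d" shows "AE x in unif_sphere d. \<bar>x i\<bar> \<le> 1"
  using AE_dotp_le_1[of d "unitv i"] assms by (simp add: dotp_unitv) (simp add: unitv_def)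

lemma integrable_sphere_bounded:
  assumes "f \<in> borel_measurable (euclid d)" "AE x in unif_sphere d. \<bar>f x\<bar> \<le> (B::real)"
  shows "integrable (unif_sphere d) f"
proof -
  interpret prob_space "unif_sphere d" by (rule prob_space_unif_sphere)
  show ?thesis using assms by (intro integrable_const_bound[where B=B]) (auto cong: measurable_cong_sets)
qed

lemma AE_sum_coord:
  assumes "1 \<le> d" shows "AE x in unif_sphere d. (\<Sum>j=1..<d. (x j)\<^sup>2) = 1 - (x 0)\<^sup>2"
proof -
  have "AE x in unif_sphere d. dotp d x x = 1" using assms by (intro AE_unit) simp
  then show ?thesis
  proof eventually_elim
  case (elim x)
  have "dotp d x x = (x 0)\<^sup>2 + (\<Sum>j=1..<d. (x j)\<^sup>2)"
    using assms unfolding dotp_def lessThan_atLeast0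
    by (subst sum.atLeast_Suc_lessThan) (auto simp: power2_eq_square)
  with elim show ?case by simp
  qed
qed

context
  fixes d :: nat and S :: "real set" and \<psi> :: "real \<Rightarrow> real"
  assumes d: "2 \<le> d" and S[measurable]: "S \<in> sets borel"
  defines "\<psi> \<equiv> indicator S"
begin

lemma psi_measurable[measurable]: "\<psi> \<in> borel_measurable borel"
  unfolding \<psi>_def by measurable

lemma psi_bound: "\<bar>\<psi> s\<bar> \<le> 1" "0 \<le> \<psi> s"
  by (auto simp: \<psi>_def indicator_def)

lemma integrable_psi:
  assumes [measurable]: "f \<in> borel_measurable (euclid d)" and f: "AE x in unif_sphere d. \<bar>f x\<bar> \<le> (B::real)"
  shows "integrable (unif_sphere d) (\<lambda>x. \<psi> (dotp d w x) * f x)"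
proof (rule integrable_sphere_bounded)
  show "AE x in unif_sphere d. \<bar>\<psi> (dotp d w x) * f x\<bar> \<le> B"
    using f by eventually_elim (use psi_bound in \<open>auto simp: abs_mult intro!: mult_left_le_one_le order_trans[OF mult_left_le_one_le]\<close>)
qed measurable

lemma integrable_psi_coord:
  assumes "i < d" shows "integrable (unif_sphere d) (\<lambda>x. \<psi> (x 0) * (x i)^n)"
proof -
  have "integrable (unif_sphere d) (\<lambda>x. \<psi> (dotp d (unitv 0) x) * (x i)^n)"
    using AE_coord_le_1[OF assms] assms
    by (intro integrable_psi[where B=1]) (auto elim!: eventually_mono intro: abs_power_le_1)
  then show ?thesis using d by (simp add: dotp_unitv)
qed

text \<open>Every coordinate other than the zeroth has the same joint law with \<open>x 0\<close>,
  and the squares of these d - 1 coordinates sum to 1 - x_0^2.\<close>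

lemma second_moment_coord:
  "(real d - 1) * (\<integral>x. \<psi> (x 0) * (x 1)\<^sup>2 \<partial>unif_sphere d) = (\<integral>x. \<psi> (x 0) * (1 - (x 0)\<^sup>2) \<partial>unif_sphere d)"
proof -
  have eq: "(\<integral>x. \<psi> (x 0) * (x j)\<^sup>2 \<partial>unif_sphere d) = (\<integral>x. \<psi> (x 0) * (x 1)\<^sup>2 \<partial>unif_sphere d)"
    if "j \<in> {1..<d}" for j
    using sphere_law2[of d "unitv 0" "unitv j" "unitv 0" "unitv 1" "\<lambda>s t. \<psi> s * t\<^sup>2"] that d
    by (simp add: orthonormal2_unitv dotp_unitv)
  have "(\<integral>x. \<psi> (x 0) * (1 - (x 0)\<^sup>2) \<partial>unif_sphere d) = (\<integral>x. (\<Sum>j=1..<d. \<psi> (x 0) * (x j)\<^sup>2) \<partial>unif_sphere d)"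
  proof (rule integral_cong_AE)
    show "AE x in unif_sphere d. \<psi> (x 0) * (1 - (x 0)\<^sup>2) = (\<Sum>j=1..<d. \<psi> (x 0) * (x j)\<^sup>2)"
      using AE_sum_coord[of d] d by (auto simp: sum_distrib_left[symmetric])
    show "(\<lambda>x. \<Sum>j=1..<d. \<psi> (x 0) * (x j)\<^sup>2) \<in> borel_measurable (unif_sphere d)"
      using d by (auto intro!: borel_measurable_sum)
  qed (use d in auto)
  also have "\<dots> = (\<Sum>j=1..<d. \<integral>x. \<psi> (x 0) * (x j)\<^sup>2 \<partial>unif_sphere d)"
    by (intro Bochner_Integration.integral_sum integrable_psi_coord) auto
  also have "\<dots> = (\<Sum>j=1..<d. \<integral>x. \<psi> (x 0) * (x 1)\<^sup>2 \<partial>unif_sphere d)"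
    by (intro sum.cong refl eq)
  also have "\<dots> = (real d - 1) * (\<integral>x. \<psi> (x 0) * (x 1)\<^sup>2 \<partial>unif_sphere d)"
    using d by (simp add: of_nat_diff)
  finally show ?thesis ..
qed

text \<open>The vectors \<open>p\<close> and \<open>q\<close> arise from the axes \<open>i\<close>
  and \<open>j\<close> by a turn of 45 degrees, so their fourth moments are those of the axes. In
  the sum of the expansions of (x_i + x_j)^4 / 4 and (x_i - x_j)^4 / 4 the mixed moment is the only
  unknown.\<close>

lemma mixed_moment_coord:
  assumes i: "i \<in> {1..<d}" and j: "j \<in> {1..<d}" and ij: "i \<noteq> j"
  shows "(\<integral>x. \<psi> (x 0) * ((x i)\<^sup>2 * (x j)\<^sup>2) \<partial>unif_sphere d) = (\<integral>x. \<psi> (x 0) * (x 1)^4 \<partial>unif_sphere d) / 3"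
proof -
  let ?M = "\<integral>x. \<psi> (x 0) * (x 1)^4 \<partial>unif_sphere d"
  let ?r = "sqrt 2"
  define p where "p = (\<lambda>l. (unitv i l + unitv j l) / ?r)"
  define q where "q = (\<lambda>l. (unitv i l - unitv j l) / ?r)"
  have ij': "i < d" "j < d" "i \<noteq> 0" "j \<noteq> 0" using i j by auto
  have nij: "unitv i j = 0" "unitv j i = 0" "unitv i i = 1" "unitv j j = 1" "unitv i 0 = 0" "unitv j 0 = 0"
     "unitv 0 i = 0" "unitv 0 j = 0" "unitv 0 0 = 1" "0 < d" using d ij ij' by (auto simp: unitv_def)
  have op: "orthonormal2 d (unitv 0) p" "orthonormal2 d (unitv 0) q"
    using ij' nij d unfolding orthonormal2_def p_def q_def dotp_lin
    by (simp_all add: dotp_unitv field_simps)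
  have dp: "dotp d p x = (x i + x j) / ?r" "dotp d q x = (x i - x j) / ?r" for x
    using ij' by (auto simp: p_def q_def dotp_lin dotp_unitv)
  have r4: "?r ^ 4 = 4" by (simp add: power4_eq_xxxx)
  have law: "(\<integral>x. \<psi> (x 0) * (dotp d h x)^4 \<partial>unif_sphere d) = ?M" if "orthonormal2 d (unitv 0) h" for h
    using sphere_law2[OF that orthonormal2_unitv[of 0 d 1], of "\<lambda>s t. \<psi> s * t^4"] d
    by (simp add: dotp_unitv)
  have i4: "(\<integral>x. \<psi> (x 0) * (x i)^4 \<partial>unif_sphere d) = ?M"
    using law[of "unitv i"] ij' orthonormal2_unitv[of 0 d i] by (simp add: dotp_unitv)
  have j4: "(\<integral>x. \<psi> (x 0) * (x j)^4 \<partial>unif_sphere d) = ?M"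
    using law[of "unitv j"] ij' orthonormal2_unitv[of 0 d j] by (simp add: dotp_unitv)
  have int2: "integrable (unif_sphere d) (\<lambda>x. \<psi> (x 0) * ((x i)\<^sup>2 * (x j)\<^sup>2))"
  proof -
    have "AE x in unif_sphere d. \<bar>(x i)\<^sup>2 * (x j)\<^sup>2\<bar> \<le> 1"
      using AE_coord_le_1[OF ij'(1)] AE_coord_le_1[OF ij'(2)]
      by eventually_elim (auto simp: abs_mult abs_square_le_1 intro!: mult_le_one)
    then have "integrable (unif_sphere d) (\<lambda>x. \<psi> (dotp d (unitv 0) x) * ((x i)\<^sup>2 * (x j)\<^sup>2))"
      using ij' by (intro integrable_psi[where B=1]) auto
    then show ?thesis using d by (simp add: dotp_unitv)
  qed
  have int4: "integrable (unif_sphere d) (\<lambda>x. \<psi> (x 0) * (dotp d h x)^4)" if "orthonormal2 d (unitv 0) h" for h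
  proof -
    have h1: "AE x in unif_sphere d. \<bar>dotp d h x\<bar> \<le> 1"
      using AE_dotp_le_1[of d h] that d by (simp add: orthonormal2_def)
    have "AE x in unif_sphere d. \<bar>(dotp d h x)^4\<bar> \<le> 1"
      using h1 by eventually_elim (rule abs_power_le_1)
    then have "integrable (unif_sphere d) (\<lambda>x. \<psi> (dotp d (unitv 0) x) * (dotp d h x)^4)"
      using ij' by (intro integrable_psi[where B=1]) auto
    then show ?thesis using d by (simp add: dotp_unitv)
  qed
  note ints = int4[OF op(1)] int4[OF op(2)] integrable_psi_coord[OF ij'(1), of 4] integrable_psi_coord[OF ij'(2), of 4] int2
  have poly: "((s + t) / ?r)^4 + ((s - t) / ?r)^4 = 1/2 * s^4 + 1/2 * t^4 + 3 * (s\<^sup>2 * t\<^sup>2)" for s t :: real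
    unfolding power_divide r4 by (simp add: power4_eq_xxxx power2_eq_square field_simps)
  have "?M + ?M = (\<integral>x. \<psi> (x 0) * (dotp d p x)^4 + \<psi> (x 0) * (dotp d q x)^4 \<partial>unif_sphere d)"
    by (subst Bochner_Integration.integral_add) (simp_all only: ints law[OF op(1)] law[OF op(2)])
  also have "\<dots> = (\<integral>x. 1/2 * (\<psi> (x 0) * (x i)^4) + 1/2 * (\<psi> (x 0) * (x j)^4) + 3 * (\<psi> (x 0) * ((x i)\<^sup>2 * (x j)\<^sup>2)) \<partial>unif_sphere d)"
    unfolding dp distrib_left[symmetric] poly by (simp add: algebra_simps)
  also have "\<dots> = 1/2 * ?M + 1/2 * ?M + 3 * (\<integral>x. \<psi> (x 0) * ((x i)\<^sup>2 * (x j)\<^sup>2) \<partial>unif_sphere d)"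
    using ints by (simp add: i4 j4)
  finally show ?thesis by simp
qed

text \<open>The square of the sum of the x_j^2 is at most one. Expanded as a double sum, each of its
  d - 1 rows has one diagonal entry M and d - 2 entries M / 3, that is (d + 1) M / 3.\<close>

lemma fourth_moment_coord:
  "(real d - 1) * (real d + 1) / 3 * (\<integral>x. \<psi> (x 0) * (x 1)^4 \<partial>unif_sphere d) \<le> (\<integral>x. \<psi> (x 0) \<partial>unif_sphere d)"
proof -
  let ?M = "\<integral>x. \<psi> (x 0) * (x 1)^4 \<partial>unif_sphere d"
  have d1: "1 \<le> d" and d0: "0 < d" using d by auto
  have eq: "(\<integral>x. \<psi> (x 0) * (x j)^4 \<partial>unif_sphere d) = ?M"
    if "j \<in> {1..<d}" for j
    using sphere_law2[of d "unitv 0" "unitv j" "unitv 0" "unitv 1" "\<lambda>s t. \<psi> s * t^4"] that d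
    by (simp add: orthonormal2_unitv dotp_unitv)
  have eq2: "(\<integral>x. \<psi> (x 0) * ((x i)\<^sup>2 * (x j)\<^sup>2) \<partial>unif_sphere d) = (if i = j then ?M else ?M / 3)"
    if "i \<in> {1..<d}" "j \<in> {1..<d}" for i j
    using mixed_moment_coord[OF that] eq[OF that(1)] by (auto simp: power2_eq_square power4_eq_xxxx mult.assoc)
  have int2: "integrable (unif_sphere d) (\<lambda>x. \<psi> (x 0) * ((x i)\<^sup>2 * (x j)\<^sup>2))"
    if "i \<in> {1..<d}" "j \<in> {1..<d}" for i j
  proof -
    have ij': "i < d" "j < d" using that by auto
    have "AE x in unif_sphere d. \<bar>(x i)\<^sup>2 * (x j)\<^sup>2\<bar> \<le> 1"
      using AE_coord_le_1[OF ij'(1)] AE_coord_le_1[OF ij'(2)]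
      by eventually_elim (auto simp: abs_mult abs_square_le_1 intro!: mult_le_one)
    then have "integrable (unif_sphere d) (\<lambda>x. \<psi> (dotp d (unitv 0) x) * ((x i)\<^sup>2 * (x j)\<^sup>2))"
      using ij' by (intro integrable_psi[where B=1]) auto
    then show ?thesis using d by (simp add: dotp_unitv)
  qed
  have row: "(\<Sum>j=1..<d. if i = j then ?M else ?M / 3) = (real d + 1) / 3 * ?M" if "i \<in> {1..<d}" for i
  proof -
    have "(\<Sum>j=1..<d. if i = j then ?M else ?M / 3) = (\<Sum>j=1..<d. (if i = j then 2 * ?M / 3 else 0) + ?M / 3)"
      by (intro sum.cong) auto
    also have "\<dots> = 2 * ?M / 3 + (real d - 1) * ?M / 3"
      using that d by (subst sum.distrib) (simp add: of_nat_diff)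
    finally show ?thesis by (simp add: field_simps)
  qed
  have "(real d - 1) * (real d + 1) / 3 * ?M = (\<Sum>i=1..<d. (real d + 1) / 3 * ?M)"
    using d by (simp add: of_nat_diff)
  also have "\<dots> = (\<Sum>i=1..<d. \<Sum>j=1..<d. if i = j then ?M else ?M / 3)"
    by (intro sum.cong refl row[symmetric])
  also have "\<dots> = (\<Sum>i=1..<d. \<Sum>j=1..<d. \<integral>x. \<psi> (x 0) * ((x i)\<^sup>2 * (x j)\<^sup>2) \<partial>unif_sphere d)"
    by (intro sum.cong refl) (simp add: eq2)
  also have "\<dots> = (\<integral>x. (\<Sum>i=1..<d. \<Sum>j=1..<d. \<psi> (x 0) * ((x i)\<^sup>2 * (x j)\<^sup>2)) \<partial>unif_sphere d)"
    by (subst Bochner_Integration.integral_sum, intro Bochner_Integration.integrable_sum int2, assumption, assumption)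
      (intro sum.cong refl Bochner_Integration.integral_sum[symmetric] int2)
  also have "\<dots> \<le> (\<integral>x. \<psi> (x 0) \<partial>unif_sphere d)"
  proof (rule integral_mono_AE)
    show "integrable (unif_sphere d) (\<lambda>x. \<Sum>i=1..<d. \<Sum>j=1..<d. \<psi> (x 0) * ((x i)\<^sup>2 * (x j)\<^sup>2))"
      by (intro Bochner_Integration.integrable_sum int2)
    show "integrable (unif_sphere d) (\<lambda>x. \<psi> (x 0))"
      using integrable_psi_coord[of 0 0] d by simp
    show "AE x in unif_sphere d. (\<Sum>i=1..<d. \<Sum>j=1..<d. \<psi> (x 0) * ((x i)\<^sup>2 * (x j)\<^sup>2)) \<le> \<psi> (x 0)"
      using AE_sum_coord[OF d1] AE_coord_le_1[OF d0]
    proof eventually_elim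
      case (elim x)
      have "(\<Sum>i=1..<d. \<Sum>j=1..<d. \<psi> (x 0) * ((x i)\<^sup>2 * (x j)\<^sup>2)) = \<psi> (x 0) * (\<Sum>j=1..<d. (x j)\<^sup>2)\<^sup>2"
        by (simp add: sum_distrib_left[symmetric] power2_eq_square sum_product)
      also have "\<dots> = \<psi> (x 0) * (1 - (x 0)\<^sup>2)\<^sup>2" using elim by simp
      also have "\<dots> \<le> \<psi> (x 0) * 1"
        using elim by (intro mult_left_mono psi_bound power_le_one) (auto simp: abs_square_le_1)
      finally show ?case by simp
    qed
  qed
  finally show ?thesis .
qed

end


locale band =
  fixes d :: nat and w h :: vec and b :: real and S :: "real set" and p :: real and \<psi> :: "real \<Rightarrow> real"
  assumes d: "2 \<le> d" and on: "orthonormal2 d w h"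
    and S[measurable]: "S \<in> sets borel" and Sb: "S \<subseteq> {-b..b}" and b: "b\<^sup>2 \<le> 1/18"
  defines "\<psi> \<equiv> indicator S"
    and "p \<equiv> (\<integral>x. \<psi> (dotp d w x) \<partial>unif_sphere d)"
begin

lemma psi_meas[measurable]: "\<psi> \<in> borel_measurable borel"
  unfolding \<psi>_def by measurable

lemma psi_b: "\<psi> s * s\<^sup>2 \<le> \<psi> s * b\<^sup>2" "0 \<le> \<psi> s"
  using Sb by (force simp: \<psi>_def indicator_def intro!: abs_le_square_iff[THEN iffD1])+

lemma coords: "0 < d" "1 < d" "dotp d w w = 1" "dotp d h h = 1" "orthonormal2 d (unitv 0) (unitv 1)"
  using d on orthonormal2_unitv[of 0 d 1] by (auto simp: orthonormal2_def)

lemma integrable_band: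
  assumes [measurable]: "f \<in> borel_measurable (euclid d)" and f: "AE x in unif_sphere d. \<bar>f x\<bar> \<le> (B::real)"
  shows "integrable (unif_sphere d) (\<lambda>x. \<psi> (dotp d w x) * f x)"
  using integrable_psi[OF d S assms] unfolding \<psi>_def .

lemma law: 
  assumes [measurable]: "case_prod g \<in> borel_measurable (borel \<Otimes>\<^sub>M borel)"
  shows "(\<integral>x. \<psi> (dotp d w x) * g (dotp d w x) (dotp d h x) \<partial>unif_sphere d) = (\<integral>x. \<psi> (x 0) * g (x 0) (x 1) \<partial>unif_sphere d)"
  using sphere_law2[OF on coords(5), of "\<lambda>s t. \<psi> s * g s t"] coords(1,2) by (simp add: dotp_unitv)

lemma p_nonneg: "0 \<le> p"
  unfolding p_def using psi_b by (intro Bochner_Integration.integral_nonneg) auto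

lemma AE_h: "AE x in unif_sphere d. \<bar>dotp d h x\<bar> \<le> 1" "AE x in unif_sphere d. \<bar>dotp d w x\<bar> \<le> 1"
  using coords by (auto intro!: AE_dotp_le_1)

lemma integrable_h: "integrable (unif_sphere d) (\<lambda>x. \<psi> (dotp d w x) * (dotp d h x)^n)"
  using AE_h(1) by (intro integrable_band[where B=1]) (auto elim!: eventually_mono intro: abs_power_le_1)

lemma integrable_w: "integrable (unif_sphere d) (\<lambda>x. \<psi> (dotp d w x) * (dotp d w x)^n)"
  using AE_h(2) by (intro integrable_band[where B=1]) (auto elim!: eventually_mono intro: abs_power_le_1)

lemma integrable_psi_w: "integrable (unif_sphere d) (\<lambda>x. \<psi> (dotp d w x))"
  using integrable_w[of 0] by simp

lemma second_moment: 
  "(real d - 1) * (\<integral>x. \<psi> (dotp d w x) * (dotp d h x)\<^sup>2 \<partial>unif_sphere d)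
     = p - (\<integral>x. \<psi> (dotp d w x) * (dotp d w x)\<^sup>2 \<partial>unif_sphere d)"
proof -
  have "p - (\<integral>x. \<psi> (dotp d w x) * (dotp d w x)\<^sup>2 \<partial>unif_sphere d)
    = (\<integral>x. \<psi> (dotp d w x) * (1 - (dotp d w x)\<^sup>2) \<partial>unif_sphere d)"
    unfolding p_def using integrable_psi_w integrable_w[of 2] by (simp add: right_diff_distrib)
  then show ?thesis
    using second_moment_coord[OF d S, folded \<psi>_def] law[of "\<lambda>s t. t\<^sup>2"] law[of "\<lambda>s t. 1 - s\<^sup>2"]
    by simp
qed

lemma second_moment_upper:
  "(\<integral>x. \<psi> (dotp d w x) * (dotp d h x)\<^sup>2 \<partial>unif_sphere d) \<le> p / (real d - 1)"
proof -
  have "0 \<le> (\<integral>x. \<psi> (dotp d w x) * (dotp d w x)\<^sup>2 \<partial>unif_sphere d)"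
    using psi_b by (intro Bochner_Integration.integral_nonneg) auto
  then show ?thesis using second_moment d by (simp add: field_simps)
qed

lemma second_moment_lower:
  "p * (1 - b\<^sup>2) / (real d - 1) \<le> (\<integral>x. \<psi> (dotp d w x) * (dotp d h x)\<^sup>2 \<partial>unif_sphere d)"
proof -
  have "(\<integral>x. \<psi> (dotp d w x) * (dotp d w x)\<^sup>2 \<partial>unif_sphere d) \<le> (\<integral>x. \<psi> (dotp d w x) * b\<^sup>2 \<partial>unif_sphere d)"
    using psi_b integrable_w[of 2] integrable_psi_w by (intro integral_mono) auto
  also have "\<dots> = p * b\<^sup>2" unfolding p_def by simp
  finally show ?thesis using second_moment d by (simp add: field_simps)
qed

lemma fourth_moment_upper:
  "(\<integral>x. \<psi> (dotp d w x) * (dotp d h x)^4 \<partial>unif_sphere d) \<le> 3 * p / ((real d - 1) * (real d + 1))"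
proof -
  have "0 < (real d - 1) * (real d + 1)" using d by simp
  then show ?thesis
    using fourth_moment_coord[OF d S, folded \<psi>_def] law[of "\<lambda>s t. t^4"] law[of "\<lambda>s t. 1"]
    unfolding p_def by (simp add: field_simps)
qed

text \<open>The minorant touches at \<open>\<alpha> |s| = 3/2\<close>; it turns moments of order two and four into a lower bound for
  the first absolute moment.\<close>

lemma quartic_minorant:
  fixes s \<alpha> :: real assumes "0 \<le> \<alpha>"
  shows "\<alpha> * s\<^sup>2 - 4/27 * \<alpha>^3 * s^4 \<le> \<bar>s\<bar>"
proof -
  define y where "y = \<alpha> * \<bar>s\<bar>"
  have y: "0 \<le> y" using assms by (simp add: y_def)
  have "1 - y + 4/27 * y^3 = (y + 3) * (2 * y - 3)\<^sup>2 / 27" by algebra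
  also have "\<dots> \<ge> 0" using y by simp
  finally have "0 \<le> \<bar>s\<bar> * (1 - y + 4/27 * y^3)" by (intro mult_nonneg_nonneg) auto
  also have "\<dots> = \<bar>s\<bar> - \<alpha> * \<bar>s\<bar>^2 + 4/27 * \<alpha>^3 * \<bar>s\<bar>^4" unfolding y_def by algebra
  finally show ?thesis by (simp add: power_even_abs)
qed

text \<open>The minorant is taken at scale \<open>sqrt (real d)\<close>, the inverse of the typical
  size of h.x; then its terms of order two and four both have order p / sqrt d.\<close>

lemma abs_moment_lower:
  "p / (2 * sqrt (real d)) \<le> (\<integral>x. \<psi> (dotp d w x) * \<bar>dotp d h x\<bar> \<partial>unif_sphere d)"
proof -
  let ?a = "sqrt (real d)"
  define M2 where "M2 = (\<integral>x. \<psi> (dotp d w x) * (dotp d h x)\<^sup>2 \<partial>unif_sphere d)"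
  define M4 where "M4 = (\<integral>x. \<psi> (dotp d w x) * (dotp d h x)^4 \<partial>unif_sphere d)"
  have a: "0 < ?a" "?a * ?a = d" "?a ^ 3 = d * ?a" using d by (auto simp: power3_eq_cube)
  have "?a * M2 - 4/27 * ?a^3 * M4 = (\<integral>x. \<psi> (dotp d w x) * (?a * (dotp d h x)\<^sup>2 - 4/27 * ?a^3 * (dotp d h x)^4) \<partial>unif_sphere d)"
  proof -
    have "(\<integral>x. \<psi> (dotp d w x) * (?a * (dotp d h x)\<^sup>2 - 4/27 * ?a^3 * (dotp d h x)^4) \<partial>unif_sphere d)
      = (\<integral>x. ?a * (\<psi> (dotp d w x) * (dotp d h x)\<^sup>2) - (4/27 * ?a^3) * (\<psi> (dotp d w x) * (dotp d h x)^4) \<partial>unif_sphere d)"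
      by (simp add: algebra_simps)
    then show ?thesis unfolding M2_def M4_def using integrable_h[of 2] integrable_h[of 4] by simp
  qed
  also have "\<dots> \<le> (\<integral>x. \<psi> (dotp d w x) * \<bar>dotp d h x\<bar> \<partial>unif_sphere d)"
  proof (rule integral_mono)
    show "integrable (unif_sphere d) (\<lambda>x. \<psi> (dotp d w x) * \<bar>dotp d h x\<bar>)"
      using AE_h(1) by (intro integrable_band[where B=1]) auto
    show "integrable (unif_sphere d) (\<lambda>x. \<psi> (dotp d w x) * (?a * (dotp d h x)\<^sup>2 - 4/27 * ?a^3 * (dotp d h x)^4))"
      using integrable_h[of 2] integrable_h[of 4] by (simp add: right_diff_distrib mult.left_commute[of "\<psi> _"])
  qed (use quartic_minorant[of ?a] psi_b in \<open>auto intro!: mult_left_mono\<close>)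
  also have "p / (2 * ?a) \<le> ?a * M2 - 4/27 * ?a^3 * M4"
  proof -
    have d1: "real d - 1 > 0" using d by simp
    have "?a * (p * (1 - b\<^sup>2) / (real d - 1)) - 4/27 * ?a^3 * (3 * p / ((real d - 1) * (real d + 1))) \<le> ?a * M2 - 4/27 * ?a^3 * M4"
      using second_moment_lower fourth_moment_upper unfolding M2_def M4_def
      by (intro diff_mono mult_left_mono) auto
    moreover have alg: "?a * (p * (1 - b\<^sup>2) / D) - 4/27 * (d * ?a) * (3 * p / (D * E)) = (?a * p / D) * (1 - b\<^sup>2 - 4/9 * (d / E))"
      if "D \<noteq> 0" "E \<noteq> 0" for D E :: real using that by (simp add: field_simps)
    moreover have "?a * (p * (1 - b\<^sup>2) / (real d - 1)) - 4/27 * ?a^3 * (3 * p / ((real d - 1) * (real d + 1)))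
       = (?a * p / (real d - 1)) * (1 - b\<^sup>2 - 4/9 * (d / (real d + 1)))"
      unfolding a(3) using d1
      by (intro alg) auto
    moreover have "(?a * p / (real d - 1)) * (1/2) \<le> (?a * p / (real d - 1)) * (1 - b\<^sup>2 - 4/9 * (d / (real d + 1)))"
    proof (rule mult_left_mono)
      \<comment> \<open>The quartic term takes at most 4/9, and 1 - 4/9 - 1/18 = 1/2: this is the
        origin of the bound 1/18 on the squared width.\<close>
      have "d / (real d + 1) \<le> 1" by simp
      then show "1/2 \<le> 1 - b\<^sup>2 - 4/9 * (d / (real d + 1))" using b by linarith
    qed (use p_nonneg d1 in auto)
    moreover have "p / (2 * ?a) \<le> (?a * p / (real d - 1)) * (1/2)"
    proof -
      have "p / ?a = p * ?a / d" using a(1,2) by (simp add: field_simps)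
      also have "\<dots> \<le> p * ?a / (real d - 1)" using p_nonneg d1 by (intro divide_left_mono) auto
      finally have "p / ?a * (1/2) \<le> p * ?a / (real d - 1) * (1/2)" by (rule mult_right_mono) simp
      then show ?thesis by (simp add: mult.commute)
    qed
    ultimately show ?thesis by linarith
  qed
  finally show ?thesis by (simp add: order_trans)
qed

text \<open>Replacing \<open>h\<close> by its negative does not change the joint law with w.x, so
  the negative part carries half of the absolute moment. It is this half that drives progress: a
  correct label causes an update only where u.x is negative.\<close>

lemma neg_part_lower:
  "p / (4 * sqrt (real d)) \<le> (\<integral>x. \<psi> (dotp d w x) * max 0 (- dotp d h x) \<partial>unif_sphere d)"
proof -
  have eq: "(\<integral>x. \<psi> (dotp d w x) * max 0 (- dotp d h x) \<partial>unif_sphere d) = (\<integral>x. \<psi> (dotp d w x) * max 0 (dotp d h x) \<partial>unif_sphere d)"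
    using sphere_law2[OF on orthonormal2_neg[OF on], of "\<lambda>s t. \<psi> s * max 0 (- t)"]
      dotp_lin(4)[of d "-1" h] by simp
  have int: "integrable (unif_sphere d) (\<lambda>x. \<psi> (dotp d w x) * max 0 (- dotp d h x))"
     "integrable (unif_sphere d) (\<lambda>x. \<psi> (dotp d w x) * max 0 (dotp d h x))"
    using AE_h(1) by (auto intro!: integrable_band[where B=1])
  have "(\<integral>x. \<psi> (dotp d w x) * \<bar>dotp d h x\<bar> \<partial>unif_sphere d)
    = (\<integral>x. \<psi> (dotp d w x) * max 0 (- dotp d h x) + \<psi> (dotp d w x) * max 0 (dotp d h x) \<partial>unif_sphere d)"
    by (intro Bochner_Integration.integral_cong) (auto simp: max_def)
  with int eq abs_moment_lower show ?thesis by simp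
qed

end

section \<open>Band probabilities and disagreement\<close>

lemma unit_ball_vol_log_concave:
  assumes "1 \<le> (n::nat)"
  shows "unit_ball_vol (real n - 1) * unit_ball_vol (real n + 1) \<le> (unit_ball_vol (real n))\<^sup>2"
proof -
  define x where "x = real n / 2 + 1/2"
  have x: "x > 0" by (simp add: x_def)
  have G: "Gamma x > 0" "Gamma (x + 1) > 0" "Gamma (x + 1/2) > 0" using x by (auto intro!: Gamma_real_pos)
  have "(ln \<circ> Gamma) ((1 - 1/2) *\<^sub>R x + (1/2) *\<^sub>R (x + 1)) \<le> (1 - 1/2) * (ln \<circ> Gamma) x + (1/2) * (ln \<circ> Gamma) (x + 1)"
    using x by (intro convex_onD[OF log_convex_Gamma_real]) auto
  then have "2 * ln (Gamma (x + 1/2)) \<le> ln (Gamma x) + ln (Gamma (x + 1))"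
    by (simp add: field_simps)
  also have "\<dots> = ln (Gamma x * Gamma (x + 1))" using G by (simp add: ln_mult)
  also have "2 * ln (Gamma (x + 1/2)) = ln ((Gamma (x + 1/2))\<^sup>2)" using G by (simp add: ln_realpow)
  finally have le: "(Gamma (x + 1/2))\<^sup>2 \<le> Gamma x * Gamma (x + 1)" using G by simp
  have e: "(real n - 1) / 2 + 1 = x" "(real n + 1) / 2 + 1 = x + 1" "real n / 2 + 1 = x + 1/2"
    by (auto simp: x_def field_simps)
  have "unit_ball_vol (real n - 1) * unit_ball_vol (real n + 1) = pi powr real n / (Gamma x * Gamma (x + 1))"
    unfolding unit_ball_vol_def e by (simp add: powr_add[symmetric] field_simps)
  also have "\<dots> \<le> pi powr real n / (Gamma (x + 1/2))\<^sup>2"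
    using le G by (intro divide_left_mono) auto
  also have "\<dots> = (unit_ball_vol (real n))\<^sup>2"
    unfolding unit_ball_vol_def e power_divide by (simp add: power2_eq_square powr_add[symmetric])
  finally show ?thesis .
qed

lemma unit_ball_vol_plus2: "0 \<le> x \<Longrightarrow> unit_ball_vol (x + 2) = unit_ball_vol x * (2 * pi / (x + 2))"
proof -
  assume x: "0 \<le> x"
  define P G where "P = pi powr (x / 2)" and "G = Gamma (x / 2 + 1)"
  have G: "G > 0" using x by (auto simp: G_def intro!: Gamma_real_pos)
  have "Gamma (x / 2 + 1 + 1) = (x / 2 + 1) * G"
    unfolding G_def
  proof (rule Gamma_plus1)
    show "x / 2 + 1 \<notin> \<int>\<^sub>\<le>\<^sub>0" using x by (auto elim!: nonpos_Ints_cases)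
  qed
  moreover have "pi powr (x / 2 + 1) = P * pi" by (simp add: powr_add P_def)
  moreover have "(x + 2) / 2 = x / 2 + 1" by simp
  ultimately have "unit_ball_vol (x + 2) = P * pi / ((x / 2 + 1) * G)"
    by (simp only: unit_ball_vol_def)
  also have "\<dots> = P / G * (2 * pi / (x + 2))" using x G by (simp add: field_simps)
  finally show ?thesis by (simp add: unit_ball_vol_def P_def G_def)
qed

text \<open>Log-concavity at d - 1, which is midpoint log-convexity of Gamma, bounds V_(d-2) V_d by
  V_(d-1)^2, and the two-step recursion trades V_(d-2) for V_d. The companion upper bound uses
  log-concavity at d. Together they fix the order sqrt d of the ratio without Stirling's
  formula.\<close>

lemma unit_ball_vol_ratio_lower:
  assumes "2 \<le> d"
  shows "sqrt (real d / (2 * pi)) * unit_ball_vol (real d) \<le> unit_ball_vol (real (d - 1))"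
proof -
  let ?V = unit_ball_vol
  have "?V (real d - 2) * ?V (real d) \<le> (?V (real d - 1))\<^sup>2"
    using unit_ball_vol_log_concave[of "d - 1"] assms by (simp add: of_nat_diff)
  moreover have "?V (real d - 2) = ?V (real d) * (real d / (2 * pi))"
    using unit_ball_vol_plus2[of "real d - 2"] assms by simp
  ultimately have "(sqrt (real d / (2 * pi)) * ?V (real d))\<^sup>2 \<le> (?V (real d - 1))\<^sup>2"
    using assms by (simp add: power_mult_distrib power2_eq_square[of "?V (real d)"] mult_ac)
  then show ?thesis using assms by (simp add: of_nat_diff power2_le_iff_abs_le)
qed

lemma unit_ball_vol_ratio_upper:
  assumes "1 \<le> d"
  shows "unit_ball_vol (real (d - 1)) \<le> sqrt ((real d + 1) / (2 * pi)) * unit_ball_vol (real d)"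
proof -
  let ?V = unit_ball_vol
  have "?V (real d - 1) * ?V (real d + 1) \<le> (?V (real d))\<^sup>2"
    using unit_ball_vol_log_concave[of "d"] assms by (simp add: of_nat_diff)
  moreover have "?V (real d + 1) = ?V (real d - 1) * (2 * pi / (real d + 1))"
    using unit_ball_vol_plus2[of "real d - 1"] assms by (simp add: add.commute)
  ultimately have "(?V (real d - 1))\<^sup>2 * (2 * pi / (real d + 1)) \<le> (?V (real d))\<^sup>2"
    by (simp add: power2_eq_square mult.assoc)
  then have "(?V (real d - 1))\<^sup>2 \<le> (real d + 1) / (2 * pi) * (?V (real d))\<^sup>2"
    by (simp add: field_simps)
  then have "(?V (real d - 1))\<^sup>2 \<le> (sqrt ((real d + 1) / (2 * pi)) * ?V (real d))\<^sup>2"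
    by (simp add: power_mult_distrib)
  then show ?thesis using assms by (simp add: of_nat_diff power2_le_iff_abs_le)
qed

section \<open>Slicing along the first coordinate\<close>

definition tailsq :: "nat \<Rightarrow> vec \<Rightarrow> real" where
  "tailsq d x = (\<Sum>j=1..<d. (x j)\<^sup>2)"

lemma dotp_self_split: "0 < d \<Longrightarrow> dotp d x x = (x 0)\<^sup>2 + tailsq d x"
  unfolding dotp_def tailsq_def lessThan_atLeast0
  by (subst sum.atLeast_Suc_lessThan) (auto simp: power2_eq_square)

lemma tailsq_upd[simp]: "tailsq d (x(0 := s)) = tailsq d x"
  unfolding tailsq_def by (intro sum.cong) auto

lemma tailsq_nonneg[simp]: "0 \<le> tailsq d x"
  unfolding tailsq_def by (intro sum_nonneg) auto

abbreviation euclid_tail :: "nat \<Rightarrow> vec measure" where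
  "euclid_tail d \<equiv> PiM {1..<d} (\<lambda>_. lborel)"

lemma measurable_tail_coord[measurable]:
  "j \<in> {1..<d} \<Longrightarrow> (\<lambda>x. x j) \<in> borel_measurable (euclid_tail d)"
  using measurable_component_singleton[of j "{1..<d}" "\<lambda>_. lborel :: real measure"] by (simp add: measurable_lborel2)

lemma tailsq_measurable[measurable]:
  "tailsq d \<in> borel_measurable (euclid d)" "tailsq d \<in> borel_measurable (euclid_tail d)"
  unfolding tailsq_def by (intro borel_measurable_sum borel_measurable_power measurable_coord measurable_tail_coord; simp)+

lemma emeasure_tail_ball:
  assumes "0 < r"
  shows "emeasure (euclid_tail d) {y \<in> space (euclid_tail d). sqrt (tailsq d y) \<le> r} = ennreal (unit_ball_vol (real (d - 1)) * r ^ (d - 1))"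
  using emeasure_cball_aux[OF _ assms, of "{1..<d}"]
  by (simp add: tailsq_def Int_def conj_commute)

lemma nn_integral_euclid_split:
  assumes "0 < d" "f \<in> borel_measurable (euclid d)"
  shows "(\<integral>\<^sup>+x. f x \<partial>euclid d) = (\<integral>\<^sup>+y. \<integral>\<^sup>+s. f (y(0 := s)) \<partial>lborel \<partial>euclid_tail d)"
proof -
  have ins: "insert 0 {1..<d} = {..<d}" using assms by auto
  have E: "euclid d = PiM (insert 0 {1..<d}) (\<lambda>_. lborel)" unfolding ins euclid_def ..
  show ?thesis unfolding E by (rule leb.product_nn_integral_insert) (use assms in \<open>auto simp: E\<close>)
qed

lemma proj1_unit:
  assumes "dotp d w w = 1" "dotp d w' w' = 1"
  shows "distr (unif_sphere d) borel (dotp d w) = distr (unif_sphere d) borel (dotp d w')"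
  using assms
proof (cases rule: swap_reflection)
  case 1
  then have "dotp d w = dotp d w'" by auto
  then show ?thesis by simp
next
  case (2 a)
  note P = preserves_hrefl_sphere[OF 2(1), unfolded preserves_def]
  have "distr (unif_sphere d) borel (dotp d w) = distr (distr (unif_sphere d) (unif_sphere d) (hrefl d a)) borel (dotp d w)"
    using P by simp
  also have "\<dots> = distr (unif_sphere d) borel (dotp d w')"
    using P 2(2) by (subst distr_distr) (auto simp: comp_def)
  finally show ?thesis .
qed

text \<open>A point with first coordinate \<open>s\<close> and tail of norm \<open>r\<close> is
  projected to first coordinate s / sqrt (s^2 + r^2). This equals \<open>a\<close> exactly at s = r
  a / sqrt (1 - a^2), so a band on the sphere becomes an interval of \<open>s\<close> for each tail.
  The last inequality serves to keep the point inside the unit ball.\<close>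

lemma sqrt_frac_bounds:
  fixes a r s :: real
  assumes "0 < r" "0 \<le> a" "a < 1"
  shows "r * (a / sqrt (1 - a\<^sup>2)) \<le> s \<Longrightarrow> a \<le> s / sqrt (s\<^sup>2 + r\<^sup>2)"
    and "0 \<le> s \<Longrightarrow> s \<le> r * (a / sqrt (1 - a\<^sup>2)) \<Longrightarrow> s / sqrt (s\<^sup>2 + r\<^sup>2) \<le> a \<and> s\<^sup>2 + r\<^sup>2 \<le> r\<^sup>2 / (1 - a\<^sup>2)"
proof -
  have a2: "a\<^sup>2 < 1" using assms by (simp add: abs_square_less_1)
  let ?A = "r * (a / sqrt (1 - a\<^sup>2))"
  have A: "0 \<le> ?A" "?A\<^sup>2 = r\<^sup>2 * a\<^sup>2 / (1 - a\<^sup>2)" using assms a2 by (auto simp: power_mult_distrib power_divide)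
  have pos: "0 < sqrt (s\<^sup>2 + r\<^sup>2)" using assms by (simp add: add_nonneg_pos)
  { assume s: "?A \<le> s"
    then have "?A\<^sup>2 \<le> s\<^sup>2" using A by (intro power_mono) auto
    then have "a\<^sup>2 * (s\<^sup>2 + r\<^sup>2) \<le> s\<^sup>2" using a2 unfolding A by (simp add: field_simps)
    then have "(a * sqrt (s\<^sup>2 + r\<^sup>2))\<^sup>2 \<le> s\<^sup>2" by (simp add: power_mult_distrib)
    then have "a * sqrt (s\<^sup>2 + r\<^sup>2) \<le> s" using s A assms by (simp add: power2_le_iff_abs_le)
    then show "a \<le> s / sqrt (s\<^sup>2 + r\<^sup>2)" using pos by (simp add: field_simps) }
  { assume s: "0 \<le> s" "s \<le> ?A"
    then have "s\<^sup>2 \<le> ?A\<^sup>2" by (intro power_mono) auto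
    then have le: "s\<^sup>2 * (1 - a\<^sup>2) \<le> r\<^sup>2 * a\<^sup>2" using a2 unfolding A by (simp add: field_simps)
    then have "s\<^sup>2 \<le> (a * sqrt (s\<^sup>2 + r\<^sup>2))\<^sup>2" by (simp add: power_mult_distrib algebra_simps)
    then have "s \<le> a * sqrt (s\<^sup>2 + r\<^sup>2)" using s A assms by (simp add: power2_le_iff_abs_le)
    moreover have "s\<^sup>2 + r\<^sup>2 \<le> r\<^sup>2 / (1 - a\<^sup>2)" using le a2 by (simp add: field_simps)
    ultimately show "s / sqrt (s\<^sup>2 + r\<^sup>2) \<le> a \<and> s\<^sup>2 + r\<^sup>2 \<le> r\<^sup>2 / (1 - a\<^sup>2)"
      using pos by (simp add: field_simps) }
qed

text \<open>The interval of first coordinates belonging to a tail of norm one is at least as long as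
  the band is wide, because division by a square root below one only stretches.\<close>

lemma half_frac_gap:
  fixes b :: real assumes "0 < b" "b < 1"
  shows "b / 2 \<le> b / sqrt (1 - b\<^sup>2) - (b/2) / sqrt (1 - (b/2)\<^sup>2)"
proof -
  have b2: "b\<^sup>2 < 1" using assms by (simp add: abs_square_less_1)
  have "0 < sqrt (1 - b\<^sup>2)" "sqrt (1 - b\<^sup>2) \<le> sqrt (1 - (b/2)\<^sup>2)" "sqrt (1 - b\<^sup>2) \<le> 1"
    using b2 by (auto simp: power_divide)
  then have "(b/2) / sqrt (1 - (b/2)\<^sup>2) \<le> (b/2) / sqrt (1 - b\<^sup>2)" "b / 2 \<le> (b / 2) / sqrt (1 - b\<^sup>2)"
    using assms by (auto intro!: divide_left_mono simp: field_simps)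
  moreover have "b / sqrt (1 - b\<^sup>2) = 2 * ((b/2) / sqrt (1 - b\<^sup>2))" by simp
  ultimately show ?thesis by linarith
qed

text \<open>Only tails of norm between \<rho> / 2 and \<rho> are counted. The upper limit puts every
  point of the slice into the unit ball; the lower one makes each slice at least \<rho> b / 4 long.
  What remains is the volume of a shell in dimension d - 1 divided by the volume of the
  d-ball.\<close>

theorem band_prob_lower:
  assumes d: "2 \<le> d" and w: "dotp d w w = 1" and b: "0 < b" "b\<^sup>2 * real d \<le> 1/2"
  shows "b * sqrt (real d) / 50 \<le> measure (unif_sphere d) {x \<in> space (unif_sphere d). b/2 \<le> dotp d w x \<and> dotp d w x \<le> b}"
proof -
  interpret prob_space "unif_sphere d" by (rule prob_space_unif_sphere)
  let ?V = "unit_ball_vol (real d)" and ?V' = "unit_ball_vol (real (d - 1))"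
  have V: "0 < ?V" "0 < ?V'" by simp_all
  have b1: "b\<^sup>2 \<le> 1/4" using d b(2) mult_left_mono[of 2 "real d" "b\<^sup>2"] by simp
  then have blt: "b < 1" using abs_square_less_1[of b] by linarith
  define \<rho> where "\<rho> = sqrt (1 - b\<^sup>2)"
  have \<rho>: "0 < \<rho>" "\<rho> \<le> 1" "\<rho>\<^sup>2 = 1 - b\<^sup>2" using b1 by (auto simp: \<rho>_def)
  \<comment> \<open>Bernoulli's inequality bounds the square of \<open>\<rho> ^ d\<close> below by
    1/2, and a number in [0,1] dominates its square. This is where \<open>b\<close> of order 1 /
    sqrt d is essential.\<close>
  have \<rho>d: "1/2 \<le> \<rho> ^ d"
  proof -
    have "1/2 \<le> 1 + real d * (- b\<^sup>2)" using b by (simp add: mult.commute)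
    also have "\<dots> \<le> (1 + (- b\<^sup>2)) ^ d" using b1 by (intro Bernoulli_inequality) simp
    also have "\<dots> = (\<rho>\<^sup>2) ^ d" using \<rho>(3) by simp
    also have "\<dots> = (\<rho> ^ d) ^ 2" by (simp add: power_mult[symmetric] mult.commute)
    also have "\<dots> \<le> (\<rho> ^ d) ^ 1" using \<rho> by (intro power_decreasing power_le_one) auto
    finally show ?thesis by simp
  qed
  let ?P = "\<lambda>x. b/2 \<le> dotp d (unitv 0) x \<and> dotp d (unitv 0) x \<le> b"
  have meas: "{x \<in> space (euclid d). ?P x} \<in> sets (euclid d)" by measurable
  have "measure (unif_sphere d) {x \<in> space (unif_sphere d). b/2 \<le> dotp d w x \<and> dotp d w x \<le> b}
     = measure (distr (unif_sphere d) borel (dotp d w)) {b/2..b}"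
    by (subst measure_distr) (auto intro!: arg_cong[where f="measure _"])
  also have "\<dots> = measure (distr (unif_sphere d) borel (dotp d (unitv 0))) {b/2..b}"
    using proj1_unit[OF w, of "unitv 0"] d by (simp add: dotp_unitv) (simp add: unitv_def)
  also have "\<dots> = measure (unif_sphere d) {x \<in> space (euclid d). ?P x}"
    by (subst measure_distr) (auto intro!: arg_cong[where f="measure _"])
  finally have eq: "measure (unif_sphere d) {x \<in> space (unif_sphere d). b/2 \<le> dotp d w x \<and> dotp d w x \<le> b} = \<dots>" .
  let ?f = "\<lambda>x. indicator {x \<in> space (euclid d). ?P x} (nrm d x) * indicator (uball d) x :: ennreal"
  let ?R = "{y \<in> space (euclid_tail d). \<rho>/2 < sqrt (tailsq d y) \<and> sqrt (tailsq d y) \<le> \<rho>}"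
  have "ennreal (\<rho> * b / 4) * emeasure (euclid_tail d) ?R
    = (\<integral>\<^sup>+y. ennreal (\<rho> * b / 4) * indicator ?R y \<partial>euclid_tail d)"
    by (rule nn_integral_cmult_indicator[symmetric]) measurable
  also have "\<dots> \<le> (\<integral>\<^sup>+y. \<integral>\<^sup>+s. ?f (y(0 := s)) \<partial>lborel \<partial>euclid_tail d)"
  proof (rule nn_integral_mono)
    fix y assume y: "y \<in> space (euclid_tail d)"
    show "ennreal (\<rho> * b / 4) * indicator ?R y \<le> (\<integral>\<^sup>+s. ?f (y(0 := s)) \<partial>lborel)"
    proof (cases "y \<in> ?R")
      case True
      define r where "r = sqrt (tailsq d y)"
      have r: "\<rho>/2 < r" "r \<le> \<rho>" "r\<^sup>2 = tailsq d y" using True by (auto simp: r_def)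
      have r0: "0 < r" using r(1) \<rho>(1) by linarith
      note r = r0 r
      let ?A = "r * ((b/2) / sqrt (1 - (b/2)\<^sup>2))" and ?B = "r * (b / sqrt (1 - b\<^sup>2))"
      have A0: "0 \<le> ?A" using r b b1 by (auto simp: power_divide)
      have "\<rho> * b / 4 \<le> r * (b / 2)" using r b by simp
      also have "\<dots> \<le> r * (b / sqrt (1 - b\<^sup>2) - (b/2) / sqrt (1 - (b/2)\<^sup>2))"
        using half_frac_gap[OF b(1) blt] r by (intro mult_left_mono) auto
      also have "\<dots> = ?B - ?A" by (rule right_diff_distrib)
      finally have AB: "\<rho> * b / 4 \<le> ?B - ?A" .
      have "0 \<le> \<rho> * b / 4" using \<rho> b by simp
      with AB have AB0: "?A \<le> ?B" by linarith
      have "ennreal (\<rho> * b / 4) \<le> emeasure lborel {?A..?B}"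
        using AB AB0 by (simp only: emeasure_lborel_Icc ennreal_leI)
      also have "\<dots> = (\<integral>\<^sup>+s. indicator {?A..?B} s \<partial>lborel)" by simp
      also have "\<dots> \<le> (\<integral>\<^sup>+s. ?f (y(0 := s)) \<partial>lborel)"
      proof (rule nn_integral_mono)
        fix s :: real
        show "indicator {?A..?B} s \<le> ?f (y(0 := s))"
        proof (cases "s \<in> {?A..?B}")
          case True
          let ?x = "y(0 := s)"
          have xs: "?x \<in> space (euclid d)" using y d by (auto simp: space_euclid space_PiM PiE_def extensional_def)
          have xx: "dotp d ?x ?x = s\<^sup>2 + r\<^sup>2" using d r by (subst dotp_self_split) auto
          have s0: "0 \<le> s" using True A0 by auto
          have 1: "b/2 \<le> s / sqrt (s\<^sup>2 + r\<^sup>2)"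
            using True b blt r by (intro sqrt_frac_bounds(1)) auto
          have 2: "s / sqrt (s\<^sup>2 + r\<^sup>2) \<le> b" "s\<^sup>2 + r\<^sup>2 \<le> r\<^sup>2 / (1 - b\<^sup>2)"
            using sqrt_frac_bounds(2)[of r b s] True b blt r s0 by auto
          have "r\<^sup>2 / (1 - b\<^sup>2) \<le> \<rho>\<^sup>2 / (1 - b\<^sup>2)" using r b1 by (intro divide_right_mono power_mono) auto
          also have "\<dots> = 1" using \<rho> b1 by simp
          finally have 3: "s\<^sup>2 + r\<^sup>2 \<le> 1" using 2 by simp
          have dx: "dotp d (unitv 0) (nrm d ?x) = s / sqrt (s\<^sup>2 + r\<^sup>2)"
            using d xx by (simp add: dotp_nrm dotp_unitv)
          have "nrm d ?x \<in> space (euclid d)" using measurable_space[OF nrm_measurable xs] .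
          then have "?f ?x = 1" using 1 2 3 xs dx xx by (auto simp: uball_def)
          then show ?thesis by (simp add: indicator_def)
        qed simp
      qed
      finally show ?thesis using True by simp
    qed simp
  qed
  also have "\<dots> = (\<integral>\<^sup>+x. ?f x \<partial>euclid d)"
    using d by (intro nn_integral_euclid_split[symmetric]) auto
  finally have "ennreal (\<rho> * b / 4) * emeasure (euclid_tail d) ?R / ?V \<le> (\<integral>\<^sup>+x. ?f x \<partial>euclid d) / ?V"
    by (intro divide_right_mono_ennreal)
  also have "\<dots> = (\<integral>\<^sup>+x. indicator {x \<in> space (euclid d). ?P x} x \<partial>unif_sphere d)"
    by (rule nn_integral_unif_sphere[symmetric]) measurable
  also have "\<dots> = ennreal (measure (unif_sphere d) {x \<in> space (euclid d). ?P x})"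
    using meas by (subst nn_integral_indicator) (auto simp: emeasure_eq_measure)
  finally have main: "ennreal (\<rho> * b / 4) * emeasure (euclid_tail d) ?R / ?V \<le> \<dots>" .
  have R: "emeasure (euclid_tail d) ?R = ennreal (?V' * \<rho> ^ (d - 1) - ?V' * (\<rho>/2) ^ (d - 1))"
  proof -
    let ?S = "\<lambda>r. {y \<in> space (euclid_tail d). sqrt (tailsq d y) \<le> r}"
    have S: "?S r \<in> sets (euclid_tail d)" for r by measurable
    have eS: "emeasure (euclid_tail d) (?S r) = ennreal (?V' * r ^ (d - 1))" if "0 < r" for r
      using emeasure_tail_ball[OF that] .
    have "emeasure (euclid_tail d) ?R = emeasure (euclid_tail d) (?S \<rho> - ?S (\<rho>/2))"
      by (rule arg_cong[where f="emeasure _"]) auto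
    also have "\<dots> = emeasure (euclid_tail d) (?S \<rho>) - emeasure (euclid_tail d) (?S (\<rho>/2))"
    proof (rule emeasure_Diff)
      show "emeasure (euclid_tail d) (?S (\<rho>/2)) \<noteq> \<infinity>" using \<rho>(1) by (subst eS) auto
      show "?S (\<rho>/2) \<subseteq> ?S \<rho>" using \<rho>(1) by auto
    qed (rule S)+
    also have "\<dots> = ennreal (?V' * \<rho> ^ (d - 1)) - ennreal (?V' * (\<rho>/2) ^ (d - 1))"
      using \<rho>(1) by (subst (1 2) eS) auto
    finally show ?thesis using \<rho>(1) V by (simp only: ennreal_minus mult_nonneg_nonneg less_imp_le zero_le_power half_gt_zero)
  qed
  have half: "(1/2::real) ^ (d - 1) \<le> 1/2"
    using power_decreasing[of 1 "d - 1" "1/2::real"] d by simp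
  have "ennreal (\<rho> * b / 4) * emeasure (euclid_tail d) ?R / ?V = ennreal (\<rho> * b / 4 * (?V' * \<rho> ^ (d - 1) - ?V' * (\<rho>/2) ^ (d - 1)) / ?V)"
    unfolding R using \<rho> b V by (simp add: ennreal_mult[symmetric] divide_ennreal power_mono)
  with main have main': "\<rho> * b / 4 * (?V' * \<rho> ^ (d - 1) - ?V' * (\<rho>/2) ^ (d - 1)) / ?V \<le> measure (unif_sphere d) {x \<in> space (euclid d). ?P x}"
    by simp
  \<comment> \<open>The factor 1/16 combines 1/4 from the slice length, 1/2 from
    \<open>\<rho> ^ d\<close> and 1/2 from the removed inner ball; 50 dominates 16 sqrt (2
    pi).\<close>
  have "b * sqrt (real d) / 50 \<le> b / 16 * sqrt (real d / (2 * pi))"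
  proof -
    have "sqrt (2 * pi) \<le> sqrt ((5/2 + 1/20)^2)" using pi_less_4 pi_approx by (intro real_sqrt_le_mono) (auto simp: power2_eq_square)
    then have "sqrt (2 * pi) \<le> 50/16" by simp
    then have "sqrt (real d) / 50 \<le> sqrt (real d) / (16 * sqrt (2 * pi))" by (intro divide_left_mono) auto
    then have "b * (sqrt (real d) / 50) \<le> b * (sqrt (real d) / (16 * sqrt (2 * pi)))" using b by (intro mult_left_mono) auto
    then show ?thesis by (simp add: real_sqrt_divide)
  qed
  also have "\<dots> \<le> b / 16 * (?V' / ?V)"
    using unit_ball_vol_ratio_lower[OF d] V b by (intro mult_left_mono) (auto simp: field_simps)
  also have "\<dots> \<le> \<rho> * b / 4 * (?V' * \<rho> ^ (d - 1) - ?V' * (\<rho>/2) ^ (d - 1)) / ?V"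
  proof -
    have alg: "\<rho> * b / 4 * (W * X - W * (X * H)) / U = b / 4 * (W / U) * ((\<rho> * X) * (1 - H))" if "U \<noteq> 0" for W X H U :: real
      using that by (simp add: field_simps)
    have "(\<rho>/2) ^ (d - 1) = \<rho> ^ (d - 1) * (1/2) ^ (d - 1)"
      by (simp add: power_mult_distrib[symmetric])
    moreover have "\<rho> ^ d = \<rho> * \<rho> ^ (d - 1)" using d by (simp add: power_eq_if)
    ultimately have e: "\<rho> * b / 4 * (?V' * \<rho> ^ (d - 1) - ?V' * (\<rho>/2) ^ (d - 1)) / ?V
       = b / 4 * (?V' / ?V) * (\<rho> ^ d * (1 - (1/2) ^ (d - 1)))"
      using alg[OF less_imp_neq[OF V(1), symmetric], of ?V' "\<rho> ^ (d - 1)" "(1/2) ^ (d - 1)"] by (simp only:)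
    have "1/2 * (1/2) \<le> \<rho> ^ d * (1 - (1/2) ^ (d - 1))"
      using \<rho>d half by (intro mult_mono) auto
    then have "b / 4 * (?V' / ?V) * (1/4) \<le> b / 4 * (?V' / ?V) * (\<rho> ^ d * (1 - (1/2) ^ (d - 1)))"
      using b V by (intro mult_left_mono) auto
    then show ?thesis unfolding e by simp
  qed
  also note main'
  finally show ?thesis unfolding eq .
qed

section \<open>Measure of a thin cone and the disagreement of two halfspaces\<close>

definition tail_sq_int :: "nat \<Rightarrow> nat \<Rightarrow> ennreal" where
  "tail_sq_int d j = (\<integral>\<^sup>+y. ennreal ((y j)\<^sup>2) * indicator {y. tailsq d y \<le> 1} y \<partial>euclid_tail d)"

text \<open>Thickening the tail ball by a unit interval in the first coordinate makes the
  reflections of \<open>euclid d\<close> available.\<close>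

lemma tail_sq_int_cylinder:
  assumes "j \<in> {1..<d}"
  shows "tail_sq_int d j = (\<integral>\<^sup>+x. ennreal ((x j)\<^sup>2) * indicator {x. 0 \<le> x 0 \<and> x 0 \<le> 1 \<and> tailsq d x \<le> 1} x \<partial>euclid d)"
proof -
  have d: "0 < d" "j < d" "j \<noteq> 0" using assms by auto
  have [measurable]: "(\<lambda>x. ennreal ((x j)\<^sup>2) * indicator {x. 0 \<le> x 0 \<and> x 0 \<le> 1 \<and> tailsq d x \<le> 1} x) \<in> borel_measurable (euclid d)"
    using d by (intro borel_measurable_times_ennreal borel_measurable_indicator') measurable
  have "(\<integral>\<^sup>+x. ennreal ((x j)\<^sup>2) * indicator {x. 0 \<le> x 0 \<and> x 0 \<le> 1 \<and> tailsq d x \<le> 1} x \<partial>euclid d)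
     = (\<integral>\<^sup>+y. \<integral>\<^sup>+s. (ennreal ((y j)\<^sup>2) * indicator {y. tailsq d y \<le> 1} y) * indicator {0..1::real} s \<partial>lborel \<partial>euclid_tail d)"
    using d by (subst nn_integral_euclid_split) (auto intro!: nn_integral_cong simp: indicator_def)
  also have "\<dots> = tail_sq_int d j"
    unfolding tail_sq_int_def by (subst nn_integral_cmult) (auto intro!: nn_integral_cong)
  finally show ?thesis ..
qed

text \<open>The reflection exchanging axes 1 and \<open>j\<close> fixes axis 0, hence it preserves
  \<open>x 0\<close> and the tail norm and maps the cylinder to itself.\<close>

lemma tail_sq_int_eq:
  assumes "j \<in> {1..<d}"
  shows "tail_sq_int d j = tail_sq_int d 1"
proof -
  have d: "0 < d" "1 < d" "j < d" "j \<noteq> 0" using assms by auto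
  have "dotp d (unitv 1) (unitv 1) = 1" "dotp d (unitv j) (unitv j) = 1"
    using d by (simp_all only: dotp_unitv) (simp_all add: unitv_def)
  then show ?thesis
  proof (cases rule: swap_reflection)
    case 1
    from 1[of "unitv 1"] have "j = 1" using d by (simp only: dotp_unitv) (simp add: unitv_def split: if_splits)
    then show ?thesis by simp
  next
    case (2 a)
    let ?f = "\<lambda>x. ennreal ((x 1)\<^sup>2) * indicator {x. 0 \<le> x 0 \<and> x 0 \<le> 1 \<and> tailsq d x \<le> 1} x"
    have [measurable]: "?f \<in> borel_measurable (euclid d)"
      using d by (intro borel_measurable_times_ennreal borel_measurable_indicator') measurable
    have x1: "hrefl d a x 1 = x j" for x using 2(2)[of x] d by (simp only: dotp_unitv)
    have "dotp d (unitv 0) a = 0" using d by (intro 2(3)) (simp only: dotp_unitv, simp add: unitv_def)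
    then have x0: "hrefl d a x 0 = x 0" for x
      using dotp_hrefl[of d "unitv 0" a x] d by (simp add: dotp_unitv)
    have T: "tailsq d (hrefl d a x) = tailsq d x" for x
      using dotp_self_split[of d x] dotp_self_split[of d "hrefl d a x"] dotp_hrefl_hrefl[OF 2(1), of x x] d x0 by simp
    have "tail_sq_int d 1 = (\<integral>\<^sup>+x. ?f (hrefl d a x) \<partial>euclid d)"
      using d preserves_nn_integral[OF preserves_hrefl[OF 2(1)], of ?f] by (subst tail_sq_int_cylinder) auto
    also have "\<dots> = tail_sq_int d j"
      unfolding tail_sq_int_cylinder[OF assms] by (intro nn_integral_cong) (simp only: x1 x0 T indicator_def mem_Collect_eq)
    finally show ?thesis ..
  qed
qed

lemma emeasure_tail_unit_ball:
  "emeasure (euclid_tail d) {y \<in> space (euclid_tail d). tailsq d y \<le> 1} = ennreal (unit_ball_vol (real (d - 1)))"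
  using emeasure_tail_ball[of 1 d] by simp

text \<open>The d - 1 equal integrals add up to the integral of the squared norm, which is at most
  one on the ball.\<close>

lemma tail_sq_int_bound:
  assumes d: "2 \<le> d"
  shows "tail_sq_int d 1 \<le> ennreal (unit_ball_vol (real (d - 1)) / (real d - 1))"
proof -
  let ?V' = "unit_ball_vol (real (d - 1))"
  have "of_nat (d - 1) * tail_sq_int d 1 = (\<Sum>j=1..<d. tail_sq_int d 1)"
    by (simp del: of_nat_diff)
  also have "\<dots> = (\<Sum>j=1..<d. tail_sq_int d j)"
    by (intro sum.cong refl tail_sq_int_eq[symmetric])
  also have "\<dots> = (\<integral>\<^sup>+y. (\<Sum>j=1..<d. ennreal ((y j)\<^sup>2) * indicator {y. tailsq d y \<le> 1} y) \<partial>euclid_tail d)"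
    unfolding tail_sq_int_def
    by (intro nn_integral_sum[symmetric] borel_measurable_times_ennreal borel_measurable_indicator') measurable
  also have "\<dots> \<le> (\<integral>\<^sup>+y. indicator {y \<in> space (euclid_tail d). tailsq d y \<le> 1} y \<partial>euclid_tail d)"
  proof (rule nn_integral_mono)
    fix y assume y: "y \<in> space (euclid_tail d)"
    show "(\<Sum>j=1..<d. ennreal ((y j)\<^sup>2) * indicator {y. tailsq d y \<le> 1} y) \<le> indicator {y \<in> space (euclid_tail d). tailsq d y \<le> 1} y"
    proof (cases "tailsq d y \<le> 1")
      case True
      have "(\<Sum>j=1..<d. ennreal ((y j)\<^sup>2)) = ennreal (tailsq d y)"
        unfolding tailsq_def by (rule sum_ennreal) simp
      also have "\<dots> \<le> ennreal 1" using True by (rule ennreal_leI)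
      finally show ?thesis using True y by (simp add: indicator_def)
    qed simp
  qed
  also have "\<dots> = ennreal ?V'"
    unfolding emeasure_tail_unit_ball[symmetric] by (rule nn_integral_indicator) measurable
  finally have le: "of_nat (d - 1) * tail_sq_int d 1 \<le> ennreal ?V'" .
  have "tail_sq_int d 1 \<noteq> \<top>"
  proof
    assume "tail_sq_int d 1 = \<top>"
    with le d show False by (simp add: ennreal_mult_top top_unique del: of_nat_diff)
  qed
  then obtain q where q: "0 \<le> q" "tail_sq_int d 1 = ennreal q" by (cases "tail_sq_int d 1") auto
  have "ennreal (real (d - 1) * q) \<le> ennreal ?V'"
    using le q by (simp add: ennreal_of_nat_eq_real_of_nat ennreal_mult' del: of_nat_diff)
  then have "q \<le> ?V' / (real d - 1)" using d q by (simp add: of_nat_diff field_simps)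
  then show ?thesis using q by (simp add: ennreal_leI)
qed

text \<open>Converts a first absolute moment into a second one. The weight is the inverse of the
  typical size of \<open>y\<close>: it is taken as \<open>sqrt (real d)\<close> for a coordinate,
  and as a tunable parameter when label noise is estimated.\<close>

lemma amgm_weighted:
  fixes a y :: real assumes "0 < a" shows "y \<le> 1 / (2 * a) + a / 2 * y\<^sup>2"
proof -
  have "0 \<le> (1 - a * y)\<^sup>2 / (2 * a)" using assms by simp
  also have "\<dots> = 1 / (2 * a) + a / 2 * y\<^sup>2 - y"
    using assms by (simp add: power2_eq_square field_simps)
  finally show ?thesis by simp
qed

text \<open>The defining inequality is homogeneous, so the set on the sphere may be replaced by a
  cone in the ball. Its slice over a tail \<open>y\<close> has length at most 2 \<kappa> |y_1|, and
  the mean of |y_1| is of order 1 / sqrt d, which cancels the ratio of ball volumes.\<close>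

lemma cone_prob_upper:
  assumes d: "2 \<le> d" and k: "0 \<le> \<kappa>"
  shows "measure (unif_sphere d) {x \<in> space (unif_sphere d). \<bar>x 0\<bar> \<le> \<kappa> * \<bar>x 1\<bar>} \<le> 2 * \<kappa>"
proof -
  interpret prob_space "unif_sphere d" by (rule prob_space_unif_sphere)
  let ?V = "unit_ball_vol (real d)" and ?V' = "unit_ball_vol (real (d - 1))" and ?a = "sqrt (real d)"
  have V: "0 < ?V" "0 < ?V'" by simp_all
  have d': "0 < d" "1 < d" "(1::nat) \<in> {1..<d}" "?a > 0" using d by auto
  let ?B = "{y. tailsq d y \<le> 1}"
  have S[measurable]: "{x \<in> space (euclid d). \<bar>x 0\<bar> \<le> \<kappa> * \<bar>x 1\<bar>} \<in> sets (euclid d)" using d' by measurable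
  have fm[measurable]: "(\<lambda>x. indicator {x. \<bar>x 0\<bar> \<le> \<kappa> * \<bar>x 1\<bar>} x * indicator (uball d) x :: ennreal) \<in> borel_measurable (euclid d)"
    using d' by (intro borel_measurable_times_ennreal borel_measurable_indicator') measurable
  have "emeasure (unif_sphere d) {x \<in> space (unif_sphere d). \<bar>x 0\<bar> \<le> \<kappa> * \<bar>x 1\<bar>}
    = (\<integral>\<^sup>+x. indicator {x \<in> space (euclid d). \<bar>x 0\<bar> \<le> \<kappa> * \<bar>x 1\<bar>} x \<partial>unif_sphere d)"
    unfolding space_unif_sphere by (rule nn_integral_indicator[symmetric]) (use S in \<open>simp only: sets_unif_sphere\<close>)
  also have "\<dots> = (\<integral>\<^sup>+x. indicator {x \<in> space (euclid d). \<bar>x 0\<bar> \<le> \<kappa> * \<bar>x 1\<bar>} (nrm d x) * indicator (uball d) x \<partial>euclid d) / ?V"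
    by (rule nn_integral_unif_sphere) measurable
  also have "\<dots> \<le> (\<integral>\<^sup>+x. indicator {x. \<bar>x 0\<bar> \<le> \<kappa> * \<bar>x 1\<bar>} x * indicator (uball d) x \<partial>euclid d) / ?V"
  proof (intro divide_right_mono_ennreal nn_integral_mono mult_right_mono)
    fix x
    show "indicator {x \<in> space (euclid d). \<bar>x 0\<bar> \<le> \<kappa> * \<bar>x 1\<bar>} (nrm d x) \<le> (indicator {x. \<bar>x 0\<bar> \<le> \<kappa> * \<bar>x 1\<bar>} x :: ennreal)"
    proof (cases "dotp d x x = 0")
      case True
      then show ?thesis using d' by (auto simp: dotp_self_eq_0 indicator_def)
    next
      case False
      then have "0 < dotp d x x" using dotp_self_nonneg[of d x] by linarith
      then have "0 < sqrt (dotp d x x)" by simp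
      then show ?thesis using d' by (auto simp: indicator_def nrm_def divide_le_cancel)
    qed
  qed simp
  also have "(\<integral>\<^sup>+x. indicator {x. \<bar>x 0\<bar> \<le> \<kappa> * \<bar>x 1\<bar>} x * indicator (uball d) x \<partial>euclid d)
    = (\<integral>\<^sup>+y. \<integral>\<^sup>+s. indicator {x. \<bar>x 0\<bar> \<le> \<kappa> * \<bar>x 1\<bar>} (y(0 := s)) * indicator (uball d) (y(0 := s)) \<partial>lborel \<partial>euclid_tail d)"
    using d' by (intro nn_integral_euclid_split) measurable
  also have "\<dots> \<le> (\<integral>\<^sup>+y. ennreal (2 * \<kappa>) * (ennreal (1 / (2 * ?a)) * indicator {y \<in> space (euclid_tail d). tailsq d y \<le> 1} y + ennreal (?a / 2) * (ennreal ((y 1)\<^sup>2) * indicator ?B y)) \<partial>euclid_tail d)"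
  proof (rule nn_integral_mono)
    fix y assume y: "y \<in> space (euclid_tail d)"
    have "(\<integral>\<^sup>+s. indicator {x. \<bar>x 0\<bar> \<le> \<kappa> * \<bar>x 1\<bar>} (y(0 := s)) * indicator (uball d) (y(0 := s)) \<partial>lborel)
       \<le> (\<integral>\<^sup>+s. indicator ?B y * indicator {- (\<kappa> * \<bar>y 1\<bar>) .. \<kappa> * \<bar>y 1\<bar>} s \<partial>lborel)"
    proof (rule nn_integral_mono)
      fix s :: real
      show "indicator {x. \<bar>x 0\<bar> \<le> \<kappa> * \<bar>x 1\<bar>} (y(0 := s)) * indicator (uball d) (y(0 := s))
         \<le> (indicator ?B y * indicator {- (\<kappa> * \<bar>y 1\<bar>) .. \<kappa> * \<bar>y 1\<bar>} s :: ennreal)"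
      proof (cases "\<bar>s\<bar> \<le> \<kappa> * \<bar>y 1\<bar> \<and> y(0 := s) \<in> uball d")
        case True
        then have "s\<^sup>2 + tailsq d y \<le> 1" using dotp_self_split[of d "y(0 := s)"] d' by (simp add: uball_def)
        then have "tailsq d y \<le> 1" using zero_le_power2[of s] by linarith
        with True show ?thesis by (auto simp: indicator_def)
      qed (auto simp: indicator_def)
    qed
    also have "\<dots> = ennreal (2 * \<kappa> * \<bar>y 1\<bar>) * indicator ?B y"
      using k by (simp add: nn_integral_cmult mult_ac)
    also have "\<dots> \<le> ennreal (2 * \<kappa> * (1 / (2 * ?a) + ?a / 2 * (y 1)\<^sup>2)) * indicator ?B y"
    proof (intro mult_right_mono ennreal_leI mult_left_mono)
      show "\<bar>y 1\<bar> \<le> 1 / (2 * ?a) + ?a / 2 * (y 1)\<^sup>2"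
        using amgm_weighted[OF d'(4), of "\<bar>y 1\<bar>"] by simp
    qed (use k in auto)
    also have "\<dots> = ennreal (2 * \<kappa>) * (ennreal (1 / (2 * ?a)) * indicator {y \<in> space (euclid_tail d). tailsq d y \<le> 1} y + ennreal (?a / 2) * (ennreal ((y 1)\<^sup>2) * indicator ?B y))"
      using k y by (simp add: indicator_def ennreal_mult[symmetric] ennreal_plus[symmetric] del: ennreal_plus)
    finally show "(\<integral>\<^sup>+s. indicator {x. \<bar>x 0\<bar> \<le> \<kappa> * \<bar>x 1\<bar>} (y(0 := s)) * indicator (uball d) (y(0 := s)) \<partial>lborel)
       \<le> ennreal (2 * \<kappa>) * (ennreal (1 / (2 * ?a)) * indicator {y \<in> space (euclid_tail d). tailsq d y \<le> 1} y + ennreal (?a / 2) * (ennreal ((y 1)\<^sup>2) * indicator ?B y))" .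
  qed
  also have "\<dots> = ennreal (2 * \<kappa>) * (ennreal (1 / (2 * ?a)) * ennreal ?V' + ennreal (?a / 2) * tail_sq_int d 1)"
  proof -
    have [measurable]: "(\<lambda>y. ennreal ((y 1)\<^sup>2) * indicator ?B y) \<in> borel_measurable (euclid_tail d)"
      using d' by (intro borel_measurable_times_ennreal borel_measurable_indicator') measurable
    have [measurable]: "{y \<in> space (euclid_tail d). tailsq d y \<le> 1} \<in> sets (euclid_tail d)" by measurable
    let ?S = "{y \<in> space (euclid_tail d). tailsq d y \<le> 1}" and ?g = "\<lambda>y. ennreal ((y 1)\<^sup>2) * indicator ?B y"
    have "(\<integral>\<^sup>+y. ennreal (2 * \<kappa>) * (ennreal (1 / (2 * ?a)) * indicator ?S y + ennreal (?a / 2) * ?g y) \<partial>euclid_tail d)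
       = ennreal (2 * \<kappa>) * (\<integral>\<^sup>+y. (ennreal (1 / (2 * ?a)) * indicator ?S y + ennreal (?a / 2) * ?g y) \<partial>euclid_tail d)"
      by (rule nn_integral_cmult) measurable
    also have "(\<integral>\<^sup>+y. (ennreal (1 / (2 * ?a)) * indicator ?S y + ennreal (?a / 2) * ?g y) \<partial>euclid_tail d)
       = (\<integral>\<^sup>+y. ennreal (1 / (2 * ?a)) * indicator ?S y \<partial>euclid_tail d) + (\<integral>\<^sup>+y. ennreal (?a / 2) * ?g y \<partial>euclid_tail d)"
      by (rule nn_integral_add) measurable
    also have "(\<integral>\<^sup>+y. ennreal (1 / (2 * ?a)) * indicator ?S y \<partial>euclid_tail d) = ennreal (1 / (2 * ?a)) * emeasure (euclid_tail d) ?S"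
      by (rule nn_integral_cmult_indicator) measurable
    also have "(\<integral>\<^sup>+y. ennreal (?a / 2) * ?g y \<partial>euclid_tail d) = ennreal (?a / 2) * (\<integral>\<^sup>+y. ?g y \<partial>euclid_tail d)"
      by (rule nn_integral_cmult) measurable
    finally show ?thesis unfolding tail_sq_int_def emeasure_tail_unit_ball .
  qed
  also have "\<dots> \<le> ennreal (2 * \<kappa>) * (ennreal (1 / (2 * ?a)) * ennreal ?V' + ennreal (?a / 2) * ennreal (?V' / (real d - 1)))"
    using tail_sq_int_bound[OF d] by (intro mult_left_mono add_left_mono) auto
  also have "\<dots> = ennreal (2 * \<kappa> * (1 / (2 * ?a) * ?V' + ?a / 2 * (?V' / (real d - 1))))"
    using k V d by (simp add: ennreal_mult[symmetric] ennreal_plus[symmetric] del: ennreal_plus)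
  finally have "emeasure (unif_sphere d) {x \<in> space (unif_sphere d). \<bar>x 0\<bar> \<le> \<kappa> * \<bar>x 1\<bar>}
    \<le> ennreal (2 * \<kappa> * (1 / (2 * ?a) * ?V' + ?a / 2 * (?V' / (real d - 1)))) / ennreal ?V"
    by (simp add: divide_right_mono_ennreal)
  also have "\<dots> = ennreal (2 * \<kappa> * (1 / (2 * ?a) * ?V' + ?a / 2 * (?V' / (real d - 1))) / ?V)"
    using k V d by (intro divide_ennreal) auto
  finally have "measure (unif_sphere d) {x \<in> space (unif_sphere d). \<bar>x 0\<bar> \<le> \<kappa> * \<bar>x 1\<bar>}
    \<le> 2 * \<kappa> * (1 / (2 * ?a) * ?V' + ?a / 2 * (?V' / (real d - 1))) / ?V"
    using k V d by (simp add: emeasure_eq_measure)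
  also have "\<dots> = \<kappa> * ((?V' / ?V) * (1 / ?a + ?a / (real d - 1)))"
  proof -
    have "2 * \<kappa> * (1 / (2 * A) * W + A / 2 * (W / D)) / U = \<kappa> * ((W / U) * (1 / A + A / D))"
      if "0 < A" "0 < D" "0 < U" for A D U W :: real
      using that by (simp add: field_simps)
    moreover have "0 < real d - 1" using d by simp
    ultimately show ?thesis using V(1) d'(4) by blast
  qed
  also have "\<dots> \<le> \<kappa> * 2"
  proof (intro mult_left_mono k)
    \<comment> \<open>The ratio of volumes is at most sqrt d / 2 and the bracket at most 3 / sqrt d;
      their product 3/2 is below 2.\<close>
    have "?V' / ?V \<le> sqrt ((real d + 1) / (2 * pi))"
      using unit_ball_vol_ratio_upper[of d] d V by (simp add: field_simps)
    also have "\<dots> \<le> ?a / 2"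
    proof -
      have "(real d + 1) / (2 * pi) \<le> (3/2 * real d) / (2 * 3)" using d pi_gt3 by (intro frac_le) auto
      then have "sqrt ((real d + 1) / (2 * pi)) \<le> sqrt (real d / 4)" by (intro real_sqrt_le_mono) simp
      then show ?thesis by (simp add: real_sqrt_divide)
    qed
    finally have 1: "?V' / ?V \<le> ?a / 2" .
    have "?a / (real d - 1) \<le> ?a / (real d / 2)" using d d' by (intro divide_left_mono) auto
    also have "\<dots> = 2 / ?a" using d' by (simp add: field_simps)
    finally have 2: "1 / ?a + ?a / (real d - 1) \<le> 3 / ?a" by simp
    have "(?V' / ?V) * (1 / ?a + ?a / (real d - 1)) \<le> (?a / 2) * (3 / ?a)"
      using 1 2 V d by (intro mult_mono) auto
    also have "\<dots> \<le> 2" using d' by simp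
    finally show "(?V' / ?V) * (1 / ?a + ?a / (real d - 1)) \<le> 2" .
  qed
  finally show ?thesis by simp
qed

lemma orthogonal_component:
  assumes "dotp d v v = 1" "dotp d u u = 1" "dotp d v u = t" "t\<^sup>2 < 1"
  obtains h where "orthonormal2 d v h" "\<And>x. dotp d u x = t * dotp d v x + sqrt (1 - t\<^sup>2) * dotp d h x"
proof
  let ?s = "sqrt (1 - t\<^sup>2)"
  have s: "?s > 0" using assms by simp
  let ?h = "\<lambda>i. (u i - t * v i) / ?s"
  have "dotp d u v = t" using assms dotp_commute by metis
  then show "orthonormal2 d v ?h"
    using assms s unfolding orthonormal2_def dotp_lin
    by (simp add: power2_eq_square[symmetric] field_simps)
  show "dotp d u x = t * dotp d v x + ?s * dotp d ?h x" for x
    unfolding dotp_lin using s by simp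
qed

lemma dotp_eq_1_imp_eq:
  assumes "dotp d v v = 1" "dotp d u u = 1" "dotp d v u = 1"
  shows "dotp d u x = dotp d v x"
proof -
  have "dotp d (\<lambda>i. v i - u i) (\<lambda>i. v i - u i) = 0"
    using assms dotp_commute[of d u v] unfolding dotp_lin by simp
  then show ?thesis unfolding dotp_self_eq_0 by (intro dotp_cong) auto
qed

text \<open>With u = t v + s h and t > 0, the signs can differ only where t |v.x| \<le> s |h.x|.
  That is a cone of slope s / t, and the joint law of (v.x, h.x) moves it to the first two axes. For
  t = 1 there is no \<open>h\<close>, but then the two functionals coincide.\<close>

theorem disagreement_upper:
  assumes d: "2 \<le> d" and v: "dotp d v v = 1" and u: "dotp d u u = 1" and t: "0 < dotp d v u"
  shows "measure (unif_sphere d) {x \<in> space (unif_sphere d). sgn (dotp d v x) \<noteq> sgn (dotp d u x)}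
     \<le> 2 * (sqrt (1 - (dotp d v u)\<^sup>2) / dotp d v u)"
proof -
  interpret prob_space "unif_sphere d" by (rule prob_space_unif_sphere)
  let ?t = "dotp d v u"
  have t1: "\<bar>?t\<bar> \<le> 1" using abs_dotp_le_1[OF v u] .
  show ?thesis
  proof (cases "?t = 1")
    case True
    then show ?thesis using dotp_eq_1_imp_eq[OF v u] by simp
  next
    case False
    let ?s = "sqrt (1 - ?t\<^sup>2)"
    have t2: "?t\<^sup>2 < 1" using False t1 t by (simp add: abs_square_less_1)
    then have s: "?s > 0" by simp
    obtain h where h: "orthonormal2 d v h" "\<And>x. dotp d u x = ?t * dotp d v x + ?s * dotp d h x"
      by (rule orthogonal_component[OF v u refl t2]) blast
    define k where "k = ?s / ?t"
    have k: "0 \<le> k" using s t by (simp add: k_def)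
    let ?C = "{p :: real \<times> real. \<bar>fst p\<bar> \<le> k * \<bar>snd p\<bar>}"
    have "{p :: real \<times> real. \<bar>fst p\<bar> \<le> c * \<bar>snd p\<bar>} \<in> sets (borel \<Otimes>\<^sub>M borel)" for c
    proof -
      have "{p \<in> space (borel \<Otimes>\<^sub>M borel :: (real \<times> real) measure). \<bar>fst p\<bar> \<le> c * \<bar>snd p\<bar>} \<in> sets (borel \<Otimes>\<^sub>M borel)"
        by measurable
      then show ?thesis by (simp add: space_pair_measure)
    qed
    then have C[measurable]: "?C \<in> sets (borel \<Otimes>\<^sub>M borel)" .
    have sub: "\<bar>dotp d v x\<bar> \<le> k * \<bar>dotp d h x\<bar>" if "sgn (dotp d v x) \<noteq> sgn (dotp d u x)" for x
    proof -
      define p q where "p = ?t * dotp d v x" and "q = ?s * dotp d h x"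
      have "sgn p \<noteq> sgn (p + q)" using that t unfolding p_def q_def h(2) by (simp add: sgn_mult)
      then have "\<bar>p\<bar> \<le> \<bar>q\<bar>" by (auto simp: sgn_real_def split: if_splits)
      then have "?t * \<bar>dotp d v x\<bar> \<le> ?s * \<bar>dotp d h x\<bar>" using t s by (simp add: p_def q_def abs_mult)
      then show ?thesis using t by (simp add: k_def field_simps)
    qed
    have "measure (unif_sphere d) {x \<in> space (unif_sphere d). sgn (dotp d v x) \<noteq> sgn (dotp d u x)}
       \<le> measure (unif_sphere d) {x \<in> space (unif_sphere d). \<bar>dotp d v x\<bar> \<le> k * \<bar>dotp d h x\<bar>}"
      using sub by (intro finite_measure_mono) auto
    also have "\<dots> = measure (proj2 d v h) ?C"
      by (subst measure_distr) (auto intro!: arg_cong[where f="measure _"])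
    also have "\<dots> = measure (proj2 d (unitv 0) (unitv 1)) ?C"
      using proj2_orthonormal[OF h(1) orthonormal2_unitv[of 0 d 1]] d by simp
    also have "\<dots> = measure (unif_sphere d) {x \<in> space (unif_sphere d). \<bar>x 0\<bar> \<le> k * \<bar>x 1\<bar>}"
      using d by (subst measure_distr) (auto intro!: arg_cong[where f="measure _"] simp: dotp_unitv)
    also have "\<dots> \<le> 2 * k" using cone_prob_upper[OF d k] .
    finally show ?thesis unfolding k_def .
  qed
qed

section \<open>The run as a Markov chain\<close>

lemma (in sequence_space) nn_integral_PiM_iter:
  assumes [measurable]: "f \<in> borel_measurable S"
  shows "(\<integral>\<^sup>+\<omega>. f \<omega> \<partial>S) = (\<integral>\<^sup>+x. \<integral>\<^sup>+\<omega>. f (case_nat x \<omega>) \<partial>S \<partial>M)"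
proof -
  have "(\<integral>\<^sup>+\<omega>. f \<omega> \<partial>S) = (\<integral>\<^sup>+\<omega>. f \<omega> \<partial>distr (M \<Otimes>\<^sub>M S) S (\<lambda>(s, \<omega>). case_nat s \<omega>))"
    by (simp only: PiM_iter)
  also have "\<dots> = (\<integral>\<^sup>+z. f (case_nat (fst z) (snd z)) \<partial>(M \<Otimes>\<^sub>M S))"
    by (subst nn_integral_distr) (auto simp: case_prod_beta)
  also have "\<dots> = (\<integral>\<^sup>+x. \<integral>\<^sup>+\<omega>. f (case_nat x \<omega>) \<partial>S \<partial>M)"
    by (subst P.nn_integral_fst[symmetric]) auto
  finally show ?thesis .
qed

lemma shift_case_nat[simp]:
  "(\<lambda>i. case_nat x \<omega> (i + Suc n)) = (\<lambda>i. \<omega> (i + n))" "(\<lambda>i. case_nat x \<omega> (Suc (i + n))) = (\<lambda>i. \<omega> (i + n))"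
  by (auto simp: fun_eq_iff)

lemma measurable_shift: "(\<lambda>\<omega> i. \<omega> (i + n)) \<in> measurable (PiM UNIV (\<lambda>_::nat. M)) (PiM UNIV (\<lambda>_::nat. M))"
  by (rule measurable_PiM_single') (auto simp: space_PiM PiE_iff)

text \<open>The strong Markov property at the first visit to \<open>B\<close>. The induction removes
  one rejected sample at a time, which contributes one factor of the complement's measure; the
  suffix after the visit remains a fresh stream.\<close>

lemma (in sequence_space) nn_integral_first_hit:
  assumes B[measurable]: "B \<in> sets M"
    and h: "case_prod h \<in> borel_measurable (M \<Otimes>\<^sub>M S)"
  shows "(\<integral>\<^sup>+\<omega>. (if \<omega> n \<in> B \<and> (\<forall>i<n. \<omega> i \<notin> B) then h (\<omega> n) (\<lambda>i. \<omega> (i + Suc n)) else 0) \<partial>S)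
     = emeasure M (space M - B) ^ n * (\<integral>\<^sup>+x. (if x \<in> B then \<integral>\<^sup>+\<omega>. h x \<omega> \<partial>S else 0) \<partial>M)"
proof -
  have meas: "(\<lambda>\<omega>. if \<omega> m \<in> B \<and> (\<forall>i<m. \<omega> i \<notin> B) then h (\<omega> m) (\<lambda>i. \<omega> (i + Suc m)) else 0) \<in> borel_measurable S" for m
  proof -
    have "(\<lambda>\<omega>. (\<omega> m, \<lambda>i. \<omega> (i + Suc m))) \<in> measurable S (M \<Otimes>\<^sub>M S)"
      by (intro measurable_Pair measurable_shift) simp
    from measurable_compose[OF this h]
    have [measurable]: "(\<lambda>\<omega>. h (\<omega> m) (\<lambda>i. \<omega> (i + Suc m))) \<in> borel_measurable S" by simp
    show ?thesis by measurable
  qed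
  show ?thesis
proof (induction n)
  case 0
  have "(\<lambda>\<omega>. if \<omega> 0 \<in> B \<and> (\<forall>i<0. \<omega> i \<notin> B) then h (\<omega> 0) (\<lambda>i. \<omega> (i + Suc 0)) else 0) \<in> borel_measurable S"
    by (rule meas)
  then show ?case
    by (subst nn_integral_PiM_iter, assumption) (auto intro!: nn_integral_cong)
next
  case (Suc n)
  let ?R = "\<integral>\<^sup>+x. (if x \<in> B then \<integral>\<^sup>+\<omega>. h x \<omega> \<partial>S else 0) \<partial>M"
  let ?F = "\<lambda>m \<omega>. if \<omega> m \<in> B \<and> (\<forall>i<m. \<omega> i \<notin> B) then h (\<omega> m) (\<lambda>i. \<omega> (i + Suc m)) else 0"
  have "(\<integral>\<^sup>+\<omega>. ?F (Suc n) \<omega> \<partial>S) = (\<integral>\<^sup>+x. \<integral>\<^sup>+\<omega>. ?F (Suc n) (case_nat x \<omega>) \<partial>S \<partial>M)"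
    by (rule nn_integral_PiM_iter[OF meas])
  also have "\<dots> = (\<integral>\<^sup>+x. \<integral>\<^sup>+\<omega>. indicator (space M - B) x * ?F n \<omega> \<partial>S \<partial>M)"
    by (intro nn_integral_cong) (auto simp: All_less_Suc2 indicator_def)
  also have "\<dots> = (\<integral>\<^sup>+x. indicator (space M - B) x * (emeasure M (space M - B) ^ n * ?R) \<partial>M)"
    by (intro nn_integral_cong, subst nn_integral_cmult[OF meas]) (simp only: Suc.IH)
  also have "\<dots> = (\<integral>\<^sup>+x. indicator (space M - B) x \<partial>M) * (emeasure M (space M - B) ^ n * ?R)"
    by (rule nn_integral_multc) measurable
  also have "\<dots> = emeasure M (space M - B) ^ Suc n * ?R"
    by (simp add: mult.assoc)
  finally show ?case .
qed
qed

text \<open>Missing \<open>B\<close> in the first n samples has probability q^n with q < 1. This is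
  what makes the infinite summand of \<open>cost\<close> vanish almost surely.\<close>

lemma (in sequence_space) AE_eventually_hit:
  assumes B[measurable]: "B \<in> sets M" and pos: "0 < measure M B"
  shows "AE \<omega> in S. \<exists>n. \<omega> n \<in> B"
proof -
  define q where "q = 1 - measure M B"
  have q: "0 \<le> q" "q < 1" using pos by (auto simp: q_def)
  have le: "emeasure S {\<omega> \<in> space S. \<forall>n. \<omega> n \<notin> B} \<le> ennreal (q ^ n)" for n
  proof -
    have "emeasure S {\<omega> \<in> space S. \<forall>n. \<omega> n \<notin> B} \<le> emeasure S {\<omega> \<in> space S. \<forall>i<n. \<omega> i \<notin> B}"
      by (intro emeasure_mono) auto
    also have "\<dots> = ennreal (q ^ n)"
    proof (induction n)
      case 0 then show ?case using P.emeasure_space_1 by (simp add: emeasure_space_1)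
    next
      case (Suc n)
      have "emeasure S {\<omega> \<in> space S. \<forall>i<Suc n. \<omega> i \<notin> B} = (\<integral>\<^sup>+\<omega>. indicator {\<omega> \<in> space S. \<forall>i<Suc n. \<omega> i \<notin> B} \<omega> \<partial>S)"
        by simp
      also have "\<dots> = (\<integral>\<^sup>+x. \<integral>\<^sup>+\<omega>. indicator (space M - B) x * indicator {\<omega> \<in> space S. \<forall>i<n. \<omega> i \<notin> B} \<omega> \<partial>S \<partial>M)"
        by (subst nn_integral_PiM_iter)
          (auto intro!: nn_integral_cong simp: All_less_Suc2 indicator_def space_PiM PiE_iff split: nat.split)
      also have "\<dots> = (\<integral>\<^sup>+x. indicator (space M - B) x * ennreal (q ^ n) \<partial>M)"
        using Suc.IH by (intro nn_integral_cong, subst nn_integral_cmult) auto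
      also have "\<dots> = emeasure M (space M - B) * ennreal (q ^ n)"
        by (subst nn_integral_multc) auto
      also have "emeasure M (space M - B) = ennreal q"
        by (simp add: M.emeasure_eq_measure M.prob_compl q_def)
      finally show ?case using q by (simp add: ennreal_mult)
    qed
    finally show ?thesis .
  qed
  have "(\<lambda>n. ennreal (q ^ n)) \<longlonglongrightarrow> ennreal 0"
    using q by (intro tendsto_ennrealI LIMSEQ_realpow_zero)
  then have "emeasure S {\<omega> \<in> space S. \<forall>n. \<omega> n \<notin> B} \<le> ennreal 0"
    by (rule LIMSEQ_le_const) (use le in auto)
  then have "emeasure S {\<omega> \<in> space S. \<forall>n. \<omega> n \<notin> B} = 0" by simp
  then show ?thesis by (intro AE_I[where N="{\<omega> \<in> space S. \<forall>n. \<omega> n \<notin> B}"]) auto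
qed

lemma prob_space_unif01: "prob_space unif01"
  unfolding unif01_def by (rule prob_space_uniform_measure) auto

lemma sets_unif01[measurable_cong, simp]: "sets unif01 = sets borel"
  by (simp add: unif01_def)

lemma space_unif01[simp]: "space unif01 = UNIV"
  by (simp add: unif01_def)

abbreviation points :: "nat \<Rightarrow> (nat \<Rightarrow> vec) measure" where
  "points d \<equiv> PiM UNIV (\<lambda>_::nat. unif_sphere d)"
abbreviation coins :: "(nat \<Rightarrow> real) measure" where
  "coins \<equiv> PiM UNIV (\<lambda>_::nat. unif01)"

lemma sequence_space_points: "sequence_space (unif_sphere d)"
proof -
  interpret prob_space "unif_sphere d" by (rule prob_space_unif_sphere)
  show ?thesis by unfold_locales
qed

lemma sequence_space_coins: "sequence_space unif01"
proof -
  interpret prob_space unif01 by (rule prob_space_unif01)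
  show ?thesis by unfold_locales
qed

definition in_band :: "nat \<Rightarrow> vec \<Rightarrow> real \<Rightarrow> vec \<Rightarrow> bool" where
  "in_band d w b x \<longleftrightarrow> b / 2 \<le> dotp d w x \<and> dotp d w x \<le> b"

text \<open>The perceptron correction w - 2 (w.x) x is the reflection of \<open>w\<close> in
  \<open>x\<close>, so unit length survives and the symmetry lemmas apply. Unlike the vector in
  \<open>perc_step\<close>, the result stays in \<open>space (euclid d)\<close>.\<close>

definition upd :: "nat \<Rightarrow> (vec \<Rightarrow> real) \<Rightarrow> vec \<Rightarrow> vec \<Rightarrow> real \<Rightarrow> vec" where
  "upd d \<eta> w x r = (if label_of \<eta> x r * dotp d w x < 0 then hrefl d x w else w)"

text \<open>An upper bound for the terminal cost \<open>G\<close> of the run started at \<open>w\<close>, in terms of the streams that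
  remain unused.  It is infinite on the null event that some band is never hit, where \<open>band_next\<close>
  is a \<open>LEAST\<close> over the empty predicate and the run is not invariant under shifts.\<close>

primrec cost :: "nat \<Rightarrow> (vec \<Rightarrow> real) \<Rightarrow> (vec \<Rightarrow> nat \<Rightarrow> ennreal) \<Rightarrow> real list \<Rightarrow> vec \<Rightarrow> nat \<Rightarrow> (nat \<Rightarrow> vec) \<Rightarrow> (nat \<Rightarrow> real) \<Rightarrow> ennreal" where
  "cost d \<eta> G [] w N xs rs = G w N"
| "cost d \<eta> G (b # bs) w N xs rs =
     (\<Sum>n. if in_band d w b (xs n) \<and> (\<forall>i<n. \<not> in_band d w b (xs i))
          then cost d \<eta> G bs (upd d \<eta> w (xs n) (rs 0)) (N + Suc n) (\<lambda>i. xs (i + Suc n)) (\<lambda>i. rs (i + Suc 0)) else 0)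
     + (if \<exists>n. in_band d w b (xs n) then 0 else \<top>)"

lemma dotp_measurable2:
  assumes f: "f \<in> measurable M (euclid d)" and g: "g \<in> measurable M (euclid d)"
  shows "(\<lambda>a. dotp d (f a) (g a)) \<in> borel_measurable M"
  unfolding dotp_def
  using measurable_compose[OF f measurable_coord] measurable_compose[OF g measurable_coord]
  by (intro borel_measurable_sum borel_measurable_times) auto

lemma in_band_measurable[measurable]:
  assumes "f \<in> measurable M (euclid d)" "g \<in> measurable M (euclid d)"
  shows "Measurable.pred M (\<lambda>a. in_band d (f a) b (g a))"
  unfolding in_band_def using dotp_measurable2[OF assms] by measurable

lemma label_measurable[measurable]:
  assumes [measurable]: "\<eta> \<in> borel_measurable (euclid d)" "g \<in> measurable M (euclid d)" "r \<in> borel_measurable M"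
  shows "(\<lambda>a. label_of \<eta> (g a) (r a)) \<in> borel_measurable M"
  unfolding label_of_def by measurable

lemma hrefl_measurable[measurable]:
  assumes f: "f \<in> measurable M (euclid d)" and g: "g \<in> measurable M (euclid d)"
  shows "(\<lambda>a. hrefl d (g a) (f a)) \<in> measurable M (euclid d)"
proof (rule measurable_euclid)
  fix i assume i: "i < d"
  have [measurable]: "(\<lambda>a. f a i) \<in> borel_measurable M" "(\<lambda>a. g a i) \<in> borel_measurable M"
     "(\<lambda>a. dotp d (g a) (f a)) \<in> borel_measurable M"
    using measurable_compose[OF f measurable_coord[OF i]] measurable_compose[OF g measurable_coord[OF i]] dotp_measurable2[OF g f] .
  show "(\<lambda>a. hrefl d (g a) (f a) i) \<in> borel_measurable M"
    using i unfolding hrefl_def by simp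
qed (auto simp: hrefl_def)

lemma upd_measurable[measurable]:
  assumes [measurable]: "\<eta> \<in> borel_measurable (euclid d)" "f \<in> measurable M (euclid d)" "g \<in> measurable M (euclid d)" "r \<in> borel_measurable M"
  shows "(\<lambda>a. upd d \<eta> (f a) (g a) (r a)) \<in> measurable M (euclid d)"
  using dotp_measurable2[of _ M d] unfolding upd_def by measurable

lemma measurable_points_component[measurable]:
  "fx \<in> measurable M (points d) \<Longrightarrow> (\<lambda>a. fx a n) \<in> measurable M (euclid d)"
  using measurable_compose[of fx M "points d" "\<lambda>x. x n" "unif_sphere d"] measurable_component_singleton[of n UNIV "\<lambda>_. unif_sphere d"]
  by (metis (no_types, lifting) UNIV_I measurable_cong_sets sets_unif_sphere)

lemma measurable_coins_component[measurable]:
  "fr \<in> measurable M coins \<Longrightarrow> (\<lambda>a. fr a n) \<in> borel_measurable M"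
  using measurable_compose[of fr M coins "\<lambda>x. x n" unif01] measurable_component_singleton[of n UNIV "\<lambda>_. unif01"]
  by (metis (no_types, lifting) UNIV_I measurable_cong_sets sets_unif01)

lemma cost_measurable[measurable (raw)]:
  assumes \<eta>[measurable]: "\<eta> \<in> borel_measurable (euclid d)"
    and G[measurable]: "\<And>N. (\<lambda>w. G w N) \<in> borel_measurable (euclid d)"
    and "fw \<in> measurable M (euclid d)" "fx \<in> measurable M (points d)" "fr \<in> measurable M coins"
  shows "(\<lambda>a. cost d \<eta> G bs (fw a) N (fx a) (fr a)) \<in> borel_measurable M"
  using assms(3-5)
proof (induction bs arbitrary: fw N fx fr)
  case Nil
  then show ?case by simp
next
  case (Cons b bs)
  note [measurable] = Cons.prems
  have sx: "(\<lambda>a i. fx a (i + n)) \<in> measurable M (points d)" for n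
    by (rule measurable_compose[OF Cons.prems(2) measurable_shift])
  have sr: "(\<lambda>a i. fr a (i + n)) \<in> measurable M coins" for n
    by (rule measurable_compose[OF Cons.prems(3) measurable_shift])
  have [measurable]: "(\<lambda>a. cost d \<eta> G bs (upd d \<eta> (fw a) (fx a n) (fr a 0)) (N + Suc n) (\<lambda>i. fx a (i + Suc n)) (\<lambda>i. fr a (i + Suc 0))) \<in> borel_measurable M" for n
    by (intro Cons.IH sx sr) measurable
  show ?case unfolding cost.simps by measurable
qed


lemma nn_integral_if_const: "(\<integral>\<^sup>+x. (if P then f x else 0) \<partial>M) = (if P then \<integral>\<^sup>+x. f x \<partial>M else 0)"
  by simp

lemma hrefl_extensional: "hrefl d a x \<in> extensional {..<d}"
  by (simp add: hrefl_def)

lemma upd_unit: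
  assumes "dotp d w w = 1" "dotp d x x = 1" "w \<in> space (euclid d)"
  shows "dotp d (upd d \<eta> w x r) (upd d \<eta> w x r) = 1" "upd d \<eta> w x r \<in> space (euclid d)"
  using assms by (auto simp: upd_def dotp_hrefl_hrefl space_euclid hrefl_extensional)

text \<open>Verification principle for supersolutions: \<open>V\<close> bounds the expected terminal
  cost at each stage as soon as it dominates its own one-step average. The series in the hypothesis
  runs over the number n of rejected points. Since \<open>V\<close> may depend on the draw count,
  the principle is applied both to the error and to the number of draws.\<close>

theorem cost_integral_le:
  assumes d: "0 < d" and \<eta>[measurable]: "\<eta> \<in> borel_measurable (euclid d)"
    and V: "\<And>i N. (\<lambda>w. V i w N) \<in> borel_measurable (euclid d)"
    and pos: "\<And>b w. b \<in> set bs \<Longrightarrow> dotp d w w = 1 \<Longrightarrow> 0 < measure (unif_sphere d) {x \<in> space (unif_sphere d). in_band d w b x}"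
    and super: "\<And>i w N. i < length bs \<Longrightarrow> dotp d w w = 1 \<Longrightarrow> w \<in> space (euclid d) \<Longrightarrow>
        (\<Sum>n. ennreal ((1 - measure (unif_sphere d) {x \<in> space (unif_sphere d). in_band d w (bs ! i) x}) ^ n) *
          (\<integral>\<^sup>+x. (if in_band d w (bs ! i) x then \<integral>\<^sup>+r. V (Suc i) (upd d \<eta> w x r) (N + Suc n) \<partial>unif01 else 0) \<partial>unif_sphere d))
        \<le> V i w N"
    and w: "dotp d w w = 1" "w \<in> space (euclid d)"
  shows "(\<integral>\<^sup>+xs. \<integral>\<^sup>+rs. cost d \<eta> (V (length bs)) bs w N xs rs \<partial>coins \<partial>points d) \<le> V 0 w N"
  using V pos super w
proof (induction bs arbitrary: V w N)
  case Nil
  interpret X: sequence_space "unif_sphere d" by (rule sequence_space_points)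
  interpret R: sequence_space unif01 by (rule sequence_space_coins)
  show ?case by (simp add: X.P.emeasure_space_1 R.P.emeasure_space_1 X.emeasure_space_1 R.emeasure_space_1)
next
  case (Cons b bs)
  interpret X: sequence_space "unif_sphere d" by (rule sequence_space_points)
  interpret R: sequence_space unif01 by (rule sequence_space_coins)
  note [measurable] = Cons.prems(1)
  have [measurable]: "w \<in> space (euclid d)" by fact
  let ?G = "V (length (b # bs))"
  let ?C = "\<lambda>n x r xs rs. cost d \<eta> ?G bs (upd d \<eta> w x r) (N + Suc n) xs rs"
  let ?F = "\<lambda>n xs. in_band d w b (xs n) \<and> (\<forall>i<n. \<not> in_band d w b (xs i))"
  define B where "B = {x \<in> space (unif_sphere d). in_band d w b x}"
  define p where "p = measure (unif_sphere d) B"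
  have wc: "(\<lambda>_. w) \<in> measurable M (euclid d)" for M :: "'m measure" using Cons.prems(5) by simp
  have wc': "Measurable.pred M (\<lambda>a. in_band d w b (f a))" if "f \<in> measurable M (euclid d)" for M :: "'m measure" and f
    by (rule in_band_measurable[OF wc that])
  have B[measurable]: "B \<in> sets (unif_sphere d)" unfolding B_def
    using wc'[of "\<lambda>x. x" "unif_sphere d"] by simp
  have ppos: "0 < p" unfolding p_def B_def using Cons.prems(2,4) by simp
  have Cm: "(\<lambda>a. ?C n (fx a) (fr a) (fxs a) (frs a)) \<in> borel_measurable M"
    if "fx \<in> measurable M (euclid d)" "fr \<in> borel_measurable M" "fxs \<in> measurable M (points d)" "frs \<in> measurable M coins"
    for n fx fr fxs frs and M :: "'m measure"
    using that by (intro cost_measurable upd_measurable wc \<eta> Cons.prems(1))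
  have suffix: "(\<integral>\<^sup>+xs. \<integral>\<^sup>+rs. ?C n x r xs rs \<partial>coins \<partial>points d) \<le> V (Suc 0) (upd d \<eta> w x r) (N + Suc n)"
    if x: "dotp d x x = 1" for n x r
  proof -
    note u = upd_unit[OF Cons.prems(4) x Cons.prems(5), of \<eta> r]
    have "(\<integral>\<^sup>+xs. \<integral>\<^sup>+rs. cost d \<eta> ((\<lambda>i. V (Suc i)) (length bs)) bs (upd d \<eta> w x r) (N + Suc n) xs rs \<partial>coins \<partial>points d)
       \<le> (\<lambda>i. V (Suc i)) 0 (upd d \<eta> w x r) (N + Suc n)"
    proof (rule Cons.IH)
      show "(\<lambda>w. V (Suc i) w N) \<in> borel_measurable (euclid d)" for i N by (rule Cons.prems(1))
      show "0 < measure (unif_sphere d) {x \<in> space (unif_sphere d). in_band d w b x}"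
        if "b \<in> set bs" "dotp d w w = 1" for b w
        using Cons.prems(2)[of b w] that by simp
      show "(\<Sum>n. ennreal ((1 - measure (unif_sphere d) {x \<in> space (unif_sphere d). in_band d w (bs ! i) x}) ^ n) *
          (\<integral>\<^sup>+x. (if in_band d w (bs ! i) x then \<integral>\<^sup>+r. V (Suc (Suc i)) (upd d \<eta> w x r) (N + Suc n) \<partial>unif01 else 0) \<partial>unif_sphere d))
        \<le> V (Suc i) w N" if "i < length bs" "dotp d w w = 1" "w \<in> space (euclid d)" for i w N
        using Cons.prems(3)[of "Suc i" w N] that by simp
    qed (fact u)+
    then show ?thesis by simp
  qed
  have shifts: "(\<lambda>xs i. xs (i + n)) \<in> measurable (points d) (points d)" "(\<lambda>rs i. rs (i + n)) \<in> measurable coins coins" for n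
    by (rule measurable_shift)+
  let ?h = "\<lambda>n x xs. \<integral>\<^sup>+rs. ?C n x (rs 0) xs (\<lambda>i. rs (i + Suc 0)) \<partial>coins"
  have hm: "case_prod (?h n) \<in> borel_measurable (unif_sphere d \<Otimes>\<^sub>M points d)" for n
    unfolding case_prod_beta
  proof (rule R.P.borel_measurable_nn_integral)
    show "(\<lambda>(z, rs). ?C n (fst z) (rs 0) (snd z) (\<lambda>i. rs (i + Suc 0))) \<in> borel_measurable ((unif_sphere d \<Otimes>\<^sub>M points d) \<Otimes>\<^sub>M coins)"
      unfolding case_prod_beta
    proof (rule Cm)
      show "(\<lambda>x i. snd x (i + Suc 0)) \<in> measurable ((unif_sphere d \<Otimes>\<^sub>M points d) \<Otimes>\<^sub>M coins) coins"
        by (rule measurable_compose[OF measurable_snd shifts(2)])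
    qed measurable
  qed
  have h_eq: "?h n x xs = (\<integral>\<^sup>+r. \<integral>\<^sup>+rs. ?C n x r xs rs \<partial>coins \<partial>unif01)"
    if "x \<in> space (euclid d)" "xs \<in> space (points d)" for n x xs
  proof -
    have "(\<lambda>rs. ?C n x (rs 0) xs (\<lambda>i. rs (i + Suc 0))) \<in> borel_measurable coins"
      using that by (intro Cm shifts) auto
    then show ?thesis
      by (subst R.nn_integral_PiM_iter) auto
  qed
  have term_meas: "(\<lambda>z. if ?F n (fst z) then ?C n (fst z n) (snd z 0) (\<lambda>i. fst z (i + Suc n)) (\<lambda>i. snd z (i + Suc 0)) else 0)
      \<in> borel_measurable (points d \<Otimes>\<^sub>M coins)" for n
  proof -
    have "(\<lambda>z. ?C n (fst z n) (snd z 0) (\<lambda>i. fst z (i + Suc n)) (\<lambda>i. snd z (i + Suc 0))) \<in> borel_measurable (points d \<Otimes>\<^sub>M coins)"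
      by (intro Cm measurable_compose[OF measurable_fst shifts(1)] measurable_compose[OF measurable_snd shifts(2)]) measurable
    moreover have "Measurable.pred (points d \<Otimes>\<^sub>M coins) (\<lambda>z. ?F n (fst z))"
    proof -
      have [measurable]: "Measurable.pred (points d \<Otimes>\<^sub>M coins) (\<lambda>z. in_band d w b (fst z i))" for i
        by (intro wc' measurable_points_component) simp
      show ?thesis by measurable
    qed
    ultimately show ?thesis by (intro measurable_If) auto
  qed
  let ?t = "\<lambda>n xs rs. if ?F n xs then ?C n (xs n) (rs 0) (\<lambda>i. xs (i + Suc n)) (\<lambda>i. rs (i + Suc 0)) else 0"
  have t_rs: "?t n xs \<in> borel_measurable coins" if "xs \<in> space (points d)" for n xs
    using measurable_compose[OF measurable_Pair1'[OF that] term_meas[of n]] by (simp only: fst_conv snd_conv)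
  have t_xs: "(\<lambda>xs. \<integral>\<^sup>+rs. ?t n xs rs \<partial>coins) \<in> borel_measurable (points d)" for n
    using term_meas[of n] by (intro R.P.borel_measurable_nn_integral) (simp add: case_prod_beta)
  have term_le: "(\<integral>\<^sup>+xs. \<integral>\<^sup>+rs. ?t n xs rs \<partial>coins \<partial>points d)
      \<le> ennreal ((1 - p) ^ n) * (\<integral>\<^sup>+x. (if in_band d w b x then \<integral>\<^sup>+r. V (Suc 0) (upd d \<eta> w x r) (N + Suc n) \<partial>unif01 else 0) \<partial>unif_sphere d)" for n
  proof -
    have "(\<integral>\<^sup>+xs. \<integral>\<^sup>+rs. ?t n xs rs \<partial>coins \<partial>points d)
      = (\<integral>\<^sup>+xs. (if xs n \<in> B \<and> (\<forall>i<n. xs i \<notin> B) then ?h n (xs n) (\<lambda>i. xs (i + Suc n)) else 0) \<partial>points d)"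
    proof (rule nn_integral_cong)
      fix xs assume "xs \<in> space (points d)"
      then have eq: "(xs n \<in> B \<and> (\<forall>i<n. xs i \<notin> B)) = ?F n xs"
        by (auto simp: B_def space_PiM PiE_iff)
      show "(\<integral>\<^sup>+rs. ?t n xs rs \<partial>coins) = (if xs n \<in> B \<and> (\<forall>i<n. xs i \<notin> B) then ?h n (xs n) (\<lambda>i. xs (i + Suc n)) else 0)"
        unfolding eq by (rule nn_integral_if_const)
    qed
    also have "\<dots> = emeasure (unif_sphere d) (space (unif_sphere d) - B) ^ n * (\<integral>\<^sup>+x. (if x \<in> B then \<integral>\<^sup>+xs. ?h n x xs \<partial>points d else 0) \<partial>unif_sphere d)"
      by (rule X.nn_integral_first_hit[OF B hm])
    also have "emeasure (unif_sphere d) (space (unif_sphere d) - B) ^ n = ennreal ((1 - p) ^ n)"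
      using X.M.prob_compl[OF B] X.M.prob_le_1[of B]
      by (simp add: X.M.emeasure_eq_measure p_def ennreal_power)
    finally have hit_eq: "(\<integral>\<^sup>+xs. \<integral>\<^sup>+rs. ?t n xs rs \<partial>coins \<partial>points d)
      = ennreal ((1 - p) ^ n) * (\<integral>\<^sup>+x. (if x \<in> B then \<integral>\<^sup>+xs. ?h n x xs \<partial>points d else 0) \<partial>unif_sphere d)" .
    have "(\<integral>\<^sup>+x. (if x \<in> B then \<integral>\<^sup>+xs. ?h n x xs \<partial>points d else 0) \<partial>unif_sphere d)
      \<le> (\<integral>\<^sup>+x. (if in_band d w b x then \<integral>\<^sup>+r. V (Suc 0) (upd d \<eta> w x r) (N + Suc n) \<partial>unif01 else 0) \<partial>unif_sphere d)"
    proof (rule nn_integral_mono_AE)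
      \<comment> \<open>The bound for the suffix requires a unit vector after the update, and
        reflection in \<open>x\<close> guarantees this only for unit \<open>x\<close>; hence the
        passage to almost all \<open>x\<close>.\<close>
      have le: "(if x \<in> B then \<integral>\<^sup>+xs. ?h n x xs \<partial>points d else 0)
        \<le> (if in_band d w b x then \<integral>\<^sup>+r. V (Suc 0) (upd d \<eta> w x r) (N + Suc n) \<partial>unif01 else 0)"
        if x: "x \<in> space (unif_sphere d)" "dotp d x x = 1" for x
      proof (cases "in_band d w b x")
        case True
        have x': "x \<in> space (euclid d)" using x by simp
        have "(\<integral>\<^sup>+xs. ?h n x xs \<partial>points d) = (\<integral>\<^sup>+xs. \<integral>\<^sup>+r. \<integral>\<^sup>+rs. ?C n x r xs rs \<partial>coins \<partial>unif01 \<partial>points d)"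
          by (rule nn_integral_cong) (rule h_eq[OF x'])
        also have "\<dots> = (\<integral>\<^sup>+r. \<integral>\<^sup>+xs. \<integral>\<^sup>+rs. ?C n x r xs rs \<partial>coins \<partial>points d \<partial>unif01)"
        proof (rule pair_sigma_finite.Fubini')
          show "pair_sigma_finite unif01 (points d)"
            by (intro pair_sigma_finite.intro R.M.sigma_finite_measure_axioms X.P.sigma_finite_measure_axioms)
          show "(\<lambda>(r, xs). \<integral>\<^sup>+rs. ?C n x r xs rs \<partial>coins) \<in> borel_measurable (unif01 \<Otimes>\<^sub>M points d)"
            unfolding case_prod_beta
          proof (rule R.P.borel_measurable_nn_integral)
            show "(\<lambda>(z, rs). ?C n x (fst z) (snd z) rs) \<in> borel_measurable ((unif01 \<Otimes>\<^sub>M points d) \<Otimes>\<^sub>M coins)"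
              unfolding case_prod_beta using x' by (intro Cm) auto
          qed
        qed
        also have "\<dots> \<le> (\<integral>\<^sup>+r. V (Suc 0) (upd d \<eta> w x r) (N + Suc n) \<partial>unif01)"
          by (intro nn_integral_mono suffix x)
        finally show ?thesis using True x by (simp add: B_def)
      qed (simp add: B_def)
      show "AE x in unif_sphere d. (if x \<in> B then \<integral>\<^sup>+xs. ?h n x xs \<partial>points d else 0)
        \<le> (if in_band d w b x then \<integral>\<^sup>+r. V (Suc 0) (upd d \<eta> w x r) (N + Suc n) \<partial>unif01 else 0)"
        using AE_unit[OF d] AE_space by eventually_elim (rule le)
    qed
    then show ?thesis unfolding hit_eq by (rule mult_left_mono) simp
  qed
  have "(\<integral>\<^sup>+xs. \<integral>\<^sup>+rs. cost d \<eta> ?G (b # bs) w N xs rs \<partial>coins \<partial>points d)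
     = (\<integral>\<^sup>+xs. \<integral>\<^sup>+rs. (\<Sum>n. ?t n xs rs) \<partial>coins \<partial>points d)"
  proof (rule nn_integral_cong_AE)
    \<comment> \<open>A positive band probability turns the infinite summand of \<open>cost\<close>
      into zero almost everywhere, leaving only the series over first hits.\<close>
    have "AE xs in points d. \<exists>n. xs n \<in> B"
      by (rule X.AE_eventually_hit[OF B]) (use ppos in \<open>simp only: p_def\<close>)
    then show "AE xs in points d. (\<integral>\<^sup>+rs. cost d \<eta> ?G (b # bs) w N xs rs \<partial>coins) = (\<integral>\<^sup>+rs. (\<Sum>n. ?t n xs rs) \<partial>coins)"
    proof eventually_elim
      case (elim xs)
      then have "\<exists>n. in_band d w b (xs n)" by (auto simp: B_def)
      then show ?case by (simp only: cost.simps if_True add_0_right)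
    qed
  qed
  also have "\<dots> = (\<integral>\<^sup>+xs. (\<Sum>n. \<integral>\<^sup>+rs. ?t n xs rs \<partial>coins) \<partial>points d)"
    by (intro nn_integral_cong nn_integral_suminf t_rs)
  also have "\<dots> = (\<Sum>n. \<integral>\<^sup>+xs. \<integral>\<^sup>+rs. ?t n xs rs \<partial>coins \<partial>points d)"
    by (intro nn_integral_suminf t_xs)
  also have "\<dots> \<le> (\<Sum>n. ennreal ((1 - p) ^ n) * (\<integral>\<^sup>+x. (if in_band d w b x then \<integral>\<^sup>+r. V (Suc 0) (upd d \<eta> w x r) (N + Suc n) \<partial>unif01 else 0) \<partial>unif_sphere d))"
    by (intro suminf_le term_le) auto
  also have "\<dots> \<le> V 0 w N"
    using Cons.prems(3)[of 0 w N] Cons.prems(4,5) unfolding p_def B_def by simp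
  finally show ?case .
qed

lemma dotp_restrict: "dotp d (restrict w {..<d}) x = dotp d w x"
  by (rule dotp_cong) auto

lemma band_next_shift:
  assumes "\<exists>n. in_band d w b (xs (n + N))"
  shows "band_next d xs w b N = (LEAST n. in_band d w b (xs (n + N))) + N"
  unfolding band_next_def in_band_def[symmetric]
proof (rule Least_equality)
  show "N \<le> (LEAST n. in_band d w b (xs (n + N))) + N \<and> in_band d w b (xs ((LEAST n. in_band d w b (xs (n + N))) + N))"
    using LeastI_ex[OF assms] by simp
  fix y assume y: "N \<le> y \<and> in_band d w b (xs y)"
  then have "in_band d w b (xs ((y - N) + N))" by simp
  then have "(LEAST n. in_band d w b (xs (n + N))) \<le> y - N" by (rule Least_le)
  moreover have "N \<le> y" using y by simp
  ultimately show "(LEAST n. in_band d w b (xs (n + N))) + N \<le> y" by linarith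
qed

text \<open>If the band is hit, the summand of the series at the first hit is the continuation of
  the actual run, and the other summands are nonnegative. If it is never hit, the right-hand side is
  infinite, so nothing has to be known about the run.\<close>

theorem run_le_cost:
  "(case fold (perc_step d \<eta> (xs, rs)) bs (w, N, L) of (v, N', L') \<Rightarrow> G (restrict v {..<d}) N')
   \<le> cost d \<eta> G bs (restrict w {..<d}) N (\<lambda>i. xs (i + N)) (\<lambda>i. rs (i + L))"
proof (induction bs arbitrary: w N L)
  case Nil
  then show ?case by simp
next
  case (Cons b bs)
  define W where "W = restrict w {..<d}"
  have ib: "in_band d W b x = in_band d w b x" for x by (simp add: W_def in_band_def dotp_restrict)
  show ?case
  proof (cases "\<exists>n. in_band d w b (xs (n + N))")
    case False
    then show ?thesis unfolding W_def[symmetric] by (simp add: ib)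
  next
    case True
    define n where "n = (LEAST n. in_band d w b (xs (n + N)))"
    have n: "in_band d w b (xs (n + N))" "\<And>i. i < n \<Longrightarrow> \<not> in_band d w b (xs (i + N))"
      unfolding n_def using LeastI_ex[OF True] not_less_Least by auto
    define w1 where "w1 = (if label_of \<eta> (xs (n + N)) (rs L) * dotp d w (xs (n + N)) < 0
       then (\<lambda>l. w l - 2 * dotp d w (xs (n + N)) * xs (n + N) l) else w)"
    have step: "perc_step d \<eta> (xs, rs) b (w, N, L) = (w1, Suc (n + N), Suc L)"
      unfolding perc_step_def w1_def using band_next_shift[OF True] by (simp add: n_def Let_def)
    have w1: "restrict w1 {..<d} = upd d \<eta> W (xs (n + N)) (rs L)"
      unfolding w1_def upd_def hrefl_def W_def
      using dotp_commute[of d "xs (n + N)" w] dotp_commute[of d "xs (n + N)" "restrict w {..<d}"]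
      by (auto simp: dotp_restrict fun_eq_iff)
    let ?T = "\<lambda>m. if in_band d W b (xs (m + N)) \<and> (\<forall>i<m. \<not> in_band d W b (xs (i + N)))
          then cost d \<eta> G bs (upd d \<eta> W (xs (m + N)) (rs (0 + L))) (N + Suc m) (\<lambda>i. xs (i + Suc m + N)) (\<lambda>i. rs (i + Suc 0 + L)) else 0"
    have "(case fold (perc_step d \<eta> (xs, rs)) (b # bs) (w, N, L) of (v, N', L') \<Rightarrow> G (restrict v {..<d}) N')
      \<le> cost d \<eta> G bs (restrict w1 {..<d}) (Suc (n + N)) (\<lambda>i. xs (i + Suc (n + N))) (\<lambda>i. rs (i + Suc L))"
      unfolding fold.simps comp_apply step by (rule Cons.IH)
    also have "\<dots> = ?T n" using n by (simp add: ib w1 add_ac)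
    also have "\<dots> \<le> (\<Sum>m. ?T m)"
      using sum_le_suminf[of ?T "{n}"] by simp
    also have "\<dots> \<le> cost d \<eta> G (b # bs) W N (\<lambda>i. xs (i + N)) (\<lambda>i. rs (i + L))"
      by simp
    finally show ?thesis unfolding W_def .
  qed
qed

section \<open>Drift of the potential\<close>

text \<open>For negative \<open>y\<close> both sides are multiplied by 1 - y: the left becomes at
  most 1, while the right becomes 1 - y^3, which is at least 1.\<close>

lemma exp_le_quadratic:
  fixes y :: real assumes "\<bar>y\<bar> \<le> 1" shows "exp y \<le> 1 + y + y\<^sup>2"
proof (cases "0 \<le> y")
  case True
  then show ?thesis using exp_bound[of y] assms by simp
next
  case False
  have "1 - y \<le> exp (- y)" using exp_ge_add_one_self[of "-y"] by simp
  then have "exp y * (1 - y) \<le> exp y * exp (- y)" by (intro mult_left_mono) auto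
  also have "\<dots> = 1" by (simp flip: exp_add)
  also have "\<dots> \<le> 1 - y ^ 3" using False by (simp add: power3_eq_cube mult_nonneg_nonpos2 mult_le_0_iff)
  also have "\<dots> = (1 + y + y\<^sup>2) * (1 - y)" by (simp add: power2_eq_square power3_eq_cube algebra_simps)
  finally show ?thesis using False by (simp add: mult_le_cancel_right)
qed

text \<open>The noise rate conditional on \<open>x\<close>. Where u.x = 0 it equals one, in
  agreement with \<open>adversarial_noise\<close>, since a label is never zero.\<close>

definition flip_prob :: "nat \<Rightarrow> (vec \<Rightarrow> real) \<Rightarrow> vec \<Rightarrow> vec \<Rightarrow> real" where
  "flip_prob d \<eta> u x = measure unif01 {r. label_of \<eta> x r \<noteq> sgn (dotp d u x)}"

lemma mislabel_sets:
  assumes [measurable]: "\<eta> \<in> borel_measurable (euclid d)"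
  shows "{z \<in> space (unif_sphere d \<Otimes>\<^sub>M unif01). label_of \<eta> (fst z) (snd z) \<noteq> sgn (dotp d u (fst z))} \<in> sets (unif_sphere d \<Otimes>\<^sub>M unif01)"
  unfolding label_of_def by measurable

lemma mislabel_section:
  assumes "x \<in> space (euclid d)"
  shows "Pair x -` {z \<in> space (unif_sphere d \<Otimes>\<^sub>M unif01). label_of \<eta> (fst z) (snd z) \<noteq> sgn (dotp d u (fst z))}
     = {r. label_of \<eta> x r \<noteq> sgn (dotp d u x)}"
  using assms by (auto simp: space_pair_measure)

lemma flip_prob_measurable:
  assumes "\<eta> \<in> borel_measurable (euclid d)"
  shows "flip_prob d \<eta> u \<in> borel_measurable (euclid d)"
proof -
  interpret R: prob_space unif01 by (rule prob_space_unif01)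
  have "(\<lambda>x. enn2real (emeasure unif01 (Pair x -` {z \<in> space (unif_sphere d \<Otimes>\<^sub>M unif01). label_of \<eta> (fst z) (snd z) \<noteq> sgn (dotp d u (fst z))})))
     \<in> borel_measurable (euclid d)"
    using R.measurable_emeasure_Pair[OF mislabel_sets[OF assms, of u]] by simp
  then show ?thesis
    by (rule measurable_cong[THEN iffD1, rotated]) (simp only: mislabel_section flip_prob_def measure_def)
qed

lemma flip_prob_bounds: "0 \<le> flip_prob d \<eta> u x" "flip_prob d \<eta> u x \<le> 1"
proof -
  interpret R: prob_space unif01 by (rule prob_space_unif01)
  show "0 \<le> flip_prob d \<eta> u x" "flip_prob d \<eta> u x \<le> 1" by (auto simp: flip_prob_def)
qed

lemma flip_prob_integral:
  assumes \<eta>: "\<eta> \<in> borel_measurable (euclid d)" and noise: "adversarial_noise d \<eta> \<nu> u"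
  shows "(\<integral>x. flip_prob d \<eta> u x \<partial>unif_sphere d) \<le> \<nu>"
proof -
  interpret X: prob_space "unif_sphere d" by (rule prob_space_unif_sphere)
  interpret R: prob_space unif01 by (rule prob_space_unif01)
  interpret P: pair_prob_space "unif_sphere d" unif01 ..
  let ?A = "{z \<in> space (unif_sphere d \<Otimes>\<^sub>M unif01). label_of \<eta> (fst z) (snd z) \<noteq> sgn (dotp d u (fst z))}"
  note [measurable] = \<eta>
  have lab: "(\<lambda>(x, r). (x, label_of \<eta> x r)) \<in> measurable (unif_sphere d \<Otimes>\<^sub>M unif01) (euclid d \<Otimes>\<^sub>M borel)"
    unfolding case_prod_beta by (intro measurable_Pair label_measurable[OF \<eta>]) measurable
  let ?B = "{p \<in> space (euclid d \<Otimes>\<^sub>M borel). snd p \<noteq> sgn (dotp d u (fst p))}"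
  have B: "?B \<in> sets (euclid d \<Otimes>\<^sub>M (borel :: real measure))"
    by measurable
  have "measure (data_dist d \<eta>) ?B = P.prob ((\<lambda>(x, r). (x, label_of \<eta> x r)) -` ?B \<inter> space (unif_sphere d \<Otimes>\<^sub>M unif01))"
    unfolding data_dist_def by (rule measure_distr[OF lab B])
  also have "(\<lambda>(x, r). (x, label_of \<eta> x r)) -` ?B \<inter> space (unif_sphere d \<Otimes>\<^sub>M unif01) = ?A"
    by (auto simp: space_pair_measure)
  finally have eq: "measure (data_dist d \<eta>) ?B = P.prob ?A" .
  have "space (data_dist d \<eta>) = space (euclid d \<Otimes>\<^sub>M (borel :: real measure))" by (simp add: data_dist_def)
  with eq have "measure (data_dist d \<eta>) {p \<in> space (data_dist d \<eta>). snd p \<noteq> sgn (dotp d u (fst p))} = P.prob ?A"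
    by (simp only:)
  then have "P.prob ?A \<le> \<nu>" using noise by (simp add: adversarial_noise_def)
  moreover have "ennreal (\<integral>x. flip_prob d \<eta> u x \<partial>unif_sphere d) = ennreal (P.prob ?A)"
  proof -
    have "integrable (unif_sphere d) (flip_prob d \<eta> u)"
      using flip_prob_bounds flip_prob_measurable[OF \<eta>]
      by (intro integrable_sphere_bounded[where B=1]) auto
    then have "ennreal (\<integral>x. flip_prob d \<eta> u x \<partial>unif_sphere d) = (\<integral>\<^sup>+x. ennreal (flip_prob d \<eta> u x) \<partial>unif_sphere d)"
      using flip_prob_bounds by (intro nn_integral_eq_integral[symmetric]) auto
    also have "\<dots> = (\<integral>\<^sup>+x. emeasure unif01 (Pair x -` ?A) \<partial>unif_sphere d)"
      by (intro nn_integral_cong) (simp only: space_unif_sphere mislabel_section flip_prob_def R.emeasure_eq_measure)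
    also have "\<dots> = emeasure (unif_sphere d \<Otimes>\<^sub>M unif01) ?A"
      by (rule R.emeasure_pair_measure_alt[symmetric, OF mislabel_sets[OF \<eta>]])
    finally show ?thesis by (simp add: P.emeasure_eq_measure)
  qed
  moreover have "0 \<le> (\<integral>x. flip_prob d \<eta> u x \<partial>unif_sphere d)"
    using flip_prob_bounds by (intro Bochner_Integration.integral_nonneg) auto
  ultimately show ?thesis by (simp add: ennreal_inj)
qed

lemma dotp_upd:
  "dotp d u (upd d \<eta> w x r) = dotp d u w - (if label_of \<eta> x r * dotp d w x < 0 then 2 * dotp d w x * dotp d u x else 0)"
  unfolding upd_def using dotp_hrefl[of d u x w] dotp_commute[of d x w] by simp

text \<open>Cauchy-Schwarz for the component of \<open>u\<close> orthogonal to \<open>w\<close>.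
  That component is not normalised, so \<open>w\<close> parallel to \<open>u\<close> is
  covered.\<close>

lemma component_bound:
  assumes w: "dotp d w w = 1" and u: "dotp d u u = 1" and x: "dotp d x x = 1" and band: "\<bar>dotp d w x\<bar> \<le> b"
  shows "\<bar>dotp d u x\<bar> \<le> b + sqrt (1 - (dotp d w u)\<^sup>2)"
proof -
  let ?t = "dotp d w u"
  have t: "\<bar>?t\<bar> \<le> 1" by (rule abs_dotp_le_1[OF w u])
  let ?g = "\<lambda>i. u i - ?t * w i"
  have "dotp d ?g ?g = 1 - ?t\<^sup>2"
    unfolding dotp_lin using w u dotp_commute[of d u w] by (simp add: power2_eq_square algebra_simps)
  then have "(dotp d ?g x)\<^sup>2 \<le> 1 - ?t\<^sup>2" using cauchy_schwarz_dotp[of d ?g x] x by simp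
  then have "\<bar>dotp d ?g x\<bar> \<le> sqrt (1 - ?t\<^sup>2)" using real_sqrt_le_mono by fastforce
  moreover have "dotp d u x = ?t * dotp d w x + dotp d ?g x" unfolding dotp_lin by simp
  moreover have "\<bar>?t * dotp d w x\<bar> \<le> 1 * b" unfolding abs_mult using t band by (intro mult_mono) auto
  ultimately show ?thesis by linarith
qed

text \<open>Here \<open>a\<close> stands for w.x, \<open>c\<close> for u.x and \<open>y\<close> for
  the label. As \<open>a\<close> is positive, a correct label causes an update exactly when
  \<open>c\<close> is negative, and the gain 2 a |c| is at least b |c|. A wrong label forfeits this
  gain or causes a loss of at most 2 b |c|.\<close>

lemma progress_lower:
  assumes band: "b / 2 \<le> a" "a \<le> b" and b: "0 < b" and y: "y = 1 \<or> y = -1"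
  shows "b * max 0 (- c) - 2 * b * \<bar>c\<bar> * of_bool (y \<noteq> sgn c) \<le> (if y * a < 0 then - (2 * a * c) else (0::real))"
proof -
  have a: "0 < a" using band b by simp
  consider "y = 1" "0 \<le> c" | "y = 1" "c < 0" | "y = -1" "0 < c" | "y = -1" "c \<le> 0" using y by linarith
  then show ?thesis
  proof cases
    case 1
    then show ?thesis using a b by (auto simp: max_def)
  next
    case 2
    then have "b * c \<le> 0" using b by (intro mult_nonneg_nonpos) auto
    with 2 show ?thesis using a b by (auto simp: max_def mult_less_0_iff)
  next
    case 3
    then have "a * c \<le> b * c" using band by (intro mult_right_mono) auto
    then show ?thesis using 3 a b by (auto simp: max_def)
  next
    case 4
    have "b / 2 * (- c) \<le> a * (- c)" using 4 band by (intro mult_right_mono) auto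
    moreover have "0 \<le> b * \<bar>c\<bar>" using b by simp
    ultimately show ?thesis using 4 a b by (auto simp: max_def)
  qed
qed

lemma step_abs:
  assumes band: "b / 2 \<le> a" "a \<le> b" and b: "0 < b"
  shows "\<bar>if y * a < 0 then - (2 * a * c) else (0::real)\<bar> \<le> 2 * b * \<bar>c\<bar>"
proof -
  have "a * \<bar>c\<bar> \<le> b * \<bar>c\<bar>" using band by (intro mult_right_mono) auto
  then show ?thesis using band b by (auto simp: abs_mult)
qed

text \<open>To be read with \<open>a = w \<sqdot> x\<close> and \<open>e = h \<sqdot> x\<close>, where \<open>u = t w + s h\<close> for a unit vector \<open>h\<close> orthogonal to
  \<open>w\<close>; then \<open>\<Delta>\<close> is the increase of \<open>u \<sqdot> w\<close> in one step.  The label noise is decoupled from \<open>u \<sqdot> x\<close> by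
  AM-GM with weight \<open>\<rho>\<close>.\<close>

lemma potential_pointwise:
  fixes a e t s b \<Lambda> \<rho> y :: real
  defines "c \<equiv> t * a + s * e"
  defines "\<Delta> \<equiv> (if y * a < 0 then - (2 * a * c) else 0)"
  assumes band: "b / 2 \<le> a" "a \<le> b" and b: "0 < b" and y: "y = 1 \<or> y = -1"
    and t: "\<bar>t\<bar> \<le> 1" and s: "0 \<le> s" and L: "0 < \<Lambda>" and r: "0 < \<rho>" and small: "\<Lambda> * (2 * b * \<bar>c\<bar>) \<le> 1"
  shows "exp (- (\<Lambda> * \<Delta>)) \<le> 1 - \<Lambda> * b * s * max 0 (- e) + \<Lambda> * b\<^sup>2
     + (\<Lambda> * b * \<rho> + 4 * \<Lambda>\<^sup>2 * b\<^sup>2) * (2 * b\<^sup>2 + 2 * s\<^sup>2 * e\<^sup>2) + (\<Lambda> * b / \<rho>) * of_bool (y \<noteq> sgn c)"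
proof -
  let ?n = "of_bool (y \<noteq> sgn c) :: real"
  have D: "\<bar>\<Delta>\<bar> \<le> 2 * b * \<bar>c\<bar>" unfolding \<Delta>_def by (rule step_abs[OF band b])
  have "\<bar>- (\<Lambda> * \<Delta>)\<bar> \<le> 1"
  proof -
    have "\<Lambda> * \<bar>\<Delta>\<bar> \<le> \<Lambda> * (2 * b * \<bar>c\<bar>)" using L by (intro mult_left_mono D) auto
    then have "\<Lambda> * \<bar>\<Delta>\<bar> \<le> 1" using small by (rule order_trans)
    then show ?thesis using L by (simp add: abs_mult)
  qed
  then have "exp (- (\<Lambda> * \<Delta>)) \<le> 1 + - (\<Lambda> * \<Delta>) + (- (\<Lambda> * \<Delta>))\<^sup>2" by (rule exp_le_quadratic)
  also have "(- (\<Lambda> * \<Delta>))\<^sup>2 = \<Lambda>\<^sup>2 * \<bar>\<Delta>\<bar>\<^sup>2" by (simp add: power_mult_distrib)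
  finally have 1: "exp (- (\<Lambda> * \<Delta>)) \<le> 1 - \<Lambda> * \<Delta> + \<Lambda>\<^sup>2 * \<bar>\<Delta>\<bar>\<^sup>2" by simp
  have "\<bar>\<Delta>\<bar>\<^sup>2 \<le> (2 * b * \<bar>c\<bar>)\<^sup>2" using D by (intro power_mono) auto
  then have 2: "\<Lambda>\<^sup>2 * \<bar>\<Delta>\<bar>\<^sup>2 \<le> 4 * \<Lambda>\<^sup>2 * b\<^sup>2 * c\<^sup>2"
    using mult_left_mono[of "\<bar>\<Delta>\<bar>\<^sup>2" "(2 * b * \<bar>c\<bar>)\<^sup>2" "\<Lambda>\<^sup>2"] by (simp add: power_mult_distrib mult_ac)
  have "b * max 0 (- c) - 2 * b * \<bar>c\<bar> * ?n \<le> \<Delta>"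
    unfolding \<Delta>_def by (rule progress_lower[OF band b y])
  then have 3: "\<Lambda> * (b * max 0 (- c)) - \<Lambda> * (2 * b * \<bar>c\<bar> * ?n) \<le> \<Lambda> * \<Delta>"
    using mult_left_mono[of "b * max 0 (- c) - 2 * b * \<bar>c\<bar> * ?n" \<Delta> \<Lambda>] L by (simp add: right_diff_distrib)
  have a: "0 \<le> a" using band b by simp
  have ta: "\<bar>t * a\<bar> \<le> b" using mult_mono[OF t, of "\<bar>a\<bar>" b] a band by (simp add: abs_mult)
  \<comment> \<open>Replacing u.x by its component along \<open>h\<close> costs at most
    \<open>b\<close>; this is the source of the term \<open>\<Lambda> * b\<^sup>2\<close>.\<close>
  have "s * max 0 (- e) - b \<le> max 0 (- c)"
    using ta s b unfolding c_def by (auto simp: max_def abs_le_iff mult_nonneg_nonpos)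
  then have "\<Lambda> * b * (s * max 0 (- e) - b) \<le> \<Lambda> * b * max 0 (- c)"
    using L b by (intro mult_left_mono) auto
  then have 4: "\<Lambda> * b * s * max 0 (- e) - \<Lambda> * b\<^sup>2 \<le> \<Lambda> * (b * max 0 (- c))"
    by (simp add: algebra_simps power2_eq_square)
  have "\<bar>c\<bar> * ?n \<le> \<rho> / 2 * c\<^sup>2 + 1 / (2 * \<rho>) * ?n"
    using amgm_weighted[OF r, of "\<bar>c\<bar>"] r by (auto simp: of_bool_def)
  then have "2 * \<Lambda> * b * (\<bar>c\<bar> * ?n) \<le> 2 * \<Lambda> * b * (\<rho> / 2 * c\<^sup>2 + 1 / (2 * \<rho>) * ?n)"
    using L b by (intro mult_left_mono) auto
  then have 5: "\<Lambda> * (2 * b * \<bar>c\<bar> * ?n) \<le> \<Lambda> * b * \<rho> * c\<^sup>2 + (\<Lambda> * b / \<rho>) * ?n"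
    using r by (simp add: algebra_simps)
  have "(t * a)\<^sup>2 \<le> b\<^sup>2" using ta b by (simp add: abs_le_square_iff[symmetric])
  moreover have "c\<^sup>2 \<le> 2 * (t * a)\<^sup>2 + 2 * (s * e)\<^sup>2"
    using sum_squares_bound[of "t * a" "s * e"] unfolding c_def by (simp add: power2_sum)
  ultimately have c2: "c\<^sup>2 \<le> 2 * b\<^sup>2 + 2 * s\<^sup>2 * e\<^sup>2" by (simp add: power_mult_distrib)
  have "(\<Lambda> * b * \<rho> + 4 * \<Lambda>\<^sup>2 * b\<^sup>2) * c\<^sup>2 \<le> (\<Lambda> * b * \<rho> + 4 * \<Lambda>\<^sup>2 * b\<^sup>2) * (2 * b\<^sup>2 + 2 * s\<^sup>2 * e\<^sup>2)"
    using L b r by (intro mult_left_mono c2) auto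
  with 1 2 3 4 5 show ?thesis by (simp only: distrib_right)
qed


lemma in_band_indicator: "in_band d w b x \<longleftrightarrow> indicator {b/2..b} (dotp d w x) = (1::real)"
  by (simp add: in_band_def indicator_def)

lemma in_band_sets: "{x \<in> space (unif_sphere d). in_band d w b x} \<in> sets (unif_sphere d)"
proof -
  have "{x \<in> space (euclid d). b / 2 \<le> dotp d w x \<and> dotp d w x \<le> b} \<in> sets (euclid d)" by measurable
  then show ?thesis by (simp add: in_band_def)
qed

lemma band_measure_eq:
  "measure (unif_sphere d) {x \<in> space (unif_sphere d). in_band d w b x} = (\<integral>x. indicator {b/2..b} (dotp d w x) \<partial>unif_sphere d)"
proof -
  interpret X: prob_space "unif_sphere d" by (rule prob_space_unif_sphere)
  have "measure (unif_sphere d) {x \<in> space (unif_sphere d). in_band d w b x}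
    = (\<integral>x. indicator {x \<in> space (unif_sphere d). in_band d w b x} x \<partial>unif_sphere d)"
    using in_band_sets[of d w b] by simp
  also have "\<dots> = (\<integral>x. indicator {b/2..b} (dotp d w x) \<partial>unif_sphere d)"
    by (intro Bochner_Integration.integral_cong) (auto simp: indicator_def in_band_def)
  finally show ?thesis .
qed

lemma label_sections:
  assumes \<eta>: "\<eta> \<in> borel_measurable (euclid d)" and x: "x \<in> space (euclid d)"
  shows "{r. label_of \<eta> x r \<noteq> c} \<in> sets unif01"
proof -
  have "(\<lambda>r. label_of \<eta> x r) \<in> borel_measurable unif01"
    using x by (intro label_measurable[OF \<eta>]) (auto intro: measurable_ident_sets)
  then have "{r \<in> space unif01. label_of \<eta> x r \<noteq> c} \<in> sets unif01" by measurable
  then show ?thesis by simp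
qed

text \<open>The pointwise bound is integrated over the band: the half moment of h.x gives the gain,
  its second moment the quadratic loss. The left side is not yet divided by \<open>p\<close>, which
  is why \<nu> appears without that factor.\<close>

theorem potential_step:
  assumes d: "2 \<le> d" and w: "dotp d w w = 1" and u: "dotp d u u = 1"
    and \<eta>: "\<eta> \<in> borel_measurable (euclid d)" and noise: "adversarial_noise d \<eta> \<nu> u"
    and t: "dotp d w u = t" "t\<^sup>2 < 1" and s_def: "s = sqrt (1 - t\<^sup>2)"
    and b: "0 < b" "b\<^sup>2 \<le> 1/18" and L: "0 < \<Lambda>" and r: "0 < \<rho>"
    and small: "\<Lambda> * (2 * b * (b + s)) \<le> 1"
    and p_def: "p = measure (unif_sphere d) {x \<in> space (unif_sphere d). in_band d w b x}"
  shows "(\<integral>\<^sup>+x. (if in_band d w b x then \<integral>\<^sup>+r. ennreal (exp (\<Lambda> * (1 - dotp d u (upd d \<eta> w x r)))) \<partial>unif01 else 0) \<partial>unif_sphere d)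
    \<le> ennreal (exp (\<Lambda> * (1 - t)) * (p * (1 - \<Lambda> * b * s / (4 * sqrt (real d)) + \<Lambda> * b\<^sup>2
         + (\<Lambda> * b * \<rho> + 4 * \<Lambda>\<^sup>2 * b\<^sup>2) * (2 * b\<^sup>2 + 2 * s\<^sup>2 / (real d - 1))) + \<Lambda> * b / \<rho> * \<nu>))"
proof -
  interpret X: prob_space "unif_sphere d" by (rule prob_space_unif_sphere)
  interpret R: prob_space unif01 by (rule prob_space_unif01)
  obtain h where h: "orthonormal2 d w h" and ux: "\<And>x. dotp d u x = t * dotp d w x + s * dotp d h x"
    using orthogonal_component[OF w u t] unfolding s_def by blast
  interpret B: band d w h b "{b/2..b}" "\<integral>x. indicator {b/2..b} (dotp d w x) \<partial>unif_sphere d" "indicator {b/2..b}"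
    using d h b by unfold_locales auto
  let ?\<psi> = "\<lambda>x. indicator {b/2..b} (dotp d w x) :: real"
  have p: "p = (\<integral>x. ?\<psi> x \<partial>unif_sphere d)" unfolding p_def by (rule band_measure_eq)
  have s: "0 < s" using t by (simp add: s_def)
  have t1: "\<bar>t\<bar> \<le> 1" using abs_dotp_le_1[OF w u] t by simp
  let ?A = "\<Lambda> * b * s" and ?K = "\<Lambda> * b * \<rho> + 4 * \<Lambda>\<^sup>2 * b\<^sup>2" and ?n = "\<Lambda> * b / \<rho>"
  have K: "0 \<le> ?K" "0 \<le> ?n" using L b r by auto
  define G where "G x = 1 - ?A * max 0 (- dotp d h x) + \<Lambda> * b\<^sup>2 + ?K * (2 * b\<^sup>2 + 2 * s\<^sup>2 * (dotp d h x)\<^sup>2)" for x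
  define E where "E = exp (\<Lambda> * (1 - t))"
  have E: "0 < E" by (simp add: E_def)
  have inner: "(\<integral>\<^sup>+r. ennreal (exp (\<Lambda> * (1 - dotp d u (upd d \<eta> w x r)))) \<partial>unif01) \<le> ennreal (E * (G x + ?n * flip_prob d \<eta> u x))"
     and pos: "0 \<le> G x + ?n * flip_prob d \<eta> u x"
    if x: "x \<in> space (euclid d)" "dotp d x x = 1" and ib: "in_band d w b x" for x
  proof -
    let ?S = "{r. label_of \<eta> x r \<noteq> sgn (dotp d u x)}"
    note S = label_sections[OF \<eta> x(1), of "sgn (dotp d u x)"]
    have band: "b / 2 \<le> dotp d w x" "dotp d w x \<le> b" using ib by (auto simp: in_band_def)
    have "\<bar>dotp d u x\<bar> \<le> b + s"
      using component_bound[OF w u x(2), of b] band b by (simp add: s_def t(1))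
    then have "\<Lambda> * (2 * b * \<bar>dotp d u x\<bar>) \<le> \<Lambda> * (2 * b * (b + s))"
      using L b by (intro mult_left_mono) auto
    then have sm: "\<Lambda> * (2 * b * \<bar>t * dotp d w x + s * dotp d h x\<bar>) \<le> 1" using small by (simp add: ux)
    have pt: "exp (\<Lambda> * (1 - dotp d u (upd d \<eta> w x r))) \<le> E * (G x + ?n * indicator ?S r)" for r
    proof -
      let ?D = "if label_of \<eta> x r * dotp d w x < 0 then - (2 * dotp d w x * dotp d u x) else 0"
      have y: "label_of \<eta> x r = 1 \<or> label_of \<eta> x r = -1" by (simp add: label_of_def)
      have "exp (- (\<Lambda> * ?D)) \<le> G x + ?n * of_bool (label_of \<eta> x r \<noteq> sgn (dotp d u x))"
        using potential_pointwise[OF band b(1) y t1 less_imp_le[OF s] L r sm] unfolding G_def ux by simp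
      also have "of_bool (label_of \<eta> x r \<noteq> sgn (dotp d u x)) = (indicator ?S r :: real)"
        by (simp add: indicator_def)
      finally have le: "exp (- (\<Lambda> * ?D)) \<le> G x + ?n * indicator ?S r" .
      have "1 - dotp d u (upd d \<eta> w x r) = (1 - t) - ?D"
        unfolding dotp_upd using t(1) dotp_commute[of d u w] by auto
      then have "\<Lambda> * (1 - dotp d u (upd d \<eta> w x r)) = \<Lambda> * (1 - t) + - (\<Lambda> * ?D)"
        by (simp only: right_diff_distrib)
      then have "exp (\<Lambda> * (1 - dotp d u (upd d \<eta> w x r))) = E * exp (- (\<Lambda> * ?D))"
        by (simp only: E_def exp_add)
      also have "\<dots> \<le> E * (G x + ?n * indicator ?S r)" using E by (intro mult_left_mono le) auto
      finally show ?thesis .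
    qed
    have nn: "0 \<le> E * (G x + ?n * indicator ?S r)" for r
      using order_trans[OF exp_ge_zero pt] .
    have int: "integrable unif01 (\<lambda>r. E * (G x + ?n * indicator ?S r))"
      using S by (intro integrable_mult_right Bochner_Integration.integrable_add R.integrable_const integrable_mult_right)
        (simp add: R.emeasure_eq_measure)
    have ieq: "(\<integral>r. E * (G x + ?n * indicator ?S r) \<partial>unif01) = E * (G x + ?n * flip_prob d \<eta> u x)"
      using S unfolding flip_prob_def
      by (subst integral_mult_right_zero, subst Bochner_Integration.integral_add) (auto simp: R.emeasure_eq_measure R.prob_space[unfolded space_unif01])
    have eq: "(\<integral>\<^sup>+r. ennreal (E * (G x + ?n * indicator ?S r)) \<partial>unif01) = ennreal (E * (G x + ?n * flip_prob d \<eta> u x))"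
      using nn_integral_eq_integral[OF int AE_I2[OF nn], unfolded ieq] .
    show "(\<integral>\<^sup>+r. ennreal (exp (\<Lambda> * (1 - dotp d u (upd d \<eta> w x r)))) \<partial>unif01) \<le> ennreal (E * (G x + ?n * flip_prob d \<eta> u x))"
      unfolding eq[symmetric] by (intro nn_integral_mono ennreal_leI pt)
    have "0 \<le> (\<integral>r. E * (G x + ?n * indicator ?S r) \<partial>unif01)" using nn by (intro Bochner_Integration.integral_nonneg) auto
    then show "0 \<le> G x + ?n * flip_prob d \<eta> u x"
      unfolding ieq using E by (simp only: zero_le_mult_iff) linarith
  qed
  have fm[measurable]: "flip_prob d \<eta> u \<in> borel_measurable (euclid d)" by (rule flip_prob_measurable[OF \<eta>])
  have ints: "integrable (unif_sphere d) ?\<psi>" "integrable (unif_sphere d) (\<lambda>x. ?\<psi> x * max 0 (- dotp d h x))"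
    "integrable (unif_sphere d) (\<lambda>x. ?\<psi> x * (dotp d h x)\<^sup>2)" "integrable (unif_sphere d) (\<lambda>x. ?\<psi> x * flip_prob d \<eta> u x)"
    "integrable (unif_sphere d) (flip_prob d \<eta> u)"
  proof -
    show "integrable (unif_sphere d) ?\<psi>" by (rule B.integrable_psi_w)
    show "integrable (unif_sphere d) (\<lambda>x. ?\<psi> x * max 0 (- dotp d h x))"
      using B.AE_h(1) by (intro B.integrable_band[where B=1]) (auto elim!: eventually_mono)
    show "integrable (unif_sphere d) (\<lambda>x. ?\<psi> x * (dotp d h x)\<^sup>2)" by (rule B.integrable_h)
    show "integrable (unif_sphere d) (\<lambda>x. ?\<psi> x * flip_prob d \<eta> u x)"
      using flip_prob_bounds by (intro B.integrable_band[where B=1]) auto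
    show "integrable (unif_sphere d) (flip_prob d \<eta> u)"
      using flip_prob_bounds by (intro integrable_sphere_bounded[where B=1]) auto
  qed
  have expand: "?\<psi> x * (G x + ?n * flip_prob d \<eta> u x)
     = (1 + \<Lambda> * b\<^sup>2 + ?K * (2 * b\<^sup>2)) * ?\<psi> x - ?A * (?\<psi> x * max 0 (- dotp d h x)) + ?K * (2 * s\<^sup>2) * (?\<psi> x * (dotp d h x)\<^sup>2) + ?n * (?\<psi> x * flip_prob d \<eta> u x)" for x
    unfolding G_def by (simp only: algebra_simps)
  have intG: "integrable (unif_sphere d) (\<lambda>x. E * (?\<psi> x * (G x + ?n * flip_prob d \<eta> u x)))"
    unfolding expand using ints by (intro integrable_mult_right Bochner_Integration.integrable_add Bochner_Integration.integrable_diff) auto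
  have "(\<integral>\<^sup>+x. (if in_band d w b x then \<integral>\<^sup>+r. ennreal (exp (\<Lambda> * (1 - dotp d u (upd d \<eta> w x r)))) \<partial>unif01 else 0) \<partial>unif_sphere d)
     \<le> (\<integral>\<^sup>+x. ennreal (E * (?\<psi> x * (G x + ?n * flip_prob d \<eta> u x))) \<partial>unif_sphere d)"
  proof (rule nn_integral_mono_AE)
    have pt: "(if in_band d w b x then \<integral>\<^sup>+r. ennreal (exp (\<Lambda> * (1 - dotp d u (upd d \<eta> w x r)))) \<partial>unif01 else 0)
       \<le> ennreal (E * (?\<psi> x * (G x + ?n * flip_prob d \<eta> u x)))" if "dotp d x x = 1" "x \<in> space (unif_sphere d)" for x
      using inner[of x] that by (cases "in_band d w b x") (auto simp: in_band_indicator)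
    show "AE x in unif_sphere d. (if in_band d w b x then \<integral>\<^sup>+r. ennreal (exp (\<Lambda> * (1 - dotp d u (upd d \<eta> w x r)))) \<partial>unif01 else 0)
       \<le> ennreal (E * (?\<psi> x * (G x + ?n * flip_prob d \<eta> u x)))"
      using AE_unit[OF B.coords(1)] AE_space by eventually_elim (rule pt)
  qed
  also have "\<dots> = ennreal (\<integral>x. E * (?\<psi> x * (G x + ?n * flip_prob d \<eta> u x)) \<partial>unif_sphere d)"
  proof (rule nn_integral_eq_integral[OF intG])
    have pt: "0 \<le> E * (?\<psi> x * (G x + ?n * flip_prob d \<eta> u x))" if "dotp d x x = 1" "x \<in> space (unif_sphere d)" for x
      using pos[of x] that E by (cases "in_band d w b x") (auto simp: in_band_def indicator_def)
    show "AE x in unif_sphere d. 0 \<le> E * (?\<psi> x * (G x + ?n * flip_prob d \<eta> u x))"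
      using AE_unit[OF B.coords(1)] AE_space by eventually_elim (rule pt)
  qed
  also have "\<dots> \<le> ennreal (E * (p * (1 - \<Lambda> * b * s / (4 * sqrt (real d)) + \<Lambda> * b\<^sup>2
         + ?K * (2 * b\<^sup>2 + 2 * s\<^sup>2 / (real d - 1))) + ?n * \<nu>))"
  proof (intro ennreal_leI)
    define I1 where "I1 = (\<integral>x. ?\<psi> x * max 0 (- dotp d h x) \<partial>unif_sphere d)"
    define I2 where "I2 = (\<integral>x. ?\<psi> x * (dotp d h x)\<^sup>2 \<partial>unif_sphere d)"
    define I3 where "I3 = (\<integral>x. ?\<psi> x * flip_prob d \<eta> u x \<partial>unif_sphere d)"
    have I1: "p / (4 * sqrt (real d)) \<le> I1" unfolding I1_def p by (rule B.neg_part_lower)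
    have I2: "I2 \<le> p / (real d - 1)" unfolding I2_def p by (rule B.second_moment_upper)
    \<comment> \<open>In the worst case the adversary puts all noise into the band, so the full
      budget \<nu> is charged there.\<close>
    have "I3 \<le> (\<integral>x. flip_prob d \<eta> u x \<partial>unif_sphere d)"
      unfolding I3_def using ints flip_prob_bounds by (intro integral_mono) (auto simp: indicator_def)
    then have I3: "I3 \<le> \<nu>" using flip_prob_integral[OF \<eta> noise] by simp
    have "(\<integral>x. E * (?\<psi> x * (G x + ?n * flip_prob d \<eta> u x)) \<partial>unif_sphere d)
      = E * ((1 + \<Lambda> * b\<^sup>2 + ?K * (2 * b\<^sup>2)) * p - ?A * I1 + ?K * (2 * s\<^sup>2) * I2 + ?n * I3)"
      unfolding expand I1_def I2_def I3_def p using ints by simp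
    also have "\<dots> \<le> E * ((1 + \<Lambda> * b\<^sup>2 + ?K * (2 * b\<^sup>2)) * p - ?A * (p / (4 * sqrt (real d))) + ?K * (2 * s\<^sup>2) * (p / (real d - 1)) + ?n * \<nu>)"
      using E K L b s by (intro mult_left_mono add_mono diff_mono I1 I2 I3) auto
    also have "\<dots> = E * (p * (1 - \<Lambda> * b * s / (4 * sqrt (real d)) + \<Lambda> * b\<^sup>2
         + ?K * (2 * b\<^sup>2 + 2 * s\<^sup>2 / (real d - 1))) + ?n * \<nu>)"
      by (simp add: algebra_simps)
    finally show "(\<integral>x. E * (?\<psi> x * (G x + ?n * flip_prob d \<eta> u x)) \<partial>unif_sphere d) \<le> \<dots>" .
  qed
  finally show ?thesis unfolding E_def .
qed

text \<open>A bound that uses only the largest possible displacement of \<open>w\<close> and no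
  property of the labels. It replaces the drift near \<open>u\<close>, where the gain, proportional
  to the sine of the angle, no longer dominates the losses.\<close>

lemma potential_step_trivial:
  assumes d: "0 < d" and w: "dotp d w w = 1" and u: "dotp d u u = 1"
    and b: "0 < b" and L: "0 < \<Lambda>"
    and p_def: "p = measure (unif_sphere d) {x \<in> space (unif_sphere d). in_band d w b x}"
  shows "(\<integral>\<^sup>+x. (if in_band d w b x then \<integral>\<^sup>+r. ennreal (exp (\<Lambda> * (1 - dotp d u (upd d \<eta> w x r)))) \<partial>unif01 else 0) \<partial>unif_sphere d)
    \<le> ennreal (p * exp (\<Lambda> * (1 - dotp d w u + 2 * b * (b + sqrt (1 - (dotp d w u)\<^sup>2)))))"
proof -
  interpret X: prob_space "unif_sphere d" by (rule prob_space_unif_sphere)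
  interpret R: prob_space unif01 by (rule prob_space_unif01)
  let ?E = "exp (\<Lambda> * (1 - dotp d w u + 2 * b * (b + sqrt (1 - (dotp d w u)\<^sup>2))))"
  let ?B = "{x \<in> space (unif_sphere d). in_band d w b x}"
  have B: "?B \<in> sets (unif_sphere d)" by (rule in_band_sets)
  have "(\<integral>\<^sup>+x. (if in_band d w b x then \<integral>\<^sup>+r. ennreal (exp (\<Lambda> * (1 - dotp d u (upd d \<eta> w x r)))) \<partial>unif01 else 0) \<partial>unif_sphere d)
    \<le> (\<integral>\<^sup>+x. ennreal ?E * indicator ?B x \<partial>unif_sphere d)"
  proof (rule nn_integral_mono_AE)
    have pt: "(if in_band d w b x then \<integral>\<^sup>+r. ennreal (exp (\<Lambda> * (1 - dotp d u (upd d \<eta> w x r)))) \<partial>unif01 else 0)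
      \<le> ennreal ?E * indicator ?B x" if x: "dotp d x x = 1" "x \<in> space (unif_sphere d)" for x
    proof (cases "in_band d w b x")
      case True
      have band: "b / 2 \<le> dotp d w x" "dotp d w x \<le> b" using True by (auto simp: in_band_def)
      have c: "\<bar>dotp d u x\<bar> \<le> b + sqrt (1 - (dotp d w u)\<^sup>2)"
        using component_bound[OF w u x(1), of b] band b by simp
      have "1 - dotp d u (upd d \<eta> w x r) \<le> 1 - dotp d w u + 2 * b * (b + sqrt (1 - (dotp d w u)\<^sup>2))" for r
      proof -
        have "2 * b * \<bar>dotp d u x\<bar> \<le> 2 * b * (b + sqrt (1 - (dotp d w u)\<^sup>2))" using b c by (intro mult_left_mono) auto
        then show ?thesis
          unfolding dotp_upd using step_abs[OF band b, of "label_of \<eta> x r" "dotp d u x"] dotp_commute[of d u w]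
          by (auto split: if_splits)
      qed
      then have "(\<integral>\<^sup>+r. ennreal (exp (\<Lambda> * (1 - dotp d u (upd d \<eta> w x r)))) \<partial>unif01) \<le> (\<integral>\<^sup>+r. ennreal ?E \<partial>unif01)"
        using L by (intro nn_integral_mono ennreal_leI) simp
      also have "\<dots> = ennreal ?E" using R.emeasure_space_1 by simp
      finally show ?thesis using True x by simp
    qed simp
    show "AE x in unif_sphere d. (if in_band d w b x then \<integral>\<^sup>+r. ennreal (exp (\<Lambda> * (1 - dotp d u (upd d \<eta> w x r)))) \<partial>unif01 else 0)
      \<le> ennreal ?E * indicator ?B x"
      using AE_unit[OF d] AE_space by eventually_elim (rule pt)
  qed
  also have "\<dots> = ennreal ?E * emeasure (unif_sphere d) ?B" by (rule nn_integral_cmult_indicator[OF B])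
  also have "\<dots> = ennreal (p * ?E)" unfolding X.emeasure_eq_measure p_def by (simp add: ennreal_mult mult.commute)
  finally show ?thesis .
qed

section \<open>Transition operators of the chain of weight vectors\<close>

locale noisy_halfspace =
  fixes d :: nat and \<eta> :: "vec \<Rightarrow> real" and u :: vec and \<nu> :: real
  assumes d: "3 \<le> d" and \<eta>: "\<eta> \<in> borel_measurable (euclid d)"
    and u: "dotp d u u = 1" and noise: "adversarial_noise d \<eta> \<nu> u"
begin

definition band_prob :: "real \<Rightarrow> vec \<Rightarrow> real" where
  "band_prob b w = measure (unif_sphere d) {x \<in> space (unif_sphere d). in_band d w b x}"

definition band_int :: "real \<Rightarrow> (vec \<Rightarrow> ennreal) \<Rightarrow> vec \<Rightarrow> ennreal" where
  "band_int b f w = (\<integral>\<^sup>+x. (if in_band d w b x then \<integral>\<^sup>+r. f (upd d \<eta> w x r) \<partial>unif01 else 0) \<partial>unif_sphere d)"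

text \<open>The expected value of \<open>f\<close> after one iteration from \<open>w\<close>: an
  accepted point is uniform conditional on the band, hence the quotient. The number of rejected
  points no longer appears.\<close>

definition step_op :: "real \<Rightarrow> (vec \<Rightarrow> ennreal) \<Rightarrow> vec \<Rightarrow> ennreal" where
  "step_op b f w = band_int b f w / ennreal (band_prob b w)"

definition run_op :: "real list \<Rightarrow> (vec \<Rightarrow> ennreal) \<Rightarrow> vec \<Rightarrow> ennreal" where
  "run_op bs f = foldr step_op bs f"

lemma run_op_simps[simp]:
  "run_op [] f = f" "run_op (b # bs) f = step_op b (run_op bs f)" "run_op (bs @ cs) f = run_op bs (run_op cs f)"
  by (simp_all add: run_op_def)

definition admissible :: "real \<Rightarrow> bool" where
  "admissible b \<longleftrightarrow> 0 < b \<and> b\<^sup>2 * real d \<le> 1/2"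

lemma d0: "0 < d" using d by simp

lemma band_prob_lower_bound:
  assumes "admissible b" "dotp d w w = 1"
  shows "b * sqrt (real d) / 50 \<le> band_prob b w"
  unfolding band_prob_def in_band_def
  using assms d by (intro band_prob_lower) (auto simp: admissible_def)

lemma band_prob_pos:
  assumes "admissible b" "dotp d w w = 1" shows "0 < band_prob b w"
proof -
  have "0 < b * sqrt (real d) / 50" using assms d by (auto simp: admissible_def)
  then show ?thesis using band_prob_lower_bound[OF assms] by linarith
qed

lemma band_prob_le_1: "band_prob b w \<le> 1"
proof -
  interpret X: prob_space "unif_sphere d" by (rule prob_space_unif_sphere)
  show ?thesis unfolding band_prob_def by (rule X.prob_le_1)
qed

lemma band_int_measurable:
  assumes f: "f \<in> borel_measurable (euclid d)"
  shows "band_int b f \<in> borel_measurable (euclid d)"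
proof -
  interpret X: prob_space "unif_sphere d" by (rule prob_space_unif_sphere)
  interpret R: prob_space unif01 by (rule prob_space_unif01)
  have A: "(\<lambda>z. \<integral>\<^sup>+r. f (upd d \<eta> (fst z) (snd z) r) \<partial>unif01) \<in> borel_measurable (euclid d \<Otimes>\<^sub>M unif_sphere d)"
  proof (rule R.borel_measurable_nn_integral)
    show "(\<lambda>(z, r). f (upd d \<eta> (fst z) (snd z) r)) \<in> borel_measurable ((euclid d \<Otimes>\<^sub>M unif_sphere d) \<Otimes>\<^sub>M unif01)"
      unfolding case_prod_beta
      by (rule measurable_compose[OF _ f], rule upd_measurable[OF \<eta>]) measurable
  qed
  have B: "Measurable.pred (euclid d \<Otimes>\<^sub>M unif_sphere d) (\<lambda>z. in_band d (fst z) b (snd z))"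
    by (rule in_band_measurable) measurable
  have m: "(\<lambda>z. if in_band d (fst z) b (snd z) then \<integral>\<^sup>+r. f (upd d \<eta> (fst z) (snd z) r) \<partial>unif01 else 0) \<in> borel_measurable (euclid d \<Otimes>\<^sub>M unif_sphere d)"
    by (rule measurable_If[OF A _ predE[OF B]]) simp
  show ?thesis unfolding band_int_def[abs_def]
    by (rule X.borel_measurable_nn_integral) (use m in \<open>simp add: case_prod_beta\<close>)
qed

lemma band_int_const:
  "band_int b (\<lambda>_. c) w = c * ennreal (band_prob b w)"
proof -
  interpret X: prob_space "unif_sphere d" by (rule prob_space_unif_sphere)
  interpret R: prob_space unif01 by (rule prob_space_unif01)
  have "band_int b (\<lambda>_. c) w = (\<integral>\<^sup>+x. c * indicator {x \<in> space (unif_sphere d). in_band d w b x} x \<partial>unif_sphere d)"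
    unfolding band_int_def using R.emeasure_space_1 by (intro nn_integral_cong) (simp add: indicator_def)
  also have "\<dots> = c * ennreal (band_prob b w)"
    by (subst nn_integral_cmult_indicator[OF in_band_sets]) (simp add: X.emeasure_eq_measure band_prob_def)
  finally show ?thesis .
qed

lemma band_prob_measurable: "(\<lambda>w. ennreal (band_prob b w)) \<in> borel_measurable (euclid d)"
proof -
  have "band_int b (\<lambda>_. 1) = (\<lambda>w. ennreal (band_prob b w))" by (simp add: fun_eq_iff band_int_const)
  then show ?thesis using band_int_measurable[of "\<lambda>_. 1" b] by simp
qed

lemma step_op_measurable:
  "f \<in> borel_measurable (euclid d) \<Longrightarrow> step_op b f \<in> borel_measurable (euclid d)"
  unfolding step_op_def[abs_def]
  using band_int_measurable band_prob_measurable by (intro borel_measurable_divide_ennreal) auto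

lemma run_op_measurable:
  "f \<in> borel_measurable (euclid d) \<Longrightarrow> run_op bs f \<in> borel_measurable (euclid d)"
  by (induction bs) (auto intro: step_op_measurable)

lemma band_int_mono:
  assumes "dotp d w w = 1" "w \<in> space (euclid d)"
    and "\<And>w. dotp d w w = 1 \<Longrightarrow> w \<in> space (euclid d) \<Longrightarrow> f w \<le> g w"
  shows "band_int b f w \<le> band_int b g w"
  unfolding band_int_def
proof (rule nn_integral_mono_AE)
  have le: "(if in_band d w b x then \<integral>\<^sup>+r. f (upd d \<eta> w x r) \<partial>unif01 else 0) \<le> (if in_band d w b x then \<integral>\<^sup>+r. g (upd d \<eta> w x r) \<partial>unif01 else 0)"
    if "dotp d x x = 1" for x
    using assms upd_unit[OF assms(1) that assms(2)] by (auto intro!: nn_integral_mono)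
  show "AE x in unif_sphere d. (if in_band d w b x then \<integral>\<^sup>+r. f (upd d \<eta> w x r) \<partial>unif01 else 0) \<le> (if in_band d w b x then \<integral>\<^sup>+r. g (upd d \<eta> w x r) \<partial>unif01 else 0)"
    using AE_unit[OF d0] by eventually_elim (rule le)
qed

lemma step_op_mono:
  assumes "dotp d w w = 1" "w \<in> space (euclid d)"
    and "\<And>w. dotp d w w = 1 \<Longrightarrow> w \<in> space (euclid d) \<Longrightarrow> f w \<le> g w"
  shows "step_op b f w \<le> step_op b g w"
  unfolding step_op_def by (intro divide_right_mono_ennreal band_int_mono assms)

lemma band_int_affine:
  assumes f: "f \<in> borel_measurable (euclid d)" and w: "w \<in> space (euclid d)"
  shows "band_int b (\<lambda>w. c + a * f w) w = c * ennreal (band_prob b w) + a * band_int b f w"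
proof -
  interpret R: prob_space unif01 by (rule prob_space_unif01)
  interpret X: prob_space "unif_sphere d" by (rule prob_space_unif_sphere)
  have fm: "(\<lambda>r. f (upd d \<eta> w x r)) \<in> borel_measurable unif01" if "x \<in> space (unif_sphere d)" for x
    using w that by (intro measurable_compose[OF _ f] upd_measurable[OF \<eta>]) (auto intro: measurable_ident_sets)
  have m: "(\<lambda>z. if in_band d w b z then \<integral>\<^sup>+r. f (upd d \<eta> w z r) \<partial>unif01 else 0) \<in> borel_measurable (unif_sphere d)"
  proof (rule measurable_If)
    show "(\<lambda>x. \<integral>\<^sup>+r. f (upd d \<eta> w x r) \<partial>unif01) \<in> borel_measurable (unif_sphere d)"
    proof (rule R.borel_measurable_nn_integral)
      show "(\<lambda>(x, r). f (upd d \<eta> w x r)) \<in> borel_measurable (unif_sphere d \<Otimes>\<^sub>M unif01)"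
        unfolding case_prod_beta using w
        by (intro measurable_compose[OF _ f] upd_measurable[OF \<eta>]) measurable
    qed
    show "{x \<in> space (unif_sphere d). in_band d w b x} \<in> sets (unif_sphere d)" by (rule in_band_sets)
  qed auto
  have "band_int b (\<lambda>w. c + a * f w) w
    = (\<integral>\<^sup>+x. c * indicator {x \<in> space (unif_sphere d). in_band d w b x} x + a * (if in_band d w b x then \<integral>\<^sup>+r. f (upd d \<eta> w x r) \<partial>unif01 else 0) \<partial>unif_sphere d)"
    unfolding band_int_def
  proof (rule nn_integral_cong)
    fix x assume x: "x \<in> space (unif_sphere d)"
    have "(\<integral>\<^sup>+r. c + a * f (upd d \<eta> w x r) \<partial>unif01) = c + a * (\<integral>\<^sup>+r. f (upd d \<eta> w x r) \<partial>unif01)"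
      using fm[OF x] R.emeasure_space_1 by (subst nn_integral_add) (auto simp: nn_integral_cmult)
    then show "(if in_band d w b x then \<integral>\<^sup>+r. c + a * f (upd d \<eta> w x r) \<partial>unif01 else 0)
      = c * indicator {x \<in> space (unif_sphere d). in_band d w b x} x + a * (if in_band d w b x then \<integral>\<^sup>+r. f (upd d \<eta> w x r) \<partial>unif01 else 0)"
      using x by (simp add: indicator_def)
  qed
  also have "\<dots> = c * ennreal (band_prob b w) + a * band_int b f w"
    unfolding band_int_def using m in_band_sets[of d w b]
    by (subst nn_integral_add) (auto simp: nn_integral_cmult nn_integral_cmult_indicator X.emeasure_eq_measure band_prob_def)
  finally show ?thesis .
qed

text \<open>A Markov operator fixes constants. The band probability is positive and finite, as the
  cancellation in \<open>ennreal\<close> requires.\<close>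

lemma step_op_affine:
  assumes f: "f \<in> borel_measurable (euclid d)" and w: "w \<in> space (euclid d)" "dotp d w w = 1" and b: "admissible b"
  shows "step_op b (\<lambda>w. c + a * f w) w = c + a * step_op b f w"
proof -
  have p: "ennreal (band_prob b w) \<noteq> 0" "ennreal (band_prob b w) \<noteq> \<top>" using band_prob_pos[OF b w(2)] by auto
  then show ?thesis
    unfolding step_op_def band_int_affine[OF f w(1)]
    by (simp add: add_divide_distrib_ennreal ennreal_times_divide mult_divide_eq_ennreal)
qed

lemma suminf_geometric_ennreal:
  assumes "0 < p" "p \<le> 1" shows "(\<Sum>n. ennreal ((1 - p) ^ n)) = ennreal (1 / p)"
  using assms sums_unique[OF geometric_sums[of "1 - p"]] summable_geometric[of "1 - p"]
  by (subst suminf_ennreal2) auto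

text \<open>For a cost that ignores the draw count, the sum over rejected points is the geometric
  series with value 1 / p, which is the normalisation that turns \<open>band_int\<close> into
  \<open>step_op\<close>.\<close>

theorem cost_le_run_op:
  assumes f: "f \<in> borel_measurable (euclid d)" and bs: "\<And>b. b \<in> set bs \<Longrightarrow> admissible b"
    and w: "dotp d w w = 1" "w \<in> space (euclid d)"
  shows "(\<integral>\<^sup>+xs. \<integral>\<^sup>+rs. cost d \<eta> (\<lambda>w N. f w) bs w N xs rs \<partial>coins \<partial>points d) \<le> run_op bs f w"
proof -
  let ?V = "\<lambda>i w (N::nat). run_op (drop i bs) f w"
  have "(\<integral>\<^sup>+xs. \<integral>\<^sup>+rs. cost d \<eta> (?V (length bs)) bs w N xs rs \<partial>coins \<partial>points d) \<le> ?V 0 w N"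
  proof (rule cost_integral_le[OF _ \<eta>])
    show "(\<lambda>w. ?V i w N) \<in> borel_measurable (euclid d)" for i N by (rule run_op_measurable[OF f])
    show "0 < measure (unif_sphere d) {x \<in> space (unif_sphere d). in_band d w b x}" if "b \<in> set bs" "dotp d w w = 1" for b w
      using band_prob_pos[OF bs that(2)] that by (simp add: band_prob_def)
    fix i w N assume i: "i < length bs" and w: "dotp d w w = 1" "w \<in> space (euclid d)"
    have p: "0 < band_prob (bs ! i) w" using band_prob_pos[OF bs w(1)] i by simp
    have "(\<Sum>n. ennreal ((1 - band_prob (bs ! i) w) ^ n) * band_int (bs ! i) (run_op (drop (Suc i) bs) f) w)
      = ennreal (1 / band_prob (bs ! i) w) * band_int (bs ! i) (run_op (drop (Suc i) bs) f) w"
      using suminf_geometric_ennreal[OF p band_prob_le_1] by simp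
    also have "\<dots> = step_op (bs ! i) (run_op (drop (Suc i) bs) f) w"
      unfolding step_op_def divide_ennreal_def using p by (simp add: inverse_ennreal inverse_eq_divide mult.commute)
    also have "\<dots> = run_op (drop i bs) f w"
      using i by (simp flip: Cons_nth_drop_Suc)
    finally show "(\<Sum>n. ennreal ((1 - measure (unif_sphere d) {x \<in> space (unif_sphere d). in_band d w (bs ! i) x}) ^ n) *
          (\<integral>\<^sup>+x. (if in_band d w (bs ! i) x then \<integral>\<^sup>+r. run_op (drop (Suc i) bs) f (upd d \<eta> w x r) \<partial>unif01 else 0) \<partial>unif_sphere d))
        \<le> run_op (drop i bs) f w"
      unfolding band_int_def band_prob_def by simp
  qed (use d w in auto)
  then show ?thesis by simp
qed

text \<open>The base \<open>1 / (1 - p / 2)\<close> makes the generating function of each geometric waiting time at most 2.\<close>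

theorem cost_draws_le:
  fixes p :: real
  assumes bs: "\<And>b. b \<in> set bs \<Longrightarrow> admissible b \<and> p \<le> b * sqrt (real d) / 50"
    and p: "0 < p" "p \<le> 1" and w: "dotp d w w = 1" "w \<in> space (euclid d)"
  shows "(\<integral>\<^sup>+xs. \<integral>\<^sup>+rs. cost d \<eta> (\<lambda>w N. ennreal ((1 / (1 - p / 2)) ^ N)) bs w 0 xs rs \<partial>coins \<partial>points d) \<le> ennreal (2 ^ length bs)"
proof -
  define c where "c = 1 / (1 - p / 2)"
  have c: "1 \<le> c" "0 < c" using p by (auto simp: c_def)
  let ?V = "\<lambda>i (w::vec) N. ennreal (2 ^ (length bs - i) * c ^ N)"
  have "(\<integral>\<^sup>+xs. \<integral>\<^sup>+rs. cost d \<eta> (?V (length bs)) bs w 0 xs rs \<partial>coins \<partial>points d) \<le> ?V 0 w 0"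
  proof (rule cost_integral_le[OF _ \<eta>])
    show "0 < measure (unif_sphere d) {x \<in> space (unif_sphere d). in_band d w b x}" if "b \<in> set bs" "dotp d w w = 1" for b w
      using band_prob_pos[OF _ that(2)] bs[OF that(1)] by (simp add: band_prob_def)
    fix i w N assume i: "i < length bs" and w: "dotp d w w = 1" "w \<in> space (euclid d)"
    define P where "P = band_prob (bs ! i) w"
    have P: "p \<le> P" "P \<le> 1" "0 < P"
      using bs[of "bs ! i"] band_prob_lower_bound[of "bs ! i" w] i w(1) p band_prob_le_1 unfolding P_def by force+
    define m where "m = length bs - Suc i"
    have m: "length bs - i = Suc m" using i by (simp add: m_def)
    have x: "0 \<le> (1 - P) * c" "(1 - P) * c < 1"
      using P p c by (auto simp: c_def field_simps)
    have "(\<Sum>n. ennreal ((1 - P) ^ n) * band_int (bs ! i) (\<lambda>_. ennreal (2 ^ m * c ^ (N + Suc n))) w)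
       = (\<Sum>n. ennreal (2 ^ m * c ^ N * (c * P) * ((1 - P) * c) ^ n))"
      unfolding band_int_const P_def[symmetric] using P c
      by (intro suminf_cong) (simp add: ennreal_mult[symmetric] power_mult_distrib power_add mult_ac)
    also have "\<dots> = ennreal (2 ^ m * c ^ N * (c * P) * (1 / (1 - (1 - P) * c)))"
      using x P c sums_mult[OF geometric_sums[of "(1 - P) * c"], of "2 ^ m * c ^ N * (c * P)"]
      by (intro suminf_ennreal_eq) auto
    also have "\<dots> \<le> ennreal (2 ^ m * c ^ N * 2)"
    proof (intro ennreal_leI)
      \<comment> \<open>The quotient simplifies to 2 P / (2 P - p), and it is at most 2 because the
        true band probability \<open>P\<close> is at least \<open>p\<close>.\<close>
      have "(c * P) * (1 / (1 - (1 - P) * c)) \<le> 2"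
      proof -
        have "c * P = 2 * P / (2 - p)" "1 - (1 - P) * c = (2 * P - p) / (2 - p)"
          using p by (auto simp: c_def field_simps)
        then have "(c * P) * (1 / (1 - (1 - P) * c)) = (2 * P / (2 - p)) * (1 / ((2 * P - p) / (2 - p)))" by (simp only:)
        also have "\<dots> = 2 * P / (2 * P - p)"
        proof -
          have "(A / q) * (1 / (B / q)) = A / B" if "q \<noteq> 0" for A B q :: real using that by simp
          moreover have "2 - p \<noteq> 0" using p by simp
          ultimately show ?thesis by blast
        qed
        also have "\<dots> \<le> 2" using p P by (simp add: divide_le_eq)
        finally show ?thesis .
      qed
      then have "2 ^ m * c ^ N * ((c * P) * (1 / (1 - (1 - P) * c))) \<le> 2 ^ m * c ^ N * 2"
        using c by (intro mult_left_mono) auto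
      then show "2 ^ m * c ^ N * (c * P) * (1 / (1 - (1 - P) * c)) \<le> 2 ^ m * c ^ N * 2" by (simp only: mult.assoc)
    qed
    also have "\<dots> = ?V i w N" by (simp add: m mult_ac)
    finally show "(\<Sum>n. ennreal ((1 - measure (unif_sphere d) {x \<in> space (unif_sphere d). in_band d w (bs ! i) x}) ^ n) *
          (\<integral>\<^sup>+x. (if in_band d w (bs ! i) x then \<integral>\<^sup>+r. ?V (Suc i) (upd d \<eta> w x r) (N + Suc n) \<partial>unif01 else 0) \<partial>unif_sphere d))
        \<le> ?V i w N"
      unfolding P_def band_int_def band_prob_def m_def by simp
  qed (use d w in auto)
  then show ?thesis by (simp add: c_def)
qed


text \<open>For unit \<open>w\<close> this is half the squared distance to \<open>u\<close>. It is
  quadratic in the angle, so halving the angle corresponds to quartering this quantity.\<close>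

definition miss :: "vec \<Rightarrow> real" where
  "miss w = 1 - dotp d w u"

definition Phi :: "real \<Rightarrow> vec \<Rightarrow> ennreal" where
  "Phi \<Lambda> w = ennreal (exp (\<Lambda> * miss w))"

lemma Phi_measurable: "Phi \<Lambda> \<in> borel_measurable (euclid d)"
proof -
  have "miss \<in> borel_measurable (euclid d)"
    unfolding miss_def[abs_def] dotp_commute[of d _ u] by measurable
  then show ?thesis unfolding Phi_def[abs_def] by measurable
qed

lemma miss_bounds: "dotp d w w = 1 \<Longrightarrow> 0 \<le> miss w" "dotp d w w = 1 \<Longrightarrow> miss w \<le> 2"
  using abs_dotp_le_1[OF _ u, of w] by (auto simp: miss_def)

lemma sine_eq: "1 - (dotp d w u)\<^sup>2 = miss w * (2 - miss w)"
  by (simp add: miss_def power2_eq_square algebra_simps)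

text \<open>Parameters of one epoch: \<open>\<tau> = 2 ^ - k\<close>, \<open>\<beta>\<close> is the band width in units of \<open>\<tau> / sqrt d\<close>, and the
  temperature \<open>\<Lambda>\<close> is such that \<open>\<Lambda> b \<tau> sqrt d = 1 / 300\<close>.\<close>

context
  fixes \<tau> \<beta> b \<Lambda> :: real
  assumes tau: "0 < \<tau>" "\<tau> \<le> 1/2" and beta: "0 < \<beta>" "\<beta> \<le> 1/300"
    and b_eq: "b = \<beta> * \<tau> / sqrt (real d)" and L_eq: "\<Lambda> = 1 / (300 * \<beta> * \<tau>\<^sup>2)"
    and nu: "\<nu> \<le> 1/100000 * (\<beta> * \<tau> / 50)"
begin

lemma sqrt_d: "0 < sqrt (real d)" "sqrt (real d) * sqrt (real d) = real d" "1 \<le> sqrt (real d)"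
  using d by auto

lemma params_pos: "0 < b" "0 < \<Lambda>"
  using tau beta sqrt_d by (auto simp: b_eq L_eq)

lemma b_sq: "b\<^sup>2 = \<beta>\<^sup>2 * \<tau>\<^sup>2 / real d"
  by (simp add: b_eq power_divide power_mult_distrib)

lemma b_small: "b\<^sup>2 \<le> 1/18" "admissible b"
proof -
  have "\<beta>\<^sup>2 \<le> (1/300)\<^sup>2" "\<tau>\<^sup>2 \<le> (1/2)\<^sup>2" using tau beta by (auto intro!: power_mono)
  then have "\<beta>\<^sup>2 * \<tau>\<^sup>2 \<le> (1/300)\<^sup>2 * (1/2)\<^sup>2" by (intro mult_mono) auto
  moreover have "b\<^sup>2 * real d = \<beta>\<^sup>2 * \<tau>\<^sup>2" using d by (simp add: b_sq)
  moreover have "(1/300)\<^sup>2 * (1/2)\<^sup>2 \<le> (1/18 :: real)" by (simp add: power2_eq_square)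
  ultimately have le: "b\<^sup>2 * real d \<le> 1/18" by linarith
  have "b\<^sup>2 * 1 \<le> b\<^sup>2 * real d" using d by (intro mult_left_mono) auto
  with le show "b\<^sup>2 \<le> 1/18" by linarith
  show "admissible b" using params_pos le unfolding admissible_def by linarith
qed

lemma Lb: "\<Lambda> * b = 1 / (300 * \<tau> * sqrt (real d))"
  using tau beta sqrt_d by (simp add: b_eq L_eq power2_eq_square field_simps)

text \<open>Provides the condition under which the exponential may be replaced by its quadratic
  bound. The limit 7/2 fits the region \<open>miss w \<le> 6 * \<tau>\<^sup>2\<close>, where s^2 is
  at most twice \<open>miss\<close>, hence at most 12 \<tau>^2 < (7/2 \<tau>)^2.\<close>

lemma step_small:
  assumes "0 \<le> s" "s \<le> 7/2 * \<tau>" shows "\<Lambda> * (2 * b * (b + s)) \<le> 1"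
proof -
  have "b \<le> \<beta> * \<tau> / 1" unfolding b_eq using tau beta sqrt_d by (intro divide_left_mono) auto
  also have "\<dots> \<le> 1 * \<tau>" using beta tau by simp
  finally have "b + s \<le> 9/2 * \<tau>" using assms by simp
  then have "(\<Lambda> * b) * (2 * (b + s)) \<le> (\<Lambda> * b) * (2 * (9/2 * \<tau>))" using params_pos by (intro mult_left_mono) auto
  also have "\<dots> = 9 / (300 * sqrt (real d))" unfolding Lb using tau sqrt_d by (simp add: field_simps)
  also have "\<dots> \<le> 9 / (300 * 1)" using sqrt_d by (intro divide_left_mono) auto
  finally have "(\<Lambda> * b) * (2 * (b + s)) \<le> 1" by simp
  moreover have "\<Lambda> * (2 * b * (b + s)) = (\<Lambda> * b) * (2 * (b + s))" by simp
  ultimately show ?thesis by (simp only:)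
qed

text \<open>The bracket is the drift per iteration in units of \<open>1 / (300 d)\<close>, with \<open>x = s / \<tau>\<close>.\<close>

lemma drift_bracket:
  fixes x :: real assumes "1/12 \<le> x" "x \<le> 7/2"
  shows "6/1000 \<le> x / 4 - \<beta> - 1/100 * (2 * \<beta>\<^sup>2 + 3 * x\<^sup>2) - 2/1000"
proof -
  have "x\<^sup>2 \<le> 7/2 * x" using assms by (simp add: power2_eq_square)
  moreover have "\<beta>\<^sup>2 \<le> 1/300 * \<beta>" using beta by (simp add: power2_eq_square)
  moreover have "1/100 * (2 * \<beta>\<^sup>2 + 3 * x\<^sup>2) = \<beta>\<^sup>2 / 50 + 3 / 100 * x\<^sup>2" by (simp add: field_simps)
  ultimately show ?thesis using assms beta by linarith
qed

text \<open>The two bounds on \<open>miss\<close> confine x = s / \<tau> to [1/12, 7/2]. There the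
  gain x / 4 exceeds the losses from the band width, from the quadratic terms and from noise by
  6/1000, all in units of 1 / (300 d); the contraction 1 / (50000 d) follows.\<close>

lemma step_op_Phi_mid:
  assumes w: "dotp d w w = 1" and z: "\<tau>\<^sup>2 / 64 \<le> miss w" "miss w \<le> 6 * \<tau>\<^sup>2"
  shows "step_op b (Phi \<Lambda>) w \<le> ennreal (1 - 1 / (50000 * real d)) * Phi \<Lambda> w"
proof -
  define t where "t = dotp d w u"
  define s where "s = sqrt (1 - t\<^sup>2)"
  define x where "x = s / \<tau>"
  have t2: "\<tau>\<^sup>2 \<le> 1/4" using power_mono[of \<tau> "1/2" 2] tau by (simp add: power2_eq_square)
  have z2: "miss w \<le> 3/2" using z t2 by simp
  have zp: "0 < miss w" using z tau by (smt (verit) divide_pos_pos zero_less_power)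
  have ss: "s\<^sup>2 = miss w * (2 - miss w)"
    unfolding s_def t_def sine_eq using zp z2 by simp
  then have "1 - t\<^sup>2 = s\<^sup>2" unfolding t_def sine_eq ..
  moreover have s2pos: "0 < s\<^sup>2" unfolding ss using zp z2 by simp
  ultimately have t1: "t\<^sup>2 < 1" by linarith
  have s0: "0 \<le> s" unfolding s_def using t1 by simp
  have "miss w * (1/2) \<le> miss w * (2 - miss w)" using zp z2 by (intro mult_left_mono) auto
  then have "(\<tau> / 12)\<^sup>2 \<le> s\<^sup>2" unfolding ss using z by (simp add: power_divide)
  then have sl: "\<tau> / 12 \<le> s" using s0 tau by (simp add: power2_le_iff_abs_le)
  have "miss w * (2 - miss w) \<le> miss w * 2" using zp by (intro mult_left_mono) auto
  also have "\<dots> \<le> 49/4 * \<tau>\<^sup>2" using z zero_le_power2[of \<tau>] by linarith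
  also have "\<dots> = (7/2 * \<tau>)\<^sup>2" by (simp add: power_mult_distrib power_divide)
  finally have su: "s \<le> 7/2 * \<tau>" unfolding ss[symmetric] using s0 tau by (simp add: power2_le_iff_abs_le)
  have x: "1/12 \<le> x" "x \<le> 7/2" "s = x * \<tau>" using sl su tau by (auto simp: x_def field_simps)
  \<comment> \<open>This weight makes the noise contribution to the quadratic coefficient, 1 /
    (60000 \<tau>^2), comparable to the bound 1 / (67500 \<tau>^2) for the step variance, while the
    remaining noise term is 200 \<nu> / (300 d).\<close>
  define \<rho> where "\<rho> = sqrt (real d) / (200 * \<tau>)"
  have rho: "0 < \<rho>" using sqrt_d tau by (simp add: \<rho>_def)
  define p where "p = band_prob b w"
  have p: "0 < p" "b * sqrt (real d) / 50 \<le> p"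
    unfolding p_def using band_prob_pos[OF b_small(2) w] band_prob_lower_bound[OF b_small(2) w] by auto
  \<comment> \<open>\<beta> \<tau> / 50 is b sqrt d / 50, the lower bound for the band probability;
    so the noise rate given the band is at most 1/100000.\<close>
  have nup: "\<nu> \<le> 1/100000 * p"
  proof -
    have "b * sqrt (real d) = \<beta> * \<tau>" using sqrt_d by (simp add: b_eq)
    then show ?thesis using nu p(2) by simp
  qed
  define K where "K = 1 - \<Lambda> * b * s / (4 * sqrt (real d)) + \<Lambda> * b\<^sup>2
         + (\<Lambda> * b * \<rho> + 4 * \<Lambda>\<^sup>2 * b\<^sup>2) * (2 * b\<^sup>2 + 2 * s\<^sup>2 / (real d - 1))"
  have D: "0 < real d" "0 < real d - 1" using d by auto
  have "band_int b (Phi \<Lambda>) w \<le> ennreal (exp (\<Lambda> * (1 - t)) * (p * K + \<Lambda> * b / \<rho> * \<nu>))"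
    unfolding band_int_def Phi_def miss_def dotp_commute[of d _ u] K_def
  proof (rule potential_step[OF _ w u \<eta> noise t_def[symmetric] t1 s_def params_pos(1) b_small(1) params_pos(2) rho step_small[OF s0 su]])
    show "2 \<le> d" using d by simp
    show "p = measure (unif_sphere d) {x \<in> space (unif_sphere d). in_band d w b x}" by (simp add: p_def band_prob_def)
  qed
  also have "\<dots> \<le> ennreal (exp (\<Lambda> * (1 - t)) * (p * (1 - 1 / (50000 * real d))))"
  proof (intro ennreal_leI mult_left_mono)
    have e1: "\<Lambda> * b * s / (4 * sqrt (real d)) = (1 / (300 * real d)) * (x / 4)"
    proof -
      have "\<Lambda> * b * s / (4 * sqrt (real d)) = x / (300 * 4 * (sqrt (real d) * sqrt (real d)))"
        unfolding Lb x(3) using tau sqrt_d(1) by (simp add: field_simps)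
      then show ?thesis unfolding sqrt_d(2) by simp
    qed
    have e2: "\<Lambda> * b\<^sup>2 = (1 / (300 * real d)) * \<beta>"
    proof -
      have "\<Lambda> * b\<^sup>2 = (\<Lambda> * b) * b" by (simp add: power2_eq_square)
      also have "\<dots> = \<beta> / (300 * (sqrt (real d) * sqrt (real d)))"
        unfolding Lb by (subst b_eq) (use tau sqrt_d(1) in \<open>simp add: field_simps\<close>)
      finally show ?thesis unfolding sqrt_d(2) by simp
    qed
    have e3: "\<Lambda> * b * \<rho> = 1 / (60000 * \<tau>\<^sup>2)"
      unfolding Lb \<rho>_def using tau sqrt_d(1) by (simp add: power2_eq_square field_simps)
    have e4: "4 * \<Lambda>\<^sup>2 * b\<^sup>2 \<le> 1 / (67500 * \<tau>\<^sup>2)"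
    proof -
      have "4 * \<Lambda>\<^sup>2 * b\<^sup>2 = 4 * (\<Lambda> * b)\<^sup>2" by (simp add: power_mult_distrib)
      also have "\<dots> = 4 / (90000 * \<tau>\<^sup>2 * real d)" unfolding Lb by (simp add: power_divide power_mult_distrib)
      also have "\<dots> \<le> 4 / (90000 * \<tau>\<^sup>2 * 3)" using d tau by (intro divide_left_mono mult_left_mono) auto
      finally show ?thesis by simp
    qed
    have e5: "2 * b\<^sup>2 + 2 * s\<^sup>2 / (real d - 1) \<le> \<tau>\<^sup>2 / real d * (2 * \<beta>\<^sup>2 + 3 * x\<^sup>2)"
    proof -
      \<comment> \<open>2 / (d - 1) \<le> 3 / d is the condition d \<ge> 3.\<close>
      have "2 * s\<^sup>2 / (real d - 1) \<le> 3 * s\<^sup>2 / real d"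
        using d s2pos by (simp add: field_simps)
      then show ?thesis unfolding b_sq x(3) by (simp add: power_mult_distrib algebra_simps add_divide_distrib)
    qed
    have e6: "(\<Lambda> * b * \<rho> + 4 * \<Lambda>\<^sup>2 * b\<^sup>2) * (2 * b\<^sup>2 + 2 * s\<^sup>2 / (real d - 1))
       \<le> (1 / (300 * real d)) * (1/100 * (2 * \<beta>\<^sup>2 + 3 * x\<^sup>2))"
    proof -
      have "(\<Lambda> * b * \<rho> + 4 * \<Lambda>\<^sup>2 * b\<^sup>2) * (2 * b\<^sup>2 + 2 * s\<^sup>2 / (real d - 1))
        \<le> (1 / (60000 * \<tau>\<^sup>2) + 1 / (67500 * \<tau>\<^sup>2)) * (\<tau>\<^sup>2 / real d * (2 * \<beta>\<^sup>2 + 3 * x\<^sup>2))"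
        using e4 e5 D unfolding e3 by (intro mult_mono add_mono) auto
      also have "\<dots> = (1/60000 + 1/67500) * ((2 * \<beta>\<^sup>2 + 3 * x\<^sup>2) / real d)"
        using tau D by (simp add: field_simps)
      also have "\<dots> \<le> 1/30000 * ((2 * \<beta>\<^sup>2 + 3 * x\<^sup>2) / real d)" by (intro mult_right_mono) auto
      finally show ?thesis by simp
    qed
    have e7: "\<Lambda> * b / \<rho> * \<nu> \<le> p * ((1 / (300 * real d)) * (2/1000))"
    proof -
      have "\<Lambda> * b / \<rho> = 200 / (300 * (sqrt (real d) * sqrt (real d)))"
        unfolding Lb \<rho>_def using tau sqrt_d(1) by (simp add: field_simps)
      then have "\<Lambda> * b / \<rho> * \<nu> = 200 / (300 * real d) * \<nu>" unfolding sqrt_d(2) by simp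
      also have "\<dots> \<le> 200 / (300 * real d) * (1/100000 * p)" using nup by (intro mult_left_mono) auto
      finally show ?thesis by (simp add: mult_ac)
    qed
    have "K \<le> 1 - (1 / (300 * real d)) * (x / 4 - \<beta> - 1/100 * (2 * \<beta>\<^sup>2 + 3 * x\<^sup>2))"
      unfolding K_def using e6 by (simp only: e1 e2 right_diff_distrib)
    then have "p * K \<le> p * (1 - (1 / (300 * real d)) * (x / 4 - \<beta> - 1/100 * (2 * \<beta>\<^sup>2 + 3 * x\<^sup>2)))"
      using p by (intro mult_left_mono) auto
    with e7 have "p * K + \<Lambda> * b / \<rho> * \<nu> \<le> p * (1 - (1 / (300 * real d)) * (x / 4 - \<beta> - 1/100 * (2 * \<beta>\<^sup>2 + 3 * x\<^sup>2) - 2/1000))"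
      by (simp only: right_diff_distrib)
    also have "\<dots> \<le> p * (1 - (1 / (300 * real d)) * (6/1000))"
      using p D drift_bracket[OF x(1,2)] by (intro mult_left_mono diff_left_mono) auto
    finally show "p * K + \<Lambda> * b / \<rho> * \<nu> \<le> p * (1 - 1 / (50000 * real d))" by simp
  qed simp
  also have "\<dots> = ennreal p * (ennreal (1 - 1 / (50000 * real d)) * Phi \<Lambda> w)"
    unfolding Phi_def miss_def t_def using p d
    by (subst ennreal_mult[symmetric], simp, simp, subst ennreal_mult[symmetric]) (auto simp: mult_ac)
  finally have le: "band_int b (Phi \<Lambda>) w \<le> ennreal p * (ennreal (1 - 1 / (50000 * real d)) * Phi \<Lambda> w)" .
  have "step_op b (Phi \<Lambda>) w \<le> ennreal p * (ennreal (1 - 1 / (50000 * real d)) * Phi \<Lambda> w) / ennreal p"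
    unfolding step_op_def p_def[symmetric] by (rule divide_right_mono_ennreal[OF le])
  also have "\<dots> = ennreal (1 - 1 / (50000 * real d)) * Phi \<Lambda> w"
    using p by (simp add: mult.commute[of "ennreal p"] mult_divide_eq_ennreal)
  finally show ?thesis .
qed

text \<open>Close to \<open>u\<close> no contraction can be expected, but one step raises \<Lambda>
  times \<open>miss\<close> by at most one. The potential therefore remains far below its value at
  the target level \<open>\<tau>\<^sup>2 / 16\<close>.\<close>

lemma step_op_Phi_small:
  assumes w: "dotp d w w = 1" and z: "miss w \<le> \<tau>\<^sup>2 / 64"
  shows "step_op b (Phi \<Lambda>) w \<le> ennreal (exp (1 + \<Lambda> * (\<tau>\<^sup>2 / 64)))"
proof -
  define s where "s = sqrt (1 - (dotp d w u)\<^sup>2)"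
  define p where "p = band_prob b w"
  have p: "0 < p" unfolding p_def using band_prob_pos[OF b_small(2) w] .
  have z0: "0 \<le> miss w" "miss w \<le> 2" using miss_bounds[OF w] .
  have "miss w * (2 - miss w) \<le> miss w * 2" using z0 by (intro mult_left_mono) auto
  also have "\<dots> \<le> 49/4 * \<tau>\<^sup>2" using z zero_le_power2[of \<tau>] by linarith
  also have "\<dots> = (7/2 * \<tau>)\<^sup>2" by (simp add: power_mult_distrib power_divide)
  finally have "s \<le> sqrt ((7/2 * \<tau>)\<^sup>2)" unfolding s_def sine_eq by (rule real_sqrt_le_mono)
  then have su: "s \<le> 7/2 * \<tau>" using tau by simp
  have s0: "0 \<le> s" unfolding s_def sine_eq using z0 by simp
  have "band_int b (Phi \<Lambda>) w \<le> ennreal (p * exp (\<Lambda> * (1 - dotp d w u + 2 * b * (b + s))))"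
    unfolding band_int_def Phi_def miss_def dotp_commute[of d _ u] s_def
    using potential_step_trivial[OF d0 w u params_pos, of p \<eta>] by (simp add: p_def band_prob_def dotp_commute[of d u])
  also have "\<dots> \<le> ennreal (p * exp (1 + \<Lambda> * (\<tau>\<^sup>2 / 64)))"
  proof -
    have "\<Lambda> * miss w \<le> \<Lambda> * (\<tau>\<^sup>2 / 64)" using z params_pos by (intro mult_left_mono) auto
    then have "\<Lambda> * (1 - dotp d w u + 2 * b * (b + s)) \<le> 1 + \<Lambda> * (\<tau>\<^sup>2 / 64)"
      using step_small[OF s0 su] by (simp add: miss_def algebra_simps)
    then show ?thesis using p by (intro ennreal_leI mult_left_mono) auto
  qed
  also have "\<dots> = ennreal p * ennreal (exp (1 + \<Lambda> * (\<tau>\<^sup>2 / 64)))" using p by (intro ennreal_mult) auto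
  finally have le: "band_int b (Phi \<Lambda>) w \<le> ennreal p * ennreal (exp (1 + \<Lambda> * (\<tau>\<^sup>2 / 64)))" .
  have "step_op b (Phi \<Lambda>) w \<le> ennreal p * ennreal (exp (1 + \<Lambda> * (\<tau>\<^sup>2 / 64))) / ennreal p"
    unfolding step_op_def p_def[symmetric] by (rule divide_right_mono_ennreal[OF le])
  also have "\<dots> = ennreal (exp (1 + \<Lambda> * (\<tau>\<^sup>2 / 64)))"
    using p by (simp add: mult.commute[of "ennreal p"] mult_divide_eq_ennreal)
  finally show ?thesis .
qed

end

end

section \<open>Epochs\<close>

lemma (in noisy_halfspace) run_op_le_const:
  assumes "\<And>w. dotp d w w = 1 \<Longrightarrow> w \<in> space (euclid d) \<Longrightarrow> g w \<le> c"
    and "\<And>b. b \<in> set bs \<Longrightarrow> admissible b" and w: "dotp d w w = 1" "w \<in> space (euclid d)"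
  shows "run_op bs g w \<le> c"
  using assms(2) w
proof (induction bs arbitrary: w)
  case Nil
  then show ?case using assms(1) by simp
next
  case (Cons b bs)
  have "step_op b (run_op bs g) w \<le> step_op b (\<lambda>w. c + 0 * 0) w"
    using Cons by (intro step_op_mono) auto
  also have "\<dots> = c + 0 * step_op b (\<lambda>_. 0) w"
    using Cons.prems by (intro step_op_affine) auto
  finally show ?case by simp
qed

lemma ennreal_add_mono3:
  fixes R :: ennreal assumes "0 \<le> a" "0 \<le> b" "a + b \<le> c"
  shows "R + ennreal a + ennreal b \<le> R + ennreal c"
  unfolding add.assoc using assms by (intro add_left_mono) (simp flip: ennreal_plus add: ennreal_leI)

context noisy_halfspace
begin

text \<open>The last summand of the coefficient of \<open>Phi\<close> exceeds one as soon as \<open>miss w > 6 \<tau>\<^sup>2\<close>; it accounts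
  for runs that leave the region where the drift estimate holds.\<close>

lemma epoch_potential:
  fixes \<tau> \<beta> b \<Lambda> :: real
  assumes par: "0 < \<tau>" "\<tau> \<le> 1/2" "0 < \<beta>" "\<beta> \<le> 1/300"
    "b = \<beta> * \<tau> / sqrt (real d)" "\<Lambda> = 1 / (300 * \<beta> * \<tau>\<^sup>2)" "\<nu> \<le> 1/100000 * (\<beta> * \<tau> / 50)"
    and g: "\<And>w. dotp d w w = 1 \<Longrightarrow> w \<in> space (euclid d) \<Longrightarrow> g w \<le> R + (if miss w \<le> \<tau>\<^sup>2 / 16 then 0 else 1)"
    and w: "dotp d w w = 1" "w \<in> space (euclid d)"
  shows "run_op (replicate j b) g w \<le> (R + ennreal (2 * real j * exp (1 + \<Lambda> * (\<tau>\<^sup>2 / 64) - \<Lambda> * (\<tau>\<^sup>2 / 16))))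
    + ennreal (exp (- (\<Lambda> * (\<tau>\<^sup>2 / 16))) * (1 - 1 / (50000 * real d)) ^ j + exp (- (\<Lambda> * (6 * \<tau>\<^sup>2)))) * Phi \<Lambda> w"
  using w
proof (induction j arbitrary: w)
  case 0
  show ?case
  proof (cases "miss w \<le> \<tau>\<^sup>2 / 16")
    case True
    then show ?thesis using g[OF 0] by (simp add: add_increasing2)
  next
    case False
    have L: "0 < \<Lambda>" using params_pos[OF par] by simp
    have "\<Lambda> * (\<tau>\<^sup>2 / 16) \<le> \<Lambda> * miss w" using False L by (intro mult_left_mono) auto
    then have "1 \<le> exp (- (\<Lambda> * (\<tau>\<^sup>2 / 16))) * exp (\<Lambda> * miss w)" by (simp flip: exp_add)
    also have "\<dots> \<le> (exp (- (\<Lambda> * (\<tau>\<^sup>2 / 16))) * (1 - 1 / (50000 * real d)) ^ 0 + exp (- (\<Lambda> * (6 * \<tau>\<^sup>2)))) * exp (\<Lambda> * miss w)"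
      by (intro mult_right_mono) auto
    finally have "ennreal 1 \<le> ennreal \<dots>" by (rule ennreal_leI)
    then have "1 \<le> ennreal (exp (- (\<Lambda> * (\<tau>\<^sup>2 / 16))) * (1 - 1 / (50000 * real d)) ^ 0 + exp (- (\<Lambda> * (6 * \<tau>\<^sup>2)))) * Phi \<Lambda> w"
      unfolding Phi_def by (subst ennreal_mult[symmetric]) auto
    then have le: "R + 1 \<le> R + \<dots>" by (rule add_left_mono)
    have "run_op (replicate 0 b) g w \<le> R + 1" using g[OF 0] False by simp
    also note le
    finally show ?thesis by simp
  qed
next
  case (Suc j)
  let ?q = "1 - 1 / (50000 * real d)"
  define A where "A i = exp (- (\<Lambda> * (\<tau>\<^sup>2 / 16))) * ?q ^ i + exp (- (\<Lambda> * (6 * \<tau>\<^sup>2)))" for i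
  define M where "M = exp (1 + \<Lambda> * (\<tau>\<^sup>2 / 64))"
  define B where "B i = 2 * real i * exp (1 + \<Lambda> * (\<tau>\<^sup>2 / 64) - \<Lambda> * (\<tau>\<^sup>2 / 16))" for i :: nat
  have q: "0 \<le> ?q" "?q \<le> 1" using d by (auto simp: field_simps)
  have A0: "0 \<le> A i" for i unfolding A_def using q by (intro add_nonneg_nonneg mult_nonneg_nonneg) auto
  have B0: "0 \<le> B i" for i by (simp add: B_def)
  have L: "0 < \<Lambda>" and adm: "admissible b" using params_pos[OF par] b_small[OF par] by auto
  have IH: "run_op (replicate j b) g w \<le> (R + ennreal (B j)) + ennreal (A j) * Phi \<Lambda> w"
    if "dotp d w w = 1" "w \<in> space (euclid d)" for w
    using Suc.IH[OF that] unfolding A_def B_def .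
  have "run_op (replicate (Suc j) b) g w \<le> (R + ennreal (B (Suc j))) + ennreal (A (Suc j)) * Phi \<Lambda> w"
  proof (cases "miss w \<le> 6 * \<tau>\<^sup>2")
    case False
    have "\<Lambda> * (6 * \<tau>\<^sup>2) \<le> \<Lambda> * miss w" using False L by (intro mult_left_mono) auto
    then have "1 \<le> exp (- (\<Lambda> * (6 * \<tau>\<^sup>2))) * exp (\<Lambda> * miss w)" by (simp flip: exp_add)
    also have "\<dots> \<le> A (Suc j) * exp (\<Lambda> * miss w)"
      using q unfolding A_def by (intro mult_right_mono) auto
    finally have "ennreal 1 \<le> ennreal \<dots>" by (rule ennreal_leI)
    then have 1: "1 \<le> ennreal (A (Suc j)) * Phi \<Lambda> w"
      unfolding Phi_def using A0 by (subst ennreal_mult[symmetric]) auto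
    have "run_op (replicate (Suc j) b) g w \<le> R + 1"
    proof (rule run_op_le_const)
      show "g w \<le> R + 1" if "dotp d w w = 1" "w \<in> space (euclid d)" for w
        using g[OF that] by (rule order_trans) (intro add_left_mono, simp)
    qed (use adm Suc.prems in auto)
    also have "\<dots> \<le> (R + ennreal (B (Suc j))) + ennreal (A (Suc j)) * Phi \<Lambda> w"
      using 1 by (intro add_mono) auto
    finally show ?thesis .
  next
    case True
    have "run_op (replicate (Suc j) b) g w \<le> step_op b (\<lambda>w. (R + ennreal (B j)) + ennreal (A j) * Phi \<Lambda> w) w"
      using IH Suc.prems by (simp add: step_op_mono)
    also have "\<dots> = (R + ennreal (B j)) + ennreal (A j) * step_op b (Phi \<Lambda>) w"
      using Suc.prems adm by (intro step_op_affine Phi_measurable)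
    finally have le: "run_op (replicate (Suc j) b) g w \<le> (R + ennreal (B j)) + ennreal (A j) * step_op b (Phi \<Lambda>) w" .
    show ?thesis
    proof (cases "miss w \<le> \<tau>\<^sup>2 / 64")
      case True
      \<comment> \<open>A step taken from the inner zone forgets the current potential and is
        charged once: the product of this bound with \<open>M\<close> is exactly one increment of
        the additive term \<open>B\<close>.\<close>
      have A2: "A j \<le> 2 * exp (- (\<Lambda> * (\<tau>\<^sup>2 / 16)))"
      proof -
        have "exp (- (\<Lambda> * (\<tau>\<^sup>2 / 16))) * ?q ^ j \<le> exp (- (\<Lambda> * (\<tau>\<^sup>2 / 16))) * 1"
          using q by (intro mult_left_mono power_le_one) auto
        moreover have "exp (- (\<Lambda> * (6 * \<tau>\<^sup>2))) \<le> exp (- (\<Lambda> * (\<tau>\<^sup>2 / 16)))" using L by simp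
        ultimately show ?thesis unfolding A_def by linarith
      qed
      have "ennreal (A j) * step_op b (Phi \<Lambda>) w \<le> ennreal (A j) * ennreal M"
        unfolding M_def by (intro mult_left_mono step_op_Phi_small[OF par Suc.prems(1) True]) simp
      also have "\<dots> = ennreal (A j * M)" using A0 by (simp add: ennreal_mult M_def)
      also have "\<dots> \<le> ennreal (2 * exp (- (\<Lambda> * (\<tau>\<^sup>2 / 16))) * M)"
        using A2 by (intro ennreal_leI mult_right_mono) (auto simp: M_def)
      also have "2 * exp (- (\<Lambda> * (\<tau>\<^sup>2 / 16))) * M = B (Suc j) - B j"
        unfolding M_def B_def by (simp add: mult.assoc algebra_simps flip: exp_add)
      finally have "(R + ennreal (B j)) + ennreal (A j) * step_op b (Phi \<Lambda>) w \<le> R + ennreal (B j) + ennreal (B (Suc j) - B j)"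
        by (rule add_left_mono)
      also have "\<dots> \<le> R + ennreal (B (Suc j))"
        using B0 by (intro ennreal_add_mono3) (auto simp: B_def algebra_simps)
      also have "\<dots> \<le> (R + ennreal (B (Suc j))) + ennreal (A (Suc j)) * Phi \<Lambda> w" by simp
      finally show ?thesis using le by (rule order_trans[rotated])
    next
      case mid: False
      have "ennreal (A j) * step_op b (Phi \<Lambda>) w \<le> ennreal (A j) * (ennreal ?q * Phi \<Lambda> w)"
        using mid by (intro mult_left_mono step_op_Phi_mid[OF par Suc.prems(1) _ True]) auto
      also have "\<dots> = ennreal (A j * ?q) * Phi \<Lambda> w" using A0 q by (simp add: ennreal_mult mult.assoc)
      also have "\<dots> \<le> ennreal (A (Suc j)) * Phi \<Lambda> w"
      proof (intro mult_right_mono ennreal_leI)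
        have "exp (- (\<Lambda> * (6 * \<tau>\<^sup>2))) * ?q \<le> exp (- (\<Lambda> * (6 * \<tau>\<^sup>2))) * 1" using q by (intro mult_left_mono) auto
        then show "A j * ?q \<le> A (Suc j)" unfolding A_def distrib_right power_Suc2 mult.assoc by simp
      qed simp
      finally have 2: "ennreal (A j) * step_op b (Phi \<Lambda>) w \<le> ennreal (A (Suc j)) * Phi \<Lambda> w" .
      have "B j \<le> B (Suc j)" by (simp add: B_def)
      then have "(R + ennreal (B j)) + ennreal (A j) * step_op b (Phi \<Lambda>) w \<le> (R + ennreal (B (Suc j))) + ennreal (A (Suc j)) * Phi \<Lambda> w"
        using 2 by (intro add_mono ennreal_leI) auto
      then show ?thesis using le by (rule order_trans[rotated])
    qed
  qed
  then show ?case unfolding A_def B_def .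
qed

text \<open>19200 = 300 * 64 gives \<Lambda> \<tau>^2 = 64 l. The inner zone then costs 2 e m exp (l
  - 4 l). The initial potential is at most exp (256 l): against it stand exp (- 4 l) times the
  contraction over \<open>m\<close> steps, and exp (- 384 l) for leaving the drift region.
  \<open>R\<close> carries the failure bound of the later epochs.\<close>

lemma epoch_failure:
  fixes \<tau> \<beta> b l :: real
  assumes par: "0 < \<tau>" "\<tau> \<le> 1/2" "1 \<le> l" "\<beta> = 1 / (19200 * l)"
    "b = \<beta> * \<tau> / sqrt (real d)" "\<nu> \<le> 1/100000 * (\<beta> * \<tau> / 50)"
    and m: "12950000 * real d * l \<le> real m"
    and g: "\<And>w. dotp d w w = 1 \<Longrightarrow> w \<in> space (euclid d) \<Longrightarrow> g w \<le> R + (if miss w \<le> \<tau>\<^sup>2 / 16 then 0 else 1)"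
    and w: "dotp d w w = 1" "w \<in> space (euclid d)" "miss w \<le> 4 * \<tau>\<^sup>2"
  shows "run_op (replicate m b) g w \<le> R + ennreal (8 * real m * exp (- (3 * l)))"
proof -
  define \<Lambda> where "\<Lambda> = 1 / (300 * \<beta> * \<tau>\<^sup>2)"
  have "1 / (19200 * l) \<le> 1 / 300" using par(3) by (intro divide_left_mono) auto
  then have beta: "0 < \<beta>" "\<beta> \<le> 1/300" using par(3,4) by auto
  note par' = par(1,2) beta par(5) \<Lambda>_def par(6)
  have Lt: "\<Lambda> * \<tau>\<^sup>2 = 64 * l" using par by (simp add: \<Lambda>_def)
  have L: "0 < \<Lambda>" using params_pos[OF par'] by simp
  have e: "\<Lambda> * (\<tau>\<^sup>2 / 64) = l" "\<Lambda> * (\<tau>\<^sup>2 / 16) = 4 * l" "\<Lambda> * (6 * \<tau>\<^sup>2) = 384 * l"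
    using Lt by simp_all
  let ?q = "1 - 1 / (50000 * real d)"
  have q: "0 \<le> ?q" using d by (auto simp: field_simps)
  define A where "A = exp (- (\<Lambda> * (\<tau>\<^sup>2 / 16))) * ?q ^ m + exp (- (\<Lambda> * (6 * \<tau>\<^sup>2)))"
  have A0: "0 \<le> A" unfolding A_def using q by (intro add_nonneg_nonneg mult_nonneg_nonneg) auto
  have "\<Lambda> * miss w \<le> \<Lambda> * (4 * \<tau>\<^sup>2)" using w L by (intro mult_left_mono) auto
  then have P: "Phi \<Lambda> w \<le> ennreal (exp (256 * l))" unfolding Phi_def using Lt by (intro ennreal_leI) simp
  have d': "0 < real d" using d by simp
  \<comment> \<open>12950000 = 259 * 50000; the exponent 259 outweighs 256 - 4 by 7.\<close>
  have "?q ^ m \<le> exp (- (259 * l))"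
  proof -
    have "?q \<le> exp (- (1 / (50000 * real d)))" using exp_ge_add_one_self[of "- (1 / (50000 * real d))"] by simp
    then have "?q ^ m \<le> exp (- (1 / (50000 * real d))) ^ m" using q by (intro power_mono) auto
    also have "\<dots> = exp (- (real m / (50000 * real d)))" by (simp flip: exp_of_nat_mult)
    also have "\<dots> \<le> exp (- (259 * l))" using m d' by (simp add: field_simps)
    finally show ?thesis .
  qed
  then have "A \<le> exp (- (4 * l)) * exp (- (259 * l)) + exp (- (384 * l))"
    unfolding A_def e by (intro add_mono mult_left_mono) auto
  then have "A * exp (256 * l) \<le> (exp (- (4 * l)) * exp (- (259 * l)) + exp (- (384 * l))) * exp (256 * l)"
    by (rule mult_right_mono) simp
  also have "\<dots> = exp (- (7 * l)) + exp (- (128 * l))" by (simp add: distrib_right flip: exp_add)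
  also have "\<dots> \<le> 2 * exp (- (3 * l))"
  proof -
    have "exp (- (7 * l)) \<le> exp (- (3 * l))" "exp (- (128 * l)) \<le> exp (- (3 * l))" using par(3) by auto
    then show ?thesis by linarith
  qed
  finally have Ae: "A * exp (256 * l) \<le> 2 * exp (- (3 * l))" .
  have m1: "1 \<le> real m"
  proof -
    have "1 * 1 \<le> 12950000 * real d * l" using d par(3) by (intro mult_mono) auto
    with m show ?thesis by simp
  qed
  have Bm: "2 * real m * exp (1 + \<Lambda> * (\<tau>\<^sup>2 / 64) - \<Lambda> * (\<tau>\<^sup>2 / 16)) \<le> 6 * real m * exp (- (3 * l))"
  proof -
    have "exp (1 + \<Lambda> * (\<tau>\<^sup>2 / 64) - \<Lambda> * (\<tau>\<^sup>2 / 16)) = exp 1 * exp (- (3 * l))"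
      unfolding e by (simp flip: exp_add)
    also have "\<dots> \<le> 3 * exp (- (3 * l))" using exp_le by (intro mult_right_mono) auto
    finally have le: "exp (1 + \<Lambda> * (\<tau>\<^sup>2 / 64) - \<Lambda> * (\<tau>\<^sup>2 / 16)) \<le> 3 * exp (- (3 * l))" .
    have "2 * real m * exp (1 + \<Lambda> * (\<tau>\<^sup>2 / 64) - \<Lambda> * (\<tau>\<^sup>2 / 16)) \<le> 2 * real m * (3 * exp (- (3 * l)))"
      by (rule mult_left_mono[OF le]) simp
    also have "\<dots> = 6 * real m * exp (- (3 * l))" by simp
    finally show ?thesis .
  qed
  have "run_op (replicate m b) g w \<le> (R + ennreal (2 * real m * exp (1 + \<Lambda> * (\<tau>\<^sup>2 / 64) - \<Lambda> * (\<tau>\<^sup>2 / 16)))) + ennreal A * Phi \<Lambda> w"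
    unfolding A_def by (rule epoch_potential[OF par' g w(1,2)])
  also have "\<dots> \<le> (R + ennreal (6 * real m * exp (- (3 * l)))) + ennreal A * ennreal (exp (256 * l))"
    using P Bm by (intro add_mono mult_left_mono ennreal_leI) auto
  also have "ennreal A * ennreal (exp (256 * l)) = ennreal (A * exp (256 * l))" using A0 by (simp add: ennreal_mult)
  also have "R + ennreal (6 * real m * exp (- (3 * l))) + ennreal (A * exp (256 * l)) \<le> R + ennreal (8 * real m * exp (- (3 * l)))"
  proof (rule ennreal_add_mono3)
    have "2 * exp (- (3 * l)) \<le> 2 * real m * exp (- (3 * l))" using m1 by simp
    then show "6 * real m * exp (- (3 * l)) + A * exp (256 * l) \<le> 8 * real m * exp (- (3 * l))"
      using Ae by linarith
  qed (use A0 in auto)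
  finally show ?thesis .
qed

text \<open>Epoch \<open>k\<close> shrinks \<open>miss\<close> from \<open>4 \<sqdot> 4 ^ - k\<close> to \<open>4 ^ - k / 16\<close>, which leaves room for the crude bound
  \<open>disagreement_upper\<close>.\<close>

lemma epochs_failure:
  fixes l \<beta> b :: "nat \<Rightarrow> real" and m :: "nat \<Rightarrow> nat"
  assumes par: "\<And>k. 1 \<le> k \<Longrightarrow> k \<le> n \<Longrightarrow> 1 \<le> l k \<and> \<beta> k = 1 / (19200 * l k) \<and> b k = \<beta> k * (1/2) ^ k / sqrt (real d)
      \<and> \<nu> \<le> 1/100000 * (\<beta> k * (1/2) ^ k / 50) \<and> 12950000 * real d * l k \<le> real (m k)
      \<and> 8 * real (m k) * exp (- (3 * l k)) \<le> \<gamma> k"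
    and n: "1 \<le> n" and w: "dotp d w w = 1" "w \<in> space (euclid d)" "miss w \<le> 1"
  shows "run_op (concat (map (\<lambda>k. replicate (m k) (b k)) [1..<Suc n])) (\<lambda>w. if miss w \<le> ((1/2) ^ n)\<^sup>2 / 16 then 0 else 1) w
     \<le> ennreal (\<Sum>k=1..n. \<gamma> k)"
proof -
  let ?f = "\<lambda>w. if miss w \<le> ((1/2) ^ n)\<^sup>2 / 16 then 0 else 1 :: ennreal"
  define E where "E j = concat (map (\<lambda>k. replicate (m k) (b k)) [j..<Suc n])" for j
  have E_rec: "E j = replicate (m j) (b j) @ E (Suc j)" if "j \<le> n" for j
    using that unfolding E_def by (subst upt_conv_Cons) auto
  have g0: "0 \<le> \<gamma> k" if "1 \<le> k" "k \<le> n" for k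
    using par[OF that] by (auto intro: order_trans[rotated])
  have adm: "admissible (b k)" if "1 \<le> k" "k \<le> n" for k
  proof -
    note P = par[OF that]
    have "(1/2::real) ^ k \<le> (1/2) ^ 1" using that by (intro power_decreasing) auto
    then have t: "0 < (1/2::real) ^ k" "(1/2::real) ^ k \<le> 1/2" by auto
    have "0 < \<beta> k" "\<beta> k \<le> 1/300" using P by (auto simp: field_simps)
    then show ?thesis using b_small(2)[OF t _ _ _ refl] P by blast
  qed
  have E_adm: "\<And>x. x \<in> set (E j) \<Longrightarrow> admissible x" if "1 \<le> j" for j
    using that adm unfolding E_def by (auto simp: set_replicate_conv_if split: if_splits)
  have epoch: "run_op (E j) ?f w \<le> ennreal (\<Sum>k=j..n. \<gamma> k)"
    if j: "1 \<le> j" "j \<le> n" and w: "dotp d w w = 1" "w \<in> space (euclid d)" "miss w \<le> 4 * ((1/2) ^ j)\<^sup>2"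
      and next_: "\<And>w. dotp d w w = 1 \<Longrightarrow> w \<in> space (euclid d) \<Longrightarrow>
         run_op (E (Suc j)) ?f w \<le> ennreal (\<Sum>k=Suc j..n. \<gamma> k) + (if miss w \<le> ((1/2) ^ j)\<^sup>2 / 16 then 0 else 1)" for j w
  proof -
    note P = par[OF j]
    have "(1/2::real) ^ j \<le> (1/2) ^ 1" using j by (intro power_decreasing) auto
    then have t: "0 < (1/2::real) ^ j" "(1/2::real) ^ j \<le> 1/2" by auto
    have "run_op (E j) ?f w = run_op (replicate (m j) (b j)) (run_op (E (Suc j)) ?f) w"
      using j by (simp add: E_rec)
    also have "\<dots> \<le> ennreal (\<Sum>k=Suc j..n. \<gamma> k) + ennreal (8 * real (m j) * exp (- (3 * l j)))"
      using P by (intro epoch_failure[OF t _ _ _ _ _ next_ w]) auto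
    also have "\<dots> \<le> ennreal (\<Sum>k=Suc j..n. \<gamma> k) + ennreal (\<gamma> j)"
      using P by (intro add_left_mono ennreal_leI) auto
    also have "\<dots> = ennreal (\<Sum>k=j..n. \<gamma> k)"
      using j g0 by (subst ennreal_plus[symmetric]) (auto simp: sum.atLeast_Suc_atMost add.commute intro!: sum_nonneg)
    finally show ?thesis .
  qed
  \<comment> \<open>The induction descends from the last epoch. If an epoch misses its target, the
    failure probability of all later ones is bounded by one, which is the indicator that
    \<open>epoch_failure\<close> expects next to \<open>R\<close>.\<close>
  have Q: "\<forall>w. dotp d w w = 1 \<longrightarrow> w \<in> space (euclid d) \<longrightarrow>
      run_op (E (Suc j)) ?f w \<le> ennreal (\<Sum>k=Suc j..n. \<gamma> k) + (if miss w \<le> ((1/2) ^ j)\<^sup>2 / 16 then 0 else 1)"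
    if "1 \<le> j" "j \<le> n" for j
    using that(2,1)
  proof (induction j rule: inc_induct)
    case base
    then show ?case by (simp add: E_def)
  next
    case (step j)
    show ?case
    proof (intro allI impI)
      fix w assume w: "dotp d w w = 1" "w \<in> space (euclid d)"
      show "run_op (E (Suc j)) ?f w \<le> ennreal (\<Sum>k=Suc j..n. \<gamma> k) + (if miss w \<le> ((1/2) ^ j)\<^sup>2 / 16 then 0 else 1)"
      proof (cases "miss w \<le> ((1/2) ^ j)\<^sup>2 / 16")
        case True
        have "((1/2::real) ^ j)\<^sup>2 / 16 \<le> 4 * ((1/2) ^ Suc j)\<^sup>2" by (simp add: power2_eq_square)
        then have "run_op (E (Suc j)) ?f w \<le> ennreal (\<Sum>k=Suc j..n. \<gamma> k)"
          using step True w by (intro epoch) auto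
        then show ?thesis using True by simp
      next
        case False
        have "run_op (E (Suc j)) ?f w \<le> 1"
          using E_adm[of "Suc j"] w by (intro run_op_le_const) auto
        also have "1 \<le> ennreal (\<Sum>k=Suc j..n. \<gamma> k) + (1::ennreal)" by simp
        finally show ?thesis using False by simp
      qed
    qed
  qed
  \<comment> \<open>The first epoch has \<tau> = 1/2, so its entry condition is
    \<open>miss w \<le> 1\<close>, an angle of at most pi / 2.\<close>
  have "run_op (E 1) ?f w \<le> ennreal (\<Sum>k=1..n. \<gamma> k)"
    using Q[of 1] n w by (intro epoch) (auto simp: power2_eq_square)
  then show ?thesis unfolding E_def .
qed

end

section \<open>Schedules and sample complexity\<close>

definition num_iter :: "nat \<Rightarrow> real \<Rightarrow> nat \<Rightarrow> nat" where
  "num_iter d \<delta> k = sched_m 1000000000 d \<delta> k"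

text \<open>The denominator logarithm of \<open>sched_b\<close>, in the role of \<open>l\<close> in
  \<open>epoch_failure\<close>: its negative exponential is \<delta> / (k m), the unit in which
  failures are counted.\<close>

definition log_term :: "nat \<Rightarrow> real \<Rightarrow> nat \<Rightarrow> real" where
  "log_term d \<delta> k = ln (real k * real (num_iter d \<delta> k) / \<delta>)"

context
  fixes d :: nat and \<delta> :: real and k :: nat and lam l :: real and M :: nat
  assumes d: "3 \<le> d" and \<delta>: "0 < \<delta>" "\<delta> < 1" and k: "1 \<le> k"
  defines "lam \<equiv> ln (real d) + ln (real k / \<delta>)"
    and "l \<equiv> log_term d \<delta> k" and "M \<equiv> num_iter d \<delta> k"
begin

lemma lam_ge_1: "1 \<le> lam"
proof -
  have "exp 1 \<le> real d" using exp_le d by linarith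
  then have "1 \<le> ln (real d)" using d by (simp add: ln_ge_iff)
  moreover have "0 \<le> ln (real k / \<delta>)" using k \<delta> by (intro ln_ge_zero) (simp add: field_simps)
  ultimately show ?thesis by (simp add: lam_def)
qed

lemma num_iter_bounds: "1000000000 * real d * lam \<le> real M" "real M \<le> 2000000000 * real d * lam"
proof -
  have 1: "1 \<le> real d * lam" using mult_mono[of 1 "real d" 1 lam] lam_ge_1 d by simp
  then have nn: "0 \<le> 1000000000 * real d * lam" by linarith
  have M: "real M = of_int \<lceil>1000000000 * real d * lam\<rceil>"
    unfolding M_def num_iter_def sched_m_def lam_def[symmetric] using nn by (simp add: ceiling_mono of_nat_nat)
  show "1000000000 * real d * lam \<le> real M" unfolding M by simp
  have "real M \<le> 1000000000 * real d * lam + 1" unfolding M by linarith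
  then show "real M \<le> 2000000000 * real d * lam" using 1 by simp
qed

lemma num_iter_large: "1000000000 \<le> real M"
proof -
  have "1 \<le> real d * lam" using mult_mono[of 1 "real d" 1 lam] lam_ge_1 d by simp
  then show ?thesis using num_iter_bounds(1) by simp
qed

lemma log_term_exp: "exp (- l) = \<delta> / (real k * real M)"
  unfolding l_def log_term_def M_def[symmetric] using k \<delta> num_iter_large by (simp add: exp_minus inverse_eq_divide)

lemma log_term_ge_1: "1 \<le> l"
proof -
  have "3 * 1 \<le> real M * (real k / \<delta>)" using num_iter_large k \<delta> by (intro mult_mono) (auto simp: field_simps)
  then have "exp 1 \<le> real k * real M / \<delta>" using exp_le by (simp add: mult.commute)
  then show ?thesis unfolding l_def log_term_def M_def[symmetric] using k \<delta> num_iter_large by (simp add: ln_ge_iff)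
qed

text \<open>The band width involves ln m, whereas m is proportional to d times \<open>lam\<close>.
  Since ln \<open>lam\<close> is at most \<open>lam\<close> - 1, the two logarithms agree up to a
  constant factor. The iteration constant 10^9 is chosen above 33 * 12950000.\<close>

lemma log_term_le: "l \<le> 33 * lam"
proof -
  have lam: "0 < lam" using lam_ge_1 by simp
  have d0: "0 < real d" using d by simp
  have m0: "0 < real M" using num_iter_large by simp
  have "ln (real M) \<le> ln (2000000000 * real d * lam)" using num_iter_bounds(2) m0 by (subst ln_le_cancel_iff) linarith+
  also have "\<dots> = ln 2000000000 + ln (real d) + ln lam" using lam d0 by (simp add: ln_mult)
  also have "ln (2000000000::real) \<le> ln (2 ^ 31)" by simp
  also have "ln (2 ^ 31 :: real) = 31 * ln 2" using ln_realpow[of "2::real" 31] by simp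
  also have "31 * ln (2::real) \<le> 31" using ln_2_less_1 by simp
  also have "ln lam \<le> lam - 1" using lam by (rule ln_le_minus_one)
  finally have "ln (real M) \<le> 31 + ln (real d) + (lam - 1)" by simp
  moreover have "l = ln (real k / \<delta>) + ln (real M)"
    unfolding l_def log_term_def M_def[symmetric] using k \<delta> m0 by (simp add: ln_mult ln_div)
  ultimately show ?thesis using lam_ge_1 by (simp add: lam_def)
qed

lemma num_iter_ge: "12950000 * real d * l \<le> real M"
proof -
  have "12950000 * real d * l \<le> 12950000 * real d * (33 * lam)" using log_term_le by (intro mult_left_mono) auto
  moreover have "0 \<le> real d * lam" using lam_ge_1 by simp
  ultimately show ?thesis using num_iter_bounds(1) by linarith
qed

text \<open>The third power of \<delta> / (k M) leaves a factor M^(-2) after multiplication by 8 M,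
  more than enough for the constant; of the powers of k, two are kept to make the sum over epochs
  converge.\<close>

lemma failure_le: "8 * real M * exp (- (3 * l)) \<le> \<delta> / (4 * (real k)\<^sup>2)"
proof -
  have m0: "0 < real M" "1 \<le> real k" using num_iter_large k by auto
  have "exp (- (3 * l)) = exp (- l) ^ 3" by (simp flip: exp_of_nat_mult)
  then have "8 * real M * exp (- (3 * l)) = (\<delta> / (4 * (real k)\<^sup>2)) * (32 * \<delta>\<^sup>2 / (real k * (real M)\<^sup>2))"
    unfolding log_term_exp using m0 by (simp add: power3_eq_cube power2_eq_square field_simps)
  also have "\<dots> \<le> (\<delta> / (4 * (real k)\<^sup>2)) * 1"
  proof (intro mult_left_mono)
    have "\<delta>\<^sup>2 \<le> 1" using \<delta> by (intro power_le_one) auto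
    moreover have "1000000000 * 1000000000 \<le> real M * real M" using num_iter_large by (intro mult_mono) auto
    moreover have "1 * (real M * real M) \<le> real k * (real M * real M)" using m0 by (intro mult_right_mono) auto
    ultimately have "32 * \<delta>\<^sup>2 \<le> real k * (real M * real M)" by linarith
    then show "32 * \<delta>\<^sup>2 / (real k * (real M)\<^sup>2) \<le> 1"
      using m0 by (simp add: divide_le_eq power2_eq_square)
  qed (use \<delta> in auto)
  finally show ?thesis by simp
qed

end

lemma sched_b_eq:
  "sched_b (1/19200) 1000000000 d \<delta> k = (1 / (19200 * log_term d \<delta> k)) * (1/2) ^ k / sqrt (real d)"
proof -
  have "2 powr (- real k) = (1/2 :: real) ^ k"
    by (simp add: powr_minus powr_realpow power_one_over inverse_eq_divide)
  then show ?thesis unfolding sched_b_def log_term_def num_iter_def by simp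
qed

lemma sum_inverse_squares_le: "(\<Sum>k=1..n. 1 / (real k)\<^sup>2) \<le> 2"
proof -
  have "(\<Sum>k=1..Suc n. 1 / (real k)\<^sup>2) \<le> 2 - 1 / real (Suc n)" for n
  proof (induction n)
    case (Suc n)
    have "1 / (x + 1)\<^sup>2 \<le> 1 / x - 1 / (x + 1)" if "0 < x" for x :: real
    proof -
      have "1 / (x + 1)\<^sup>2 \<le> 1 / (x * (x + 1))"
        using that by (intro divide_left_mono) (auto simp: power2_eq_square mult_right_mono)
      also have "\<dots> = 1 / x - 1 / (x + 1)" using that by (simp add: field_simps)
      finally show ?thesis .
    qed
    from this[of "real (Suc n)"] have "1 / (real (Suc (Suc n)))\<^sup>2 \<le> 1 / real (Suc n) - 1 / real (Suc (Suc n))"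
      by (simp add: add.commute)
    with Suc show ?case by simp
  qed simp
  from this[of "n - 1"] show ?thesis
    by (cases n) (auto intro: order_trans)
qed

section \<open>The algorithm as a single fold, and measurability of its final state\<close>

lemma fold_perc_replicate: "fold f (replicate m b) s = (f b ^^ m) s"
  by (induction m arbitrary: s) (simp_all add: funpow_swap1)

lemma active_perceptron_fold:
  "active_perceptron d \<eta> \<omega> v0 \<epsilon> m b
    = fold (perc_step d \<eta> \<omega>) (concat (map (\<lambda>k. replicate (m k) (b k)) [1..<Suc (nat \<lceil>log 2 (1 / \<epsilon>)\<rceil>)])) (v0, 0, 0)"
proof -
  have "foldl (\<lambda>s k. modified_perceptron d \<eta> \<omega> (m k) (b k) s) s ks
    = fold (perc_step d \<eta> \<omega>) (concat (map (\<lambda>k. replicate (m k) (b k)) ks)) s" for ks s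
    by (induction ks arbitrary: s) (simp_all add: modified_perceptron_def fold_perc_replicate)
  then show ?thesis unfolding active_perceptron_def by blast
qed

lemma fold_perc_labels: "snd (snd (fold (perc_step d \<eta> \<omega>) bs s)) = snd (snd s) + length bs"
  by (induction bs arbitrary: s) (auto simp: perc_step_def Let_def split: prod.split)

text \<open>Measurability is stated by components because the vector held by
  \<open>perc_step\<close> is a function on all naturals and need not lie in
  \<open>space (euclid d)\<close>; only its restriction does.\<close>

definition state_measurable :: "nat \<Rightarrow> (((nat \<Rightarrow> vec) \<times> (nat \<Rightarrow> real)) \<Rightarrow> vec \<times> nat \<times> nat) \<Rightarrow> bool" where
  "state_measurable d s \<longleftrightarrow> (\<lambda>\<omega>. restrict (fst (s \<omega>)) {..<d}) \<in> measurable (sample_space d) (euclid d)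
     \<and> (\<lambda>\<omega>. fst (snd (s \<omega>))) \<in> measurable (sample_space d) (count_space UNIV)
     \<and> (\<lambda>\<omega>. snd (snd (s \<omega>))) \<in> measurable (sample_space d) (count_space UNIV)"

lemma perc_step_state:
  "perc_step d \<eta> \<omega> b s = (let n = band_next d (fst \<omega>) (fst s) b (fst (snd s)) in
     ((if label_of \<eta> (fst \<omega> n) (snd \<omega> (snd (snd s))) * dotp d (fst s) (fst \<omega> n) < 0
       then (\<lambda>l. fst s l - 2 * dotp d (fst s) (fst \<omega> n) * fst \<omega> n l) else fst s), Suc n, Suc (snd (snd s))))"
  by (simp add: perc_step_def Let_def split: prod.split)

lemma restrict_update:
  "restrict (if label_of \<eta> x r * dotp d w x < 0 then (\<lambda>l. w l - 2 * dotp d w x * x l) else w) {..<d}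
    = upd d \<eta> (restrict w {..<d}) x r"
  unfolding upd_def hrefl_def
  using dotp_commute[of d x w] dotp_commute[of d x "restrict w {..<d}"]
  by (auto simp: dotp_restrict fun_eq_iff)

text \<open>The positions read from the two streams are random. The next position is measurable as a
  \<open>LEAST\<close> of measurable predicates, and evaluation at a random natural number is a
  countable composition.\<close>

lemma state_measurable_step:
  assumes \<eta>: "\<eta> \<in> borel_measurable (euclid d)" and s: "state_measurable d s"
  shows "state_measurable d (\<lambda>\<omega>. perc_step d \<eta> \<omega> b (s \<omega>))"
proof -
  let ?S = "sample_space d"
  have W: "(\<lambda>\<omega>. restrict (fst (s \<omega>)) {..<d}) \<in> measurable ?S (euclid d)"
    and N: "(\<lambda>\<omega>. fst (snd (s \<omega>))) \<in> measurable ?S (count_space UNIV)"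
    and L: "(\<lambda>\<omega>. snd (snd (s \<omega>))) \<in> measurable ?S (count_space UNIV)"
    using s by (auto simp: state_measurable_def)
  have xs: "(\<lambda>\<omega>. fst \<omega> i) \<in> measurable ?S (euclid d)" for i
    unfolding sample_space_def by (rule measurable_points_component) simp
  have rs: "(\<lambda>\<omega>. snd \<omega> i) \<in> borel_measurable ?S" for i
    unfolding sample_space_def by (rule measurable_coins_component) simp
  define n where "n \<omega> = band_next d (fst \<omega>) (fst (s \<omega>)) b (fst (snd (s \<omega>)))" for \<omega>
  have P: "Measurable.pred ?S (\<lambda>\<omega>. fst (snd (s \<omega>)) \<le> i \<and> in_band d (restrict (fst (s \<omega>)) {..<d}) b (fst \<omega> i))" for i
  proof (rule pred_intros_logic)
    show "Measurable.pred ?S (\<lambda>\<omega>. fst (snd (s \<omega>)) \<le> i)"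
      using measurable_compose[OF N, of "\<lambda>j. j \<le> i" "count_space UNIV"] by simp
    show "Measurable.pred ?S (\<lambda>\<omega>. in_band d (restrict (fst (s \<omega>)) {..<d}) b (fst \<omega> i))"
      by (rule in_band_measurable[OF W xs])
  qed
  have n_eq: "n \<omega> = (LEAST i. fst (snd (s \<omega>)) \<le> i \<and> in_band d (restrict (fst (s \<omega>)) {..<d}) b (fst \<omega> i))" for \<omega>
    unfolding n_def band_next_def in_band_def dotp_restrict ..
  have n: "n \<in> measurable ?S (count_space UNIV)"
    unfolding n_eq[abs_def] by (rule measurable_Least[OF P])
  have x: "(\<lambda>\<omega>. fst \<omega> (n \<omega>)) \<in> measurable ?S (euclid d)"
    by (rule measurable_compose_countable[OF xs n])
  have r: "(\<lambda>\<omega>. snd \<omega> (snd (snd (s \<omega>)))) \<in> borel_measurable ?S"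
    by (rule measurable_compose_countable[OF rs L])
  have "(\<lambda>\<omega>. upd d \<eta> (restrict (fst (s \<omega>)) {..<d}) (fst \<omega> (n \<omega>)) (snd \<omega> (snd (snd (s \<omega>))))) \<in> measurable ?S (euclid d)"
    by (rule upd_measurable[OF \<eta> W x r])
  moreover have "(\<lambda>\<omega>. Suc (n \<omega>)) \<in> measurable ?S (count_space UNIV)" "(\<lambda>\<omega>. Suc (snd (snd (s \<omega>)))) \<in> measurable ?S (count_space UNIV)"
    by (rule measurable_compose[OF n], simp) (rule measurable_compose[OF L], simp)
  ultimately show ?thesis
    unfolding state_measurable_def perc_step_state Let_def n_def[symmetric] by (simp only: fst_conv snd_conv restrict_update)
qed

lemma state_measurable_run:
  assumes \<eta>: "\<eta> \<in> borel_measurable (euclid d)"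
  shows "state_measurable d (\<lambda>\<omega>. fold (perc_step d \<eta> \<omega>) bs (w, N, L))"
proof (induction bs rule: rev_induct)
  case Nil
  have "restrict w {..<d} \<in> space (euclid d)" by (simp add: space_euclid)
  then show ?case by (simp add: state_measurable_def)
next
  case (snoc b bs)
  then show ?case using state_measurable_step[OF \<eta> snoc, of b] by simp
qed

lemma prob_space_sample_space: "prob_space (sample_space d)"
proof -
  interpret X: sequence_space "unif_sphere d" by (rule sequence_space_points)
  interpret R: sequence_space unif01 by (rule sequence_space_coins)
  interpret P: pair_prob_space "points d" coins ..
  show ?thesis unfolding sample_space_def by (rule P.prob_space_axioms)
qed

lemma run_integral_le:
  assumes \<eta>: "\<eta> \<in> borel_measurable (euclid d)" and G: "\<And>N. (\<lambda>w. G w N) \<in> borel_measurable (euclid d)"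
  shows "(\<integral>\<^sup>+\<omega>. G (restrict (fst (fold (perc_step d \<eta> \<omega>) bs (w, 0, 0))) {..<d}) (fst (snd (fold (perc_step d \<eta> \<omega>) bs (w, 0, 0)))) \<partial>sample_space d)
    \<le> (\<integral>\<^sup>+xs. \<integral>\<^sup>+rs. cost d \<eta> G bs (restrict w {..<d}) 0 xs rs \<partial>coins \<partial>points d)"
proof -
  interpret R: sequence_space unif01 by (rule sequence_space_coins)
  let ?s = "\<lambda>\<omega>. fold (perc_step d \<eta> \<omega>) bs (w, 0, 0)"
  let ?F = "\<lambda>\<omega>. G (restrict (fst (?s \<omega>)) {..<d}) (fst (snd (?s \<omega>)))"
  have s: "state_measurable d ?s" by (rule state_measurable_run[OF \<eta>])
  have "?F \<in> borel_measurable (sample_space d)"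
  proof (rule measurable_compose_countable[where g="\<lambda>\<omega>. fst (snd (?s \<omega>))" and f="\<lambda>N \<omega>. G (restrict (fst (?s \<omega>)) {..<d}) N"])
    show "(\<lambda>\<omega>. G (restrict (fst (?s \<omega>)) {..<d}) N) \<in> borel_measurable (sample_space d)" for N
      using s by (intro measurable_compose[OF _ G]) (auto simp: state_measurable_def)
    show "(\<lambda>\<omega>. fst (snd (?s \<omega>))) \<in> measurable (sample_space d) (count_space UNIV)"
      using s by (auto simp: state_measurable_def)
  qed
  then have "(\<integral>\<^sup>+\<omega>. ?F \<omega> \<partial>sample_space d) = (\<integral>\<^sup>+xs. \<integral>\<^sup>+rs. ?F (xs, rs) \<partial>coins \<partial>points d)"
    unfolding sample_space_def by (rule R.P.nn_integral_fst[symmetric])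
  also have "\<dots> \<le> (\<integral>\<^sup>+xs. \<integral>\<^sup>+rs. cost d \<eta> G bs (restrict w {..<d}) 0 xs rs \<partial>coins \<partial>points d)"
  proof (intro nn_integral_mono)
    fix xs rs
    show "?F (xs, rs) \<le> cost d \<eta> G bs (restrict w {..<d}) 0 xs rs"
      using run_le_cost[of G d \<eta> xs rs bs w 0 0] by (simp add: case_prod_beta)
  qed
  finally show ?thesis .
qed

text \<open>The error of a random vector is the measure of a section of a measurable set in the
  product. It is needed so that the probability of the final event can be obtained from its
  complement.\<close>

lemma disagreement_measurable:
  assumes V: "(\<lambda>\<omega>. restrict (v \<omega>) {..<d}) \<in> measurable M (euclid d)"
  shows "(\<lambda>\<omega>. measure (unif_sphere d) {x \<in> space (unif_sphere d). sgn (dotp d (v \<omega>) x) \<noteq> sgn (dotp d u x)}) \<in> borel_measurable M"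
proof -
  interpret X: prob_space "unif_sphere d" by (rule prob_space_unif_sphere)
  let ?Q = "{z \<in> space (M \<Otimes>\<^sub>M euclid d). sgn (dotp d (restrict (v (fst z)) {..<d}) (snd z)) \<noteq> sgn (dotp d u (snd z))}"
  have [measurable]: "(\<lambda>z. dotp d (restrict (v (fst z)) {..<d}) (snd z)) \<in> borel_measurable (M \<Otimes>\<^sub>M euclid d)"
    by (rule dotp_measurable2[OF measurable_compose[OF measurable_fst V]]) simp
  have [measurable]: "(\<lambda>z. dotp d u (snd z)) \<in> borel_measurable (M \<Otimes>\<^sub>M euclid d)"
    by (rule measurable_compose[OF measurable_snd dotp_measurable])
  have "?Q \<in> sets (M \<Otimes>\<^sub>M euclid d)" by measurable
  then have "?Q \<in> sets (M \<Otimes>\<^sub>M unif_sphere d)" by (simp cong: sets_pair_measure_cong)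
  from X.measurable_emeasure_Pair[OF this]
  have "(\<lambda>\<omega>. enn2real (emeasure (unif_sphere d) (Pair \<omega> -` ?Q))) \<in> borel_measurable M" by simp
  moreover have "measure (unif_sphere d) {x \<in> space (unif_sphere d). sgn (dotp d (v \<omega>) x) \<noteq> sgn (dotp d u x)}
     = enn2real (emeasure (unif_sphere d) (Pair \<omega> -` ?Q))" if "\<omega> \<in> space M" for \<omega>
    unfolding measure_def using that
    by (intro arg_cong[where f="\<lambda>A. enn2real (emeasure _ A)"]) (auto simp: space_pair_measure dotp_restrict)
  ultimately show ?thesis by (simp cong: measurable_cong)
qed

text \<open>In the last bound, ln 2 \<ge> 2/3 gives the factor 3/2, and rounding adds one, which is
  absorbed because \<open>Lg\<close> is at least one.\<close>

lemma ceil_log_bounds: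
  assumes "0 < \<epsilon>" "\<epsilon> < 1" and n: "n = nat \<lceil>log 2 (1 / \<epsilon>)\<rceil>"
  shows "1 \<le> n" "(1/2) ^ n \<le> \<epsilon>" "\<epsilon> \<le> 2 * (1/2) ^ n" "real n \<le> 3 * Lg (1 / \<epsilon>)"
proof -
  define x where "x = log 2 (1 / \<epsilon>)"
  have x: "0 < x" using assms unfolding x_def by (subst zero_less_log_cancel_iff) auto
  then have c: "0 < \<lceil>x\<rceil>" by simp
  then have rn: "real n = of_int \<lceil>x\<rceil>" unfolding n x_def[symmetric] by simp
  show n1: "1 \<le> n" using rn c by linarith
  have "x \<le> real n" "real n < x + 1" unfolding rn by linarith+
  have e: "2 powr x = 1 / \<epsilon>" using assms unfolding x_def by (intro powr_log_cancel) auto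
  have p: "2 powr (real n) = 2 ^ n" by (simp add: powr_realpow)
  have "1 / \<epsilon> \<le> 2 ^ n" unfolding e[symmetric] p[symmetric] using \<open>x \<le> real n\<close> by simp
  then show "(1/2) ^ n \<le> \<epsilon>" using assms by (simp add: field_simps power_one_over)
  have "2 powr (real n) \<le> 2 powr (x + 1)" using \<open>real n < x + 1\<close> by simp
  then have "2 ^ n \<le> 2 / \<epsilon>" unfolding p by (simp add: powr_add e)
  then show "\<epsilon> \<le> 2 * (1/2) ^ n" using assms by (simp add: field_simps power_one_over)
  have L: "1 \<le> Lg (1 / \<epsilon>)" "ln (1 / \<epsilon>) \<le> Lg (1 / \<epsilon>)" by (auto simp: Lg_def)
  have "x = ln (1 / \<epsilon>) / ln 2" by (simp add: x_def log_def)
  also have "\<dots> \<le> Lg (1 / \<epsilon>) / (2/3)"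
    using L ln2_ge_two_thirds assms by (intro frac_le) auto
  finally show "real n \<le> 3 * Lg (1 / \<epsilon>)" using \<open>real n < x + 1\<close> L by simp
qed

section \<open>Bounds for one fixed choice of parameters\<close>

locale run_params = noisy_halfspace +
  fixes \<epsilon> \<delta> :: real and n :: nat and \<Lambda>0 :: real and bs :: "real list"
  assumes \<epsilon>: "0 < \<epsilon>" "\<epsilon> < 1" and \<delta>: "0 < \<delta>" "\<delta> < 1"
    and nu_le: "\<nu> \<le> 1/10^14 * \<epsilon> / (ln (real d / \<delta>) + ln (Lg (1 / \<epsilon>)))"
  defines "n \<equiv> nat \<lceil>log 2 (1 / \<epsilon>)\<rceil>"
    and "\<Lambda>0 \<equiv> ln (real d) + ln (1 / \<delta>) + ln (Lg (1 / \<epsilon>))"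
    and "bs \<equiv> concat (map (\<lambda>k. replicate (sched_m 1000000000 d \<delta> k) (sched_b (1/19200) 1000000000 d \<delta> k)) [1..<Suc n])"
begin

lemma n_bounds: "1 \<le> n" "(1/2) ^ n \<le> \<epsilon>" "\<epsilon> \<le> 2 * (1/2) ^ n" "real n \<le> 3 * Lg (1 / \<epsilon>)"
  using ceil_log_bounds[OF \<epsilon>, of n] by (auto simp: n_def)

lemma Lg_ge_1: "1 \<le> Lg (1 / \<epsilon>)" by (simp add: Lg_def)

lemma ln_d: "1 \<le> ln (real d)"
proof -
  have "exp 1 \<le> real d" using exp_le d by linarith
  then show ?thesis using d by (simp add: ln_ge_iff)
qed

lemma logs_nonneg: "0 \<le> ln (1 / \<delta>)" "0 \<le> ln (Lg (1 / \<epsilon>))"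
  using \<delta> Lg_ge_1 by (auto simp: ln_div)

lemma Lam0_ge_1: "1 \<le> \<Lambda>0"
  unfolding \<Lambda>0_def using ln_d logs_nonneg by linarith

lemma Lam0_alt: "ln (real d / \<delta>) + ln (Lg (1 / \<epsilon>)) = \<Lambda>0"
  unfolding \<Lambda>0_def using d \<delta> by (simp add: ln_div)

text \<open>The epoch index is at most 3 Lg, and d \<ge> 3 pays for the factor 3. Thus ln k is
  absorbed by ln d plus the iterated logarithm, at the price of doubling ln d.\<close>

lemma lam_le:
  assumes "1 \<le> k" "k \<le> n"
  shows "ln (real d) + ln (real k / \<delta>) \<le> 2 * \<Lambda>0"
proof -
  have "real k \<le> 3 * Lg (1 / \<epsilon>)" using n_bounds(4) assms by linarith
  also have "\<dots> \<le> real d * Lg (1 / \<epsilon>)" using d Lg_ge_1 by (intro mult_right_mono) auto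
  finally have "ln (real k) \<le> ln (real d * Lg (1 / \<epsilon>))" using assms by (intro ln_mono) auto
  also have "\<dots> = ln (real d) + ln (Lg (1 / \<epsilon>))" using d Lg_ge_1 by (intro ln_mult_pos) auto
  finally have "ln (real k) \<le> ln (real d) + ln (Lg (1 / \<epsilon>))" .
  moreover have "ln (real k / \<delta>) = ln (real k) + ln (1 / \<delta>)" using assms \<delta> by (simp add: ln_div)
  ultimately show ?thesis using logs_nonneg unfolding \<Lambda>0_def distrib_left by linarith
qed

lemma log_term_bounds:
  assumes "1 \<le> k" "k \<le> n" shows "1 \<le> log_term d \<delta> k" "log_term d \<delta> k \<le> 66 * \<Lambda>0"
  using log_term_ge_1[OF d \<delta> assms(1)] log_term_le[OF d \<delta> assms(1)] lam_le[OF assms] by auto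

lemma half_power_le: "k \<le> n \<Longrightarrow> \<epsilon> \<le> 2 * (1/2) ^ k"
  using n_bounds(3) power_decreasing[of k n "1/2::real"] by linarith

text \<open>The noise budget has to work for every band, and the narrowest ones are of order
  \<epsilon>. The loss is 66 from the logarithm and 2 from rounding the number of epochs; 10^14
  leaves room for these and for 100000 * 19200 * 50 = 96000000000.\<close>

lemma nu_small:
  assumes k: "1 \<le> k" "k \<le> n"
  shows "\<nu> \<le> 1/100000 * (1 / (19200 * log_term d \<delta> k) * (1/2) ^ k / 50)"
proof -
  note l = log_term_bounds[OF k]
  have "\<nu> \<le> 1/10^14 * \<epsilon> / \<Lambda>0" using nu_le unfolding Lam0_alt .
  also have "\<dots> \<le> 1/10^14 * (2 * (1/2) ^ k) / (log_term d \<delta> k / 66)"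
    using l half_power_le[OF k(2)] \<epsilon> Lam0_ge_1 by (intro frac_le mult_left_mono) auto
  also have "\<dots> = (132 / 10^14) * ((1/2) ^ k / log_term d \<delta> k)" using l by (simp add: field_simps)
  also have "\<dots> \<le> (1 / 96000000000) * ((1/2) ^ k / log_term d \<delta> k)" using l by (intro mult_right_mono) auto
  finally show ?thesis by simp
qed

lemma epochs_bound:
  assumes w: "dotp d w w = 1" "w \<in> space (euclid d)" "miss w \<le> 1"
  shows "run_op bs (\<lambda>w. if miss w \<le> ((1/2) ^ n)\<^sup>2 / 16 then 0 else 1) w \<le> ennreal (\<delta> / 2)"
proof -
  have "run_op bs (\<lambda>w. if miss w \<le> ((1/2) ^ n)\<^sup>2 / 16 then 0 else 1) w \<le> ennreal (\<Sum>k=1..n. \<delta> / (4 * (real k)\<^sup>2))"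
    unfolding bs_def
  proof (rule epochs_failure[where l="log_term d \<delta>" and \<beta>="\<lambda>k. 1 / (19200 * log_term d \<delta> k)"])
    fix k assume k: "1 \<le> k" "k \<le> n"
    show "1 \<le> log_term d \<delta> k \<and> 1 / (19200 * log_term d \<delta> k) = 1 / (19200 * log_term d \<delta> k) \<and>
         sched_b (1/19200) 1000000000 d \<delta> k = 1 / (19200 * log_term d \<delta> k) * (1/2) ^ k / sqrt (real d) \<and>
         \<nu> \<le> 1/100000 * (1 / (19200 * log_term d \<delta> k) * (1/2) ^ k / 50) \<and>
         12950000 * real d * log_term d \<delta> k \<le> real (sched_m 1000000000 d \<delta> k) \<and>
         8 * real (sched_m 1000000000 d \<delta> k) * exp (- (3 * log_term d \<delta> k)) \<le> \<delta> / (4 * (real k)\<^sup>2)"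
      using log_term_bounds(1)[OF k] nu_small[OF k] num_iter_ge[OF d \<delta> k(1)] failure_le[OF d \<delta> k(1)] sched_b_eq
      unfolding num_iter_def by blast
  qed (use w n_bounds in auto)
  also have "(\<Sum>k=1..n. \<delta> / (4 * (real k)\<^sup>2)) = \<delta> / 4 * (\<Sum>k=1..n. 1 / (real k)\<^sup>2)"
    by (simp add: sum_distrib_left)
  also have "ennreal \<dots> \<le> ennreal (\<delta> / 4 * 2)"
    using \<delta> by (intro ennreal_leI mult_left_mono sum_inverse_squares_le) auto
  finally show ?thesis by simp
qed

lemma bs_length: "real (length bs) \<le> 12000000000 * real d * Lg (1 / \<epsilon>) * \<Lambda>0"
proof -
  have "length bs = (\<Sum>k\<leftarrow>[1..<Suc n]. sched_m 1000000000 d \<delta> k)"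
    unfolding bs_def by (simp add: length_concat comp_def del: upt_Suc)
  also have "\<dots> = (\<Sum>k=1..n. sched_m 1000000000 d \<delta> k)"
    by (simp add: sum_list_distinct_conv_sum_set atLeastLessThanSuc_atLeastAtMost del: upt_Suc)
  finally have "real (length bs) = (\<Sum>k=1..n. real (num_iter d \<delta> k))" by (simp add: num_iter_def)
  also have "\<dots> \<le> (\<Sum>k=1..n. 2000000000 * real d * (2 * \<Lambda>0))"
  proof (intro sum_mono)
    fix k assume "k \<in> {1..n}"
    then have k: "1 \<le> k" "k \<le> n" by auto
    have "2000000000 * real d * (ln (real d) + ln (real k / \<delta>)) \<le> 2000000000 * real d * (2 * \<Lambda>0)"
      by (intro mult_left_mono lam_le[OF k]) simp
    then show "real (num_iter d \<delta> k) \<le> 2000000000 * real d * (2 * \<Lambda>0)"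
      using num_iter_bounds(2)[OF d \<delta> k(1)] by linarith
  qed
  also have "\<dots> = real n * (4000000000 * real d * \<Lambda>0)" by simp
  also have "\<dots> \<le> (3 * Lg (1 / \<epsilon>)) * (4000000000 * real d * \<Lambda>0)"
    using n_bounds(4) Lam0_ge_1 by (intro mult_right_mono) auto
  finally show ?thesis by (simp add: mult_ac)
qed

text \<open>A lower bound for the probability of every band of the schedule, at every unit vector:
  63360000 = 66 * 19200 * 50 combines the logarithm, the width constant and the constant of
  \<open>band_prob_lower\<close>.\<close>

definition pmin :: real where "pmin = (1/2) ^ n / (63360000 * \<Lambda>0)"

lemma pmin_bounds: "0 < pmin" "pmin \<le> 1" "1 / pmin \<le> 126720000 * \<Lambda>0 * (1 / \<epsilon>)"
proof -
  show "0 < pmin" using Lam0_ge_1 by (simp add: pmin_def)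
  have "(1/2::real) ^ n \<le> 1" by (intro power_le_one) auto
  then show "pmin \<le> 1" using Lam0_ge_1 by (simp add: pmin_def divide_le_eq)
  have "1 / pmin = 63360000 * \<Lambda>0 / (1/2) ^ n" by (simp add: pmin_def)
  also have "\<dots> \<le> 63360000 * \<Lambda>0 / (\<epsilon> / 2)"
    using n_bounds(3) \<epsilon> Lam0_ge_1 by (intro divide_left_mono) auto
  finally show "1 / pmin \<le> 126720000 * \<Lambda>0 * (1 / \<epsilon>)" by simp
qed

lemma bs_admissible:
  assumes "b \<in> set bs" shows "admissible b" "pmin \<le> b * sqrt (real d) / 50"
proof -
  obtain k where k: "1 \<le> k" "k \<le> n" and b: "b = sched_b (1/19200) 1000000000 d \<delta> k"
    using assms unfolding bs_def by (auto simp: set_replicate_conv_if simp del: upt_Suc split: if_splits)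
  note l = log_term_bounds[OF k]
  have b': "b = (1 / (19200 * log_term d \<delta> k)) * (1/2) ^ k / sqrt (real d)" unfolding b by (rule sched_b_eq)
  have "(1/2::real) ^ k \<le> (1/2) ^ 1" using k by (intro power_decreasing) auto
  then have t: "0 < (1/2::real) ^ k" "(1/2::real) ^ k \<le> 1/2" by auto
  have "1 / (19200 * log_term d \<delta> k) \<le> 1 / 300" using l by (intro divide_left_mono) auto
  then show "admissible b"
    using l by (intro b_small(2)[OF t _ _ b' refl nu_small[OF k]]) auto
  have "pmin \<le> (1/2) ^ k / (960000 * log_term d \<delta> k)"
    unfolding pmin_def using l k by (intro frac_le power_decreasing) auto
  also have "\<dots> = b * sqrt (real d) / 50" using d by (simp add: b')
  finally show "pmin \<le> b * sqrt (real d) / 50" .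
qed

text \<open>The Chernoff threshold: multiplied by \<open>pmin / 2\<close> and exponentiated, it
  becomes e to the number of iterations times 2 / \<delta>.\<close>

definition draws_bound :: real where
  "draws_bound = 2 / pmin * (real (length bs) + ln (2 / \<delta>))"

lemma draws_bound_le: "draws_bound \<le> 4 * 10^18 * real d * \<Lambda>0\<^sup>2 * (1 / \<epsilon>) * Lg (1 / \<epsilon>)"
proof -
  have pos: "1 \<le> real d * Lg (1 / \<epsilon>)" using mult_mono[of 1 "real d" 1 "Lg (1 / \<epsilon>)"] d Lg_ge_1 by simp
  have "ln (2 / \<delta>) \<le> ln (real d / \<delta>)" using d \<delta> by (intro ln_mono divide_right_mono) auto
  then have "ln (2 / \<delta>) \<le> \<Lambda>0" using Lam0_alt logs_nonneg by linarith
  also have "\<dots> \<le> real d * Lg (1 / \<epsilon>) * \<Lambda>0" using mult_right_mono[OF pos, of \<Lambda>0] Lam0_ge_1 by simp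
  finally have "real (length bs) + ln (2 / \<delta>) \<le> 12000000001 * (real d * Lg (1 / \<epsilon>) * \<Lambda>0)"
    using bs_length by simp
  moreover have "0 \<le> ln (2 / \<delta>)" using \<delta> by (intro ln_ge_zero) (simp add: field_simps)
  ultimately have "(2 * (1 / pmin)) * (real (length bs) + ln (2 / \<delta>))
      \<le> (2 * (126720000 * \<Lambda>0 * (1 / \<epsilon>))) * (12000000001 * (real d * Lg (1 / \<epsilon>) * \<Lambda>0))"
    using pmin_bounds \<epsilon> Lam0_ge_1 by (intro mult_mono) auto
  also have "\<dots> = 3041280000253440000 * (real d * \<Lambda>0\<^sup>2 * (1 / \<epsilon>) * Lg (1 / \<epsilon>))"
    by (simp add: power2_eq_square)
  also have "\<dots> \<le> 4 * 10^18 * (real d * \<Lambda>0\<^sup>2 * (1 / \<epsilon>) * Lg (1 / \<epsilon>))"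
    using \<epsilon> Lg_ge_1 by (intro mult_right_mono) auto
  finally show ?thesis unfolding draws_bound_def by (simp add: mult.assoc)
qed

text \<open>The sine is at most 3/8 \<epsilon> and the cosine at least 15/16, so the cone bound
  gives 4/5 \<epsilon>.\<close>

lemma miss_small_imp_error:
  assumes v: "dotp d v v = 1" and z: "miss v \<le> ((1/2) ^ n)\<^sup>2 / 16"
  shows "measure (unif_sphere d) {x \<in> space (unif_sphere d). sgn (dotp d v x) \<noteq> sgn (dotp d u x)} \<le> \<epsilon>"
proof -
  have "((1/2) ^ n)\<^sup>2 \<le> \<epsilon>\<^sup>2" using n_bounds(2) by (intro power_mono) auto
  then have z: "miss v \<le> \<epsilon>\<^sup>2 / 16" using z by simp
  have e1: "\<epsilon>\<^sup>2 \<le> 1" using \<epsilon> by (intro power_le_one) auto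
  have t: "15/16 \<le> dotp d v u" using z e1 by (simp add: miss_def)
  have "1 - (dotp d v u)\<^sup>2 = miss v * (2 - miss v)" by (rule sine_eq)
  also have "\<dots> \<le> miss v * 2" using miss_bounds[OF v] by (intro mult_left_mono) auto
  also have "\<dots> \<le> 9/64 * \<epsilon>\<^sup>2" using z zero_le_power2[of \<epsilon>] by linarith
  also have "\<dots> = (3/8 * \<epsilon>)\<^sup>2" by (simp add: power_mult_distrib power_divide)
  finally have "sqrt (1 - (dotp d v u)\<^sup>2) \<le> sqrt ((3/8 * \<epsilon>)\<^sup>2)" by (rule real_sqrt_le_mono)
  then have s: "sqrt (1 - (dotp d v u)\<^sup>2) \<le> 3/8 * \<epsilon>" using \<epsilon> by simp
  have "measure (unif_sphere d) {x \<in> space (unif_sphere d). sgn (dotp d v x) \<noteq> sgn (dotp d u x)}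
     \<le> 2 * (sqrt (1 - (dotp d v u)\<^sup>2) / dotp d v u)"
    using d t by (intro disagreement_upper v u) auto
  also have "\<dots> \<le> 2 * ((3/8 * \<epsilon>) / (15/16))"
    using s t \<epsilon> by (intro mult_left_mono frac_le) auto
  also have "\<dots> \<le> \<epsilon>" using \<epsilon> by simp
  finally show ?thesis .
qed

lemma run_op_mono:
  assumes "\<And>w. dotp d w w = 1 \<Longrightarrow> w \<in> space (euclid d) \<Longrightarrow> f w \<le> g w"
    and "dotp d w w = 1" "w \<in> space (euclid d)"
  shows "run_op cs f w \<le> run_op cs g w"
  using assms(2,3)
proof (induction cs arbitrary: w)
  case Nil
  then show ?case using assms(1) by simp
next
  case (Cons c cs)
  then show ?case by (simp add: step_op_mono)
qed

context
  fixes v0 :: vec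
  assumes v0: "dotp d v0 v0 = 1" "arccos (dotp d v0 u) \<le> pi / 2"
begin

definition final :: "(nat \<Rightarrow> vec) \<times> (nat \<Rightarrow> real) \<Rightarrow> vec \<times> nat \<times> nat" where
  "final \<omega> = fold (perc_step d \<eta> \<omega>) bs (v0, 0, 0)"

lemma v0_restrict:
  "dotp d (restrict v0 {..<d}) (restrict v0 {..<d}) = 1" "restrict v0 {..<d} \<in> space (euclid d)" "miss (restrict v0 {..<d}) \<le> 1"
proof -
  have eq: "dotp d (restrict v0 {..<d}) x = dotp d v0 x" for x by (rule dotp_restrict)
  show "dotp d (restrict v0 {..<d}) (restrict v0 {..<d}) = 1"
    using v0 eq dotp_commute by metis
  show "restrict v0 {..<d} \<in> space (euclid d)" by (simp add: space_euclid)
  have "\<bar>dotp d v0 u\<bar> \<le> 1" by (rule abs_dotp_le_1[OF v0(1) u])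
  then have "dotp d v0 u = cos (arccos (dotp d v0 u))" "0 \<le> arccos (dotp d v0 u)"
    by (auto intro: arccos_lbound simp: cos_arccos_abs)
  then have "0 \<le> dotp d v0 u" using v0(2) cos_ge_zero[of "arccos (dotp d v0 u)"] by simp
  then show "miss (restrict v0 {..<d}) \<le> 1" by (simp add: miss_def eq)
qed

text \<open>Unit length is included because \<open>disagreement_upper\<close> asks for it and the
  run could violate it on a null event. The clause costs no probability: operators are compared on
  unit vectors only.\<close>

definition goodv :: "vec \<Rightarrow> bool" where
  "goodv w \<longleftrightarrow> dotp d w w = 1 \<and> miss w \<le> ((1/2) ^ n)\<^sup>2 / 16"

lemma goodv_restrict: "goodv (restrict w {..<d}) = goodv w"
  using dotp_restrict[of d w] dotp_commute[of d w "restrict w {..<d}"] by (simp add: goodv_def miss_def)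

lemma goodv_pred: "Measurable.pred (euclid d) goodv"
proof -
  have [measurable]: "miss \<in> borel_measurable (euclid d)"
    unfolding miss_def[abs_def] dotp_commute[of d _ u] by measurable
  show ?thesis unfolding goodv_def[abs_def] by measurable
qed

lemma final_measurable: "state_measurable d final"
  unfolding final_def[abs_def] by (rule state_measurable_run[OF \<eta>])

lemma goodv_final_pred: "Measurable.pred (sample_space d) (\<lambda>\<omega>. goodv (fst (final \<omega>)))"
proof -
  have "(\<lambda>\<omega>. restrict (fst (final \<omega>)) {..<d}) \<in> measurable (sample_space d) (euclid d)"
    using final_measurable by (simp add: state_measurable_def)
  from measurable_compose[OF this goodv_pred] show ?thesis by (simp add: goodv_restrict)
qed

lemma draws_measurable: "(\<lambda>\<omega>. fst (snd (final \<omega>))) \<in> measurable (sample_space d) (count_space UNIV)"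
  using final_measurable by (simp add: state_measurable_def)

lemma bad_vector_prob: "measure (sample_space d) {\<omega> \<in> space (sample_space d). \<not> goodv (fst (final \<omega>))} \<le> \<delta> / 2"
proof -
  interpret S: prob_space "sample_space d" by (rule prob_space_sample_space)
  let ?f = "\<lambda>w. if goodv w then 0 else 1 :: ennreal"
  let ?w = "restrict v0 {..<d}"
  have f: "?f \<in> borel_measurable (euclid d)"
    using goodv_pred by measurable
  have A: "{\<omega> \<in> space (sample_space d). \<not> goodv (fst (final \<omega>))} \<in> sets (sample_space d)"
    using goodv_final_pred by measurable
  have "emeasure (sample_space d) {\<omega> \<in> space (sample_space d). \<not> goodv (fst (final \<omega>))}
    = (\<integral>\<^sup>+\<omega>. indicator {\<omega> \<in> space (sample_space d). \<not> goodv (fst (final \<omega>))} \<omega> \<partial>sample_space d)"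
    using A by simp
  also have "\<dots> = (\<integral>\<^sup>+\<omega>. ?f (restrict (fst (fold (perc_step d \<eta> \<omega>) bs (v0, 0, 0))) {..<d}) \<partial>sample_space d)"
    by (intro nn_integral_cong) (simp add: goodv_restrict indicator_def final_def)
  also have "\<dots> \<le> (\<integral>\<^sup>+xs. \<integral>\<^sup>+rs. cost d \<eta> (\<lambda>w N. ?f w) bs ?w 0 xs rs \<partial>coins \<partial>points d)"
    by (rule run_integral_le[OF \<eta> f])
  also have "\<dots> \<le> run_op bs ?f ?w"
    by (rule cost_le_run_op[OF f bs_admissible(1) v0_restrict(1,2)])
  also have "\<dots> \<le> run_op bs (\<lambda>w. if miss w \<le> ((1/2) ^ n)\<^sup>2 / 16 then 0 else 1) ?w"
    by (rule run_op_mono[OF _ v0_restrict(1,2)]) (auto simp: goodv_def)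
  also have "\<dots> \<le> ennreal (\<delta> / 2)" by (rule epochs_bound[OF v0_restrict])
  finally show ?thesis using \<delta> by (simp add: S.emeasure_eq_measure)
qed

text \<open>Markov's inequality for c^N, with c at least exp (pmin / 2). Each iteration contributes
  a factor 2 to the expectation but a factor e to the threshold, so only the factor 2 / \<delta> is
  left to pay.\<close>

lemma many_draws_prob: "measure (sample_space d) {\<omega> \<in> space (sample_space d). draws_bound < real (fst (snd (final \<omega>)))} \<le> \<delta> / 2"
proof -
  interpret S: prob_space "sample_space d" by (rule prob_space_sample_space)
  let ?A = "{\<omega> \<in> space (sample_space d). draws_bound < real (fst (snd (final \<omega>)))}"
  define c where "c = 1 / (1 - pmin / 2)"
  have "1 - pmin / 2 \<le> exp (- (pmin / 2))" using exp_ge_add_one_self[of "- (pmin / 2)"] by simp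
  moreover have "0 < 1 - pmin / 2" using pmin_bounds by simp
  ultimately have c: "exp (pmin / 2) \<le> c"
    unfolding c_def by (simp add: exp_minus field_simps)
  have A: "?A \<in> sets (sample_space d)"
    using draws_measurable by measurable
  have "ennreal (exp (pmin / 2 * draws_bound)) * emeasure (sample_space d) ?A
     = (\<integral>\<^sup>+\<omega>. ennreal (exp (pmin / 2 * draws_bound)) * indicator ?A \<omega> \<partial>sample_space d)"
    using A by (rule nn_integral_cmult_indicator[symmetric])
  also have "\<dots> \<le> (\<integral>\<^sup>+\<omega>. (\<lambda>w N. ennreal (c ^ N)) (restrict (fst (fold (perc_step d \<eta> \<omega>) bs (v0, 0, 0))) {..<d}) (fst (snd (fold (perc_step d \<eta> \<omega>) bs (v0, 0, 0)))) \<partial>sample_space d)"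
  proof (rule nn_integral_mono)
    fix \<omega> assume "\<omega> \<in> space (sample_space d)"
    have "exp (pmin / 2 * draws_bound) \<le> c ^ N" if "draws_bound < real N" for N
    proof -
      have "exp (pmin / 2 * draws_bound) \<le> exp (real N * (pmin / 2))" using that pmin_bounds(1) by simp
      also have "\<dots> = exp (pmin / 2) ^ N" by (rule exp_of_nat_mult)
      also have "\<dots> \<le> c ^ N" using c by (intro power_mono) auto
      finally show ?thesis .
    qed
    then show "ennreal (exp (pmin / 2 * draws_bound)) * indicator ?A \<omega>
       \<le> (\<lambda>w N. ennreal (c ^ N)) (restrict (fst (fold (perc_step d \<eta> \<omega>) bs (v0, 0, 0))) {..<d}) (fst (snd (fold (perc_step d \<eta> \<omega>) bs (v0, 0, 0))))"
      unfolding final_def[symmetric] by (simp add: indicator_def ennreal_leI)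
  qed
  also have "\<dots> \<le> (\<integral>\<^sup>+xs. \<integral>\<^sup>+rs. cost d \<eta> (\<lambda>w N. ennreal (c ^ N)) bs (restrict v0 {..<d}) 0 xs rs \<partial>coins \<partial>points d)"
    by (rule run_integral_le[OF \<eta>]) simp
  also have "\<dots> \<le> ennreal (2 ^ length bs)"
    unfolding c_def using bs_admissible pmin_bounds(1,2) v0_restrict by (intro cost_draws_le) auto
  finally have le: "exp (pmin / 2 * draws_bound) * S.prob ?A \<le> 2 ^ length bs"
    by (simp add: S.emeasure_eq_measure ennreal_mult[symmetric])
  have "pmin / 2 * draws_bound = real (length bs) + ln (2 / \<delta>)"
    using pmin_bounds(1) by (simp add: draws_bound_def)
  also have "exp \<dots> = exp (real (length bs)) * (2 / \<delta>)"
    using \<delta> by (simp add: exp_add)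
  also have "exp (real (length bs)) = exp 1 ^ length bs"
    using exp_of_nat_mult[of "length bs" "1::real"] by simp
  finally have "exp 1 ^ length bs * (2 / \<delta>) * S.prob ?A \<le> 2 ^ length bs"
    using le by (simp only:)
  also have "\<dots> \<le> exp 1 ^ length bs" using exp_ge_add_one_self[of 1] by (intro power_mono) auto
  finally have "exp 1 ^ length bs * ((2 / \<delta>) * S.prob ?A) \<le> exp 1 ^ length bs * (1::real)" by (simp add: mult.assoc)
  then have "(2 / \<delta>) * S.prob ?A \<le> 1" by (rule mult_left_le_imp_le) simp
  then show ?thesis using \<delta> by (simp add: field_simps)
qed

text \<open>The number of labels is deterministic, one per iteration. Hence only two events can
  spoil the conclusion, a bad final vector and too many draws, each with probability at most
  \<delta> / 2.\<close>

theorem guarantee: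
  "1 - \<delta> \<le> measure (sample_space d)
     {\<omega> \<in> space (sample_space d).
        (case active_perceptron d \<eta> \<omega> v0 \<epsilon> (sched_m 1000000000 d \<delta>) (sched_b (1/19200) 1000000000 d \<delta>) of
          (v, N, L) \<Rightarrow>
            measure (unif_sphere d) {x \<in> space (unif_sphere d). sgn (dotp d v x) \<noteq> sgn (dotp d u x)} \<le> \<epsilon>
          \<and> real L \<le> 12000000000 * real d * Lg (1 / \<epsilon>) * \<Lambda>0
          \<and> real N \<le> 4 * 10^18 * real d * \<Lambda>0\<^sup>2 * (1 / \<epsilon>) * Lg (1 / \<epsilon>)
          \<and> real (running_time d N L) \<le> 5 * 10^18 * (real d)\<^sup>2 * \<Lambda>0\<^sup>2 * (1 / \<epsilon>) * Lg (1 / \<epsilon>))}"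
    (is "_ \<le> measure _ {\<omega> \<in> _. ?E \<omega>}")
proof -
  interpret S: prob_space "sample_space d" by (rule prob_space_sample_space)
  let ?err = "\<lambda>v. measure (unif_sphere d) {x \<in> space (unif_sphere d). sgn (dotp d v x) \<noteq> sgn (dotp d u x)}"
  let ?N = "\<lambda>\<omega>. fst (snd (final \<omega>))"
  let ?B1 = "{\<omega> \<in> space (sample_space d). \<not> goodv (fst (final \<omega>))}"
  let ?B2 = "{\<omega> \<in> space (sample_space d). draws_bound < real (?N \<omega>)}"
  have L: "snd (snd (final \<omega>)) = length bs" for \<omega> by (simp add: final_def fold_perc_labels)
  have E_eq: "?E \<omega> \<longleftrightarrow> ?err (fst (final \<omega>)) \<le> \<epsilon>
      \<and> real (length bs) \<le> 12000000000 * real d * Lg (1 / \<epsilon>) * \<Lambda>0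
      \<and> real (?N \<omega>) \<le> 4 * 10^18 * real d * \<Lambda>0\<^sup>2 * (1 / \<epsilon>) * Lg (1 / \<epsilon>)
      \<and> real (running_time d (?N \<omega>) (length bs)) \<le> 5 * 10^18 * (real d)\<^sup>2 * \<Lambda>0\<^sup>2 * (1 / \<epsilon>) * Lg (1 / \<epsilon>)" for \<omega>
    unfolding active_perceptron_fold n_def[symmetric] bs_def[symmetric] final_def[symmetric]
    using L[of \<omega>] by (simp add: case_prod_beta)
  have N_pred: "{\<omega> \<in> space (sample_space d). Q (?N \<omega>)} \<in> sets (sample_space d)" for Q
    by (rule predE[OF measurable_compose[OF draws_measurable]]) simp
  have [measurable]: "(\<lambda>\<omega>. ?err (fst (final \<omega>))) \<in> borel_measurable (sample_space d)"
    using final_measurable by (intro disagreement_measurable) (simp add: state_measurable_def)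
  have err_sets: "{\<omega> \<in> space (sample_space d). ?err (fst (final \<omega>)) \<le> \<epsilon>} \<in> sets (sample_space d)"
    by measurable
  have E: "{\<omega> \<in> space (sample_space d). ?E \<omega>} \<in> sets (sample_space d)"
  proof -
    let ?Q = "\<lambda>N. real (length bs) \<le> 12000000000 * real d * Lg (1 / \<epsilon>) * \<Lambda>0
      \<and> real N \<le> 4 * 10^18 * real d * \<Lambda>0\<^sup>2 * (1 / \<epsilon>) * Lg (1 / \<epsilon>)
      \<and> real (running_time d N (length bs)) \<le> 5 * 10^18 * (real d)\<^sup>2 * \<Lambda>0\<^sup>2 * (1 / \<epsilon>) * Lg (1 / \<epsilon>)"
    have "{\<omega> \<in> space (sample_space d). ?E \<omega>} = {\<omega> \<in> space (sample_space d). ?err (fst (final \<omega>)) \<le> \<epsilon>} \<inter> {\<omega> \<in> space (sample_space d). ?Q (?N \<omega>)}"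
      unfolding E_eq by blast
    then show ?thesis using sets.Int[OF err_sets N_pred[of ?Q]] by (simp only:)
  qed
  have B1: "?B1 \<in> sets (sample_space d)" using goodv_final_pred by measurable
  have B2: "?B2 \<in> sets (sample_space d)" by (rule N_pred)
  have good: "?E \<omega>" if v: "goodv (fst (final \<omega>))" and N: "real (?N \<omega>) \<le> draws_bound" for \<omega>
    unfolding E_eq
  proof (intro conjI)
    show "?err (fst (final \<omega>)) \<le> \<epsilon>" using v by (intro miss_small_imp_error) (auto simp: goodv_def)
    show len: "real (length bs) \<le> 12000000000 * real d * Lg (1 / \<epsilon>) * \<Lambda>0" by (rule bs_length)
    show N': "real (?N \<omega>) \<le> 4 * 10^18 * real d * \<Lambda>0\<^sup>2 * (1 / \<epsilon>) * Lg (1 / \<epsilon>)"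
      using N draws_bound_le by linarith
    let ?X = "real d * Lg (1 / \<epsilon>) * \<Lambda>0"
    have X: "0 \<le> ?X" using Lg_ge_1 Lam0_ge_1 by (intro mult_nonneg_nonneg) auto
    \<comment> \<open>The bound on draws exceeds the bound on labels by a further factor \<Lambda>0
      / \<epsilon>, which is at least one, so the cost of labels is absorbed into that of the
      draws.\<close>
    have "1 \<le> 1 / \<epsilon>" using \<epsilon> by simp
    then have "1 * 1 \<le> \<Lambda>0 * (1 / \<epsilon>)" using Lam0_ge_1 by (intro mult_mono) auto
    then have "?X * 1 \<le> ?X * (\<Lambda>0 * (1 / \<epsilon>))" using X by (intro mult_left_mono) auto
    define Y where "Y = real d * \<Lambda>0\<^sup>2 * (1 / \<epsilon>) * Lg (1 / \<epsilon>)"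
    have "?X * (\<Lambda>0 * (1 / \<epsilon>)) = Y" by (simp add: Y_def power2_eq_square)
    with \<open>?X * 1 \<le> ?X * (\<Lambda>0 * (1 / \<epsilon>))\<close> have "?X \<le> Y" by simp
    moreover have "real (length bs) \<le> 12000000000 * ?X" using len by (simp only: mult.assoc)
    moreover have "real (?N \<omega>) \<le> 4 * 10^18 * Y" using N' by (simp only: Y_def mult.assoc)
    ultimately have "real (?N \<omega>) + real (length bs) \<le> 5 * 10^18 * Y" using X by simp
    then have "real (?N \<omega>) + real (length bs) \<le> 5 * 10^18 * (real d * \<Lambda>0\<^sup>2 * (1 / \<epsilon>) * Lg (1 / \<epsilon>))"
      by (simp only: Y_def)
    then have "real d * (real (?N \<omega>) + real (length bs)) \<le> real d * (5 * 10^18 * (real d * \<Lambda>0\<^sup>2 * (1 / \<epsilon>) * Lg (1 / \<epsilon>)))"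
      by (intro mult_left_mono) auto
    then show "real (running_time d (?N \<omega>) (length bs)) \<le> 5 * 10^18 * (real d)\<^sup>2 * \<Lambda>0\<^sup>2 * (1 / \<epsilon>) * Lg (1 / \<epsilon>)"
      by (simp add: running_time_def power2_eq_square mult_ac)
  qed
  have "space (sample_space d) - {\<omega> \<in> space (sample_space d). ?E \<omega>} \<subseteq> ?B1 \<union> ?B2"
  proof
    have diff: "A - {\<omega> \<in> A. P \<omega>} = {\<omega> \<in> A. \<not> P \<omega>}" for A and P :: "(nat \<Rightarrow> vec) \<times> (nat \<Rightarrow> real) \<Rightarrow> bool" by auto
    fix \<omega> assume "\<omega> \<in> space (sample_space d) - {\<omega> \<in> space (sample_space d). ?E \<omega>}"
    then have *: "\<omega> \<in> space (sample_space d) \<and> \<not> ?E \<omega>" unfolding diff mem_Collect_eq .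
    then have sp: "\<omega> \<in> space (sample_space d)" by (rule conjunct1)
    have ne: "\<not> ?E \<omega>" using * by (rule conjunct2)
    show "\<omega> \<in> ?B1 \<union> ?B2"
    proof (cases "goodv (fst (final \<omega>))")
      case True
      have "\<not> real (?N \<omega>) \<le> draws_bound"
      proof
        assume "real (?N \<omega>) \<le> draws_bound"
        from good[OF True this] show False using ne by (rule notE[rotated])
      qed
      with sp show ?thesis by simp
    qed (use sp in simp)
  qed
  then have "S.prob (space (sample_space d) - {\<omega> \<in> space (sample_space d). ?E \<omega>}) \<le> S.prob (?B1 \<union> ?B2)"
    using B1 B2 by (intro S.finite_measure_mono) auto
  also have "\<dots> \<le> S.prob ?B1 + S.prob ?B2" using B1 B2 by (rule measure_Un_le)
  also have "\<dots> \<le> \<delta>" using bad_vector_prob many_draws_prob by simp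
  finally show ?thesis using S.prob_compl[OF E] by simp
qed

end

end

theorem theorem3:
  shows "\<exists>c>0. \<exists>cm>0. \<exists>cb>0. \<exists>C1 C2 C3::real.
    \<forall>(d::nat) (\<epsilon>::real) (\<delta>::real) (\<nu>::real) (\<eta>::vec \<Rightarrow> real) (u::vec) (v0::vec).
      3 \<le> d \<and> 0 < \<epsilon> \<and> \<epsilon> < 1 \<and> 0 < \<delta> \<and> \<delta> < 1
      \<and> \<eta> \<in> borel_measurable (euclid d) \<and> (\<forall>x. 0 \<le> \<eta> x \<and> \<eta> x \<le> 1)
      \<and> dotp d u u = 1 \<and> dotp d v0 v0 = 1
      \<and> adversarial_noise d \<eta> \<nu> u
      \<and> arccos (dotp d v0 u) \<le> pi / 2
      \<and> \<nu> \<le> c * \<epsilon> / (ln (real d / \<delta>) + ln (Lg (1 / \<epsilon>)))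
      \<longrightarrow>
      measure (sample_space d)
        {\<omega> \<in> space (sample_space d).
           (case active_perceptron d \<eta> \<omega> v0 \<epsilon> (sched_m cm d \<delta>) (sched_b cb cm d \<delta>) of
             (v, N, L) \<Rightarrow>
               measure (unif_sphere d)
                  {x \<in> space (unif_sphere d). sgn (dotp d v x) \<noteq> sgn (dotp d u x)} \<le> \<epsilon>
             \<and> real L \<le> C1 * real d * Lg (1 / \<epsilon>)
                  * (ln (real d) + ln (1 / \<delta>) + ln (Lg (1 / \<epsilon>)))
             \<and> real N \<le> C2 * real d * (ln (real d) + ln (1 / \<delta>) + ln (Lg (1 / \<epsilon>)))\<^sup>2
                  * (1 / \<epsilon>) * Lg (1 / \<epsilon>)
             \<and> real (running_time d N L) \<le> C3 * (real d)\<^sup>2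
                  * (ln (real d) + ln (1 / \<delta>) + ln (Lg (1 / \<epsilon>)))\<^sup>2
                  * (1 / \<epsilon>) * Lg (1 / \<epsilon>))}
      \<ge> 1 - \<delta>"
proof (rule exI[of _ "1/10^14"], rule conjI, simp, rule exI[of _ 1000000000], rule conjI, simp,
    rule exI[of _ "1/19200"], rule conjI, simp, rule exI[of _ 12000000000], rule exI[of _ "4 * 10^18"],
    rule exI[of _ "5 * 10^18"], intro allI impI, elim conjE)
  fix d :: nat and \<epsilon> \<delta> \<nu> :: real and \<eta> :: "vec \<Rightarrow> real" and u v0 :: vec
  assume "3 \<le> d" "\<eta> \<in> borel_measurable (euclid d)" "dotp d u u = 1" "adversarial_noise d \<eta> \<nu> u"
    "0 < \<epsilon>" "\<epsilon> < 1" "0 < \<delta>" "\<delta> < 1"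
    "\<nu> \<le> 1/10^14 * \<epsilon> / (ln (real d / \<delta>) + ln (Lg (1 / \<epsilon>)))"
  then have par: "run_params d \<eta> u \<nu> \<epsilon> \<delta>"
    by unfold_locales
  assume "dotp d v0 v0 = 1" "arccos (dotp d v0 u) \<le> pi / 2"
  note main = run_params.guarantee[OF par this]
  show "1 - \<delta> \<le> measure (sample_space d)
        {\<omega> \<in> space (sample_space d).
           (case active_perceptron d \<eta> \<omega> v0 \<epsilon> (sched_m 1000000000 d \<delta>) (sched_b (1/19200) 1000000000 d \<delta>) of
             (v, N, L) \<Rightarrow>
               measure (unif_sphere d)
                  {x \<in> space (unif_sphere d). sgn (dotp d v x) \<noteq> sgn (dotp d u x)} \<le> \<epsilon>
             \<and> real L \<le> 12000000000 * real d * Lg (1 / \<epsilon>)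
                  * (ln (real d) + ln (1 / \<delta>) + ln (Lg (1 / \<epsilon>)))
             \<and> real N \<le> 4 * 10^18 * real d * (ln (real d) + ln (1 / \<delta>) + ln (Lg (1 / \<epsilon>)))\<^sup>2
                  * (1 / \<epsilon>) * Lg (1 / \<epsilon>)
             \<and> real (running_time d N L) \<le> 5 * 10^18 * (real d)\<^sup>2
                  * (ln (real d) + ln (1 / \<delta>) + ln (Lg (1 / \<epsilon>)))\<^sup>2
                  * (1 / \<epsilon>) * Lg (1 / \<epsilon>))}"
    by (rule main)
qed

end
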